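(* Let $\Omega$ be a fixed closed Riemann surface of positive genus $g>0$. Then for every $n>0$ there is a triangulation $T$ of $\Omega$ with $n \leq |V(T)|$ such that $T$ has a non-degenerated antiferromagnetic groundstate.
   Context: A triangulation of a closed Riemann surface $\Omega$ is an embedding of a graph in $\Omega$ such that each face boundary is a $3$-cycle of the graph. A state (spin-assignment) on a triangulation $T$ is a function $\sigma: V(T)\to\{+1,-1\}$. The antiferromagnetic Ising energy of $\sigma$ is $H(\sigma)=\sum_{uv\in E(T)}\sigma_u\sigma_v$. A groundstate is a state minimizing $H$. Since $H(\sigma)=H(-\sigma)$, groundstates come in pairs $\{\sigma,-\sigma\}$; the groundstate is called non-degenerated if $T$ has exactly two groundstates (i.e. exactly one pair $\sigma,-\sigma$), and degenerated if it has more than two. *)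

theory Defs
  imports "HOL-Analysis.Analysis"
begin

section \<open>Closed Riemann surfaces and their genus\<close>

definition holomorphic_atlas :: "'a topology \<Rightarrow> ('a set \<times> ('a \<Rightarrow> complex)) set \<Rightarrow> bool" where
  "holomorphic_atlas X A \<longleftrightarrow>
     (\<Union>(U, \<phi>)\<in>A. U) = topspace X \<and>
     (\<forall>(U, \<phi>)\<in>A. openin X U \<and> open (\<phi> ` U) \<and>
        homeomorphic_map (subtopology X U) (top_of_set (\<phi> ` U)) \<phi>) \<and>
     (\<forall>(U, \<phi>)\<in>A. \<forall>(W, \<psi>)\<in>A. (\<psi> \<circ> inv_into U \<phi>) holomorphic_on \<phi> ` (U \<inter> W))"

definition closed_riemann_surface :: "'a topology \<Rightarrow> ('a set \<times> ('a \<Rightarrow> complex)) set \<Rightarrow> bool" where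
  "closed_riemann_surface X A \<longleftrightarrow>
     topspace X \<noteq> {} \<and> Hausdorff_space X \<and> compact_space X \<and> connected_space X \<and>
     holomorphic_atlas X A"

text \<open>
  The unit disc is regarded as a polygon with \<open>4 * g\<close> sides: for \<open>j < 4 * g\<close>, side \<open>j\<close> is the arc
  \<open>{polygon_boundary g t | t. j \<le> t \<le> j + 1}\<close> of the unit circle. The sides are glued in pairs
  according to the word $a_1 b_1 a_1^{-1} b_1^{-1} \cdots a_g b_g a_g^{-1} b_g^{-1}$.
\<close>

definition polygon_boundary :: "nat \<Rightarrow> real \<Rightarrow> complex" where
  "polygon_boundary g t = cis (2 * pi * t / real (4 * g))"

definition side_pairing :: "nat \<Rightarrow> (complex \<times> complex) set" where
  "side_pairing g =
     {(polygon_boundary g (real (4 * k) + s), polygon_boundary g (real (4 * k) + 3 - s)) | k s.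
        k < g \<and> s \<in> {0..1}} \<union>
     {(polygon_boundary g (real (4 * k) + 1 + s), polygon_boundary g (real (4 * k) + 4 - s)) | k s.
        k < g \<and> s \<in> {0..1}}"

text \<open>
  The genus is the number of handles: a surface has genus \<open>g > 0\<close> if it is (homeomorphic to) the
  quotient of the polygon with \<open>4 * g\<close> sides by the equivalence relation generated by the side
  pairing, that is, the connected sum of \<open>g\<close> tori; genus \<open>0\<close> means the sphere.
\<close>

definition has_genus :: "'a topology \<Rightarrow> nat \<Rightarrow> bool" where
  "has_genus X g \<longleftrightarrow>
     (if g = 0 then X homeomorphic_space top_of_set (sphere (0 :: real ^ 3) 1)
      else \<exists>q. quotient_map (top_of_set (cball 0 1)) X q \<and>
             (\<forall>x\<in>cball 0 1. \<forall>y\<in>cball 0 1.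
                q x = q y \<longleftrightarrow> (x, y) \<in> (side_pairing g \<union> (side_pairing g)\<inverse>)\<^sup>*))"


section \<open>Triangulations\<close>

text \<open>
  An embedded finite simple graph: the vertices are points of the surface, an edge is a two-element
  set of vertices, and \<open>\<gamma> e\<close> parametrises the simple arc that represents the edge \<open>e\<close>.
\<close>

definition embedded_graph ::
  "'a topology \<Rightarrow> 'a set \<Rightarrow> 'a set set \<Rightarrow> ('a set \<Rightarrow> real \<Rightarrow> 'a) \<Rightarrow> bool" where
  "embedded_graph X V E \<gamma> \<longleftrightarrow>
     finite V \<and> V \<subseteq> topspace X \<and>
     (\<forall>e\<in>E. e \<subseteq> V \<and> card e = 2) \<and>
     (\<forall>e\<in>E. continuous_map (top_of_set {0..1}) X (\<gamma> e) \<and> inj_on (\<gamma> e) {0..1} \<and>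
        {\<gamma> e 0, \<gamma> e 1} = e \<and> \<gamma> e ` {0<..<1} \<inter> V = {}) \<and>
     (\<forall>e\<in>E. \<forall>e'\<in>E. e \<noteq> e' \<longrightarrow> \<gamma> e ` {0<..<1} \<inter> \<gamma> e' ` {0<..<1} = {})"

definition drawn_edges :: "('a set \<Rightarrow> real \<Rightarrow> 'a) \<Rightarrow> 'a set set \<Rightarrow> 'a set" where
  "drawn_edges \<gamma> C = (\<Union>e\<in>C. \<gamma> e ` {0..1})"

definition faces ::
  "'a topology \<Rightarrow> 'a set \<Rightarrow> 'a set set \<Rightarrow> ('a set \<Rightarrow> real \<Rightarrow> 'a) \<Rightarrow> 'a set set" where
  "faces X V E \<gamma> =
     connected_components_of (subtopology X (topspace X - (V \<union> drawn_edges \<gamma> E)))"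

definition three_cycle :: "'a set set \<Rightarrow> 'a set set \<Rightarrow> bool" where
  "three_cycle E C \<longleftrightarrow>
     C \<subseteq> E \<and> (\<exists>u v w. u \<noteq> v \<and> v \<noteq> w \<and> u \<noteq> w \<and> C = {{u, v}, {v, w}, {u, w}})"

text \<open>
  Faces are required to be open discs, as is implicit in speaking of a face being bounded by a
  cycle; otherwise a face bounded by a triangle could carry handles.
\<close>

definition surface_triangulation ::
  "'a topology \<Rightarrow> 'a set \<Rightarrow> 'a set set \<Rightarrow> ('a set \<Rightarrow> real \<Rightarrow> 'a) \<Rightarrow> bool" where
  "surface_triangulation X V E \<gamma> \<longleftrightarrow>
     embedded_graph X V E \<gamma> \<and>
     (\<forall>F\<in>faces X V E \<gamma>.
        subtopology X F homeomorphic_space top_of_set (ball (0 :: complex) 1) \<and>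
        (\<exists>C. three_cycle E C \<and> X frontier_of F = drawn_edges \<gamma> C))"


section \<open>The antiferromagnetic Ising model\<close>

definition states :: "'a set \<Rightarrow> ('a \<Rightarrow> int) set" where
  "states V = V \<rightarrow>\<^sub>E {1, -1}"

text \<open>The product over an edge is \<open>\<sigma> u * \<sigma> v\<close> for \<open>e = {u, v}\<close> with \<open>u \<noteq> v\<close>.\<close>

definition ising_energy :: "'a set set \<Rightarrow> ('a \<Rightarrow> int) \<Rightarrow> int" where
  "ising_energy E \<sigma> = (\<Sum>e\<in>E. \<Prod>v\<in>e. \<sigma> v)"

definition groundstates :: "'a set \<Rightarrow> 'a set set \<Rightarrow> ('a \<Rightarrow> int) set" where
  "groundstates V E =
     {\<sigma> \<in> states V. \<forall>\<tau>\<in>states V. ising_energy E \<sigma> \<le> ising_energy E \<tau>}"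

definition nondegenerate_groundstate :: "'a set \<Rightarrow> 'a set set \<Rightarrow> bool" where
  "nondegenerate_groundstate V E \<longleftrightarrow> card (groundstates V E) = 2"

end

theory Submission
  imports Defs "HOL-Complex_Analysis.Riemann_Mapping"
begin

text \<open>
  Twice the energy of a state is the sum over all triangles of the products along their three edges. Each
  triangle contributes at least \<open>-1\<close>, with equality unless it is monochromatic, so a state without
  monochromatic triangles is a groundstate, and then all groundstates are of this kind.

  The surface is triangulated by straight chords of the polygon with \<open>4 * g\<close> sides, with all vertices on the
  boundary. In the block of sides $a\, b\, a^{-1} b^{-1}$ of a handle, \<open>a\<close> has inner vertices $a_1, a_2$ and \<open>b\<close> has
  inner vertices $b_1, \ldots, b_{5 + 2m}$, and all corners are one vertex \<open>v\<close>. A zigzag of chords near the start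
  of \<open>b\<close> and the chords from $a_1$ and $a_2$ to the two copies of the rest of \<open>b\<close> leave only the triangle
  $v\, a_1 b_1$ open, and already force a state without monochromatic triangles up to sign: if
  $a_1 = a_2$ the zigzag gives a contradiction, and if $a_1 \neq a_2$ the spins alternate along the rest of
  \<open>b\<close>, which determines the zigzag. The sign is common to all handles because they share \<open>v\<close>. The number
  \<open>m\<close> is arbitrary.
\<close>

section \<open>Chords of the unit circle\<close>

text \<open>The obstacle is that the glued graph has to be simple. In the quotient an inner point of
  a side has two positions on the circle and the vertex v has \<open>4 * g\<close>, so chords that
  are far apart in the disc can acquire the same ends. This is excluded by labelling the vertices
  and recovering every chord and every side from the labels of its ends. Two inner vertices are the
  fewest that keep the closed curve a from being a loop or a double edge. The length of b comes from
  parity. The fans at a_1 and a_2 share the path b_5, ..., b_(5+2m), v. If a_1 and a_2 have opposite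
  spins, no two neighbours on it agree, and its 1 + 2m steps give b_5 the spin opposite to v. With
  this relation the spins of v, a_1, a_2, b_1, ..., b_5 form a finite problem that depends neither
  on m nor on the handle. Its solution is the parity of the labels. With all vertices on the circle,
  a triangulation is a binary tree, and disjointness and covering of the faces reduce to the signs
  of one affine function per chord.\<close>

definition chord_side :: "real \<Rightarrow> real \<Rightarrow> complex \<Rightarrow> real" where
  "chord_side \<alpha> \<beta> z = Re (z * cis (- ((\<alpha> + \<beta>) / 2))) - cos ((\<beta> - \<alpha>) / 2)"

text \<open>\<open>chord_side \<alpha> \<beta>\<close> is the signed distance from the line through
  \<open>cis \<alpha>\<close> and \<open>cis \<beta>\<close>. The product form shows that, for
  \<open>\<alpha> < \<beta>\<close> and \<open>\<beta> < \<alpha> + 2 * pi\<close>, it is positive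
  on the open arc from \<alpha> to \<beta> and negative on the complementary open arc.\<close>

lemma chord_side_cis:
  "chord_side \<alpha> \<beta> (cis \<phi>) = 2 * sin ((\<phi> - \<alpha>) / 2) * sin ((\<beta> - \<phi>) / 2)"
proof -
  have "chord_side \<alpha> \<beta> (cis \<phi>) = cos (\<phi> - (\<alpha> + \<beta>) / 2) - cos ((\<beta> - \<alpha>) / 2)"
    by (simp add: chord_side_def cis_mult)
  also have "\<dots> = 2 * sin ((\<phi> - \<alpha>) / 2) * sin ((\<beta> - \<phi>) / 2)"
  proof -
    have "(\<phi> - (\<alpha> + \<beta>) / 2 + (\<beta> - \<alpha>) / 2) / 2 = (\<phi> - \<alpha>) / 2"
      "((\<beta> - \<alpha>) / 2 - (\<phi> - (\<alpha> + \<beta>) / 2)) / 2 = (\<beta> - \<phi>) / 2"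
      by (simp_all add: field_simps)
    then show ?thesis by (simp only: cos_diff_cos)
  qed
  finally show ?thesis .
qed

lemma chord_side_ends [simp]: "chord_side \<alpha> \<beta> (cis \<alpha>) = 0" "chord_side \<alpha> \<beta> (cis \<beta>) = 0"
  by (simp_all add: chord_side_cis)

lemma chord_side_arc_pos:
  assumes "\<alpha> < \<phi>" "\<phi> < \<beta>" "\<beta> < \<alpha> + 2 * pi"
  shows "chord_side \<alpha> \<beta> (cis \<phi>) > 0"
  using assms by (auto simp: chord_side_cis intro!: mult_pos_pos sin_gt_zero)

lemma chord_side_arc_neg:
  assumes "\<alpha> < \<beta>" "\<beta> < \<phi>" "\<phi> < \<alpha> + 2 * pi"
  shows "chord_side \<alpha> \<beta> (cis \<phi>) < 0"
proof -
  have "sin ((\<phi> - \<alpha>) / 2) > 0" "sin ((\<phi> - \<beta>) / 2) > 0"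
    using assms by (auto intro!: sin_gt_zero)
  moreover have "sin ((\<beta> - \<phi>) / 2) = - sin ((\<phi> - \<beta>) / 2)"
    by (metis minus_diff_eq minus_divide_left sin_minus)
  ultimately show ?thesis
    by (simp add: chord_side_cis mult_pos_neg)
qed

lemma chord_side_arc_nonpos:
  assumes "\<alpha> < \<beta>" "\<beta> \<le> \<phi>" "\<phi> \<le> \<alpha> + 2 * pi"
  shows "chord_side \<alpha> \<beta> (cis \<phi>) \<le> 0"
proof -
  have "cis (\<alpha> + 2 * pi) = cis \<alpha>" by (simp add: complex_eq_iff)
  then show ?thesis
    using chord_side_arc_neg[of \<alpha> \<beta> \<phi>] assms
    by (cases "\<phi> = \<beta> \<or> \<phi> = \<alpha> + 2 * pi") force+
qed

text \<open>The same chord is seen from the complementary arc: a full turn changes the half angles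
  by pi, hence the sign.\<close>

lemma chord_side_swap: "chord_side \<beta> (\<alpha> + 2 * pi) z = - chord_side \<alpha> \<beta> z"
proof -
  have "cis (- ((\<beta> + (\<alpha> + 2 * pi)) / 2)) = - cis (- ((\<alpha> + \<beta>) / 2))"
  proof -
    have "- ((\<beta> + (\<alpha> + 2 * pi)) / 2) = - ((\<alpha> + \<beta>) / 2) - pi" by (simp add: field_simps)
    then show ?thesis by (simp add: complex_eq_iff cos_diff sin_diff)
  qed
  moreover have "cos ((\<alpha> + 2 * pi - \<beta>) / 2) = - cos ((\<beta> - \<alpha>) / 2)"
  proof -
    have "(\<alpha> + 2 * pi - \<beta>) / 2 = pi - (\<beta> - \<alpha>) / 2" by (simp add: field_simps)
    then show ?thesis by (simp only: cos_pi_minus)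
  qed
  ultimately show ?thesis by (simp add: chord_side_def)
qed

lemma chord_side_convex_comb:
  assumes "u + v = 1"
  shows "chord_side \<alpha> \<beta> (of_real u * z + of_real v * w) = u * chord_side \<alpha> \<beta> z + v * chord_side \<alpha> \<beta> w"
proof -
  have "cos ((\<beta> - \<alpha>) / 2) = (u + v) * cos ((\<beta> - \<alpha>) / 2)" using assms by simp
  then show ?thesis unfolding chord_side_def by (simp add: algebra_simps)
qed

lemma chord_side_scaleR_comb:
  assumes "u + v = 1"
  shows "chord_side \<alpha> \<beta> (u *\<^sub>R z + v *\<^sub>R w) = u * chord_side \<alpha> \<beta> z + v * chord_side \<alpha> \<beta> w"
  using chord_side_convex_comb[OF assms] by (simp add: scaleR_conv_of_real)

lemma continuous_chord_side [continuous_intros]: "continuous_on S (chord_side \<alpha> \<beta>)"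
  unfolding chord_side_def by (intro continuous_intros)

lemma convex_chord_side_less: "convex {z. chord_side \<alpha> \<beta> z < 0}"
  unfolding convex_def
  by (auto simp: chord_side_scaleR_comb)
    (metis add_neg_neg add_cancel_left_left add_cancel_right_right less_eq_real_def
      mult_neg_pos mult_zero_left mult.commute zero_neq_one)

text \<open>Rotating the midpoint of the arc to the angle 0 turns the line into
  \<open>Re w = cos h\<close>, from which the disc cuts the segment where Im w lies between
  \<open>- sin h\<close> and \<open>sin h\<close>.\<close>

lemma chord_side_eq_0_iff:
  assumes "\<alpha> < \<beta>" "\<beta> < \<alpha> + 2 * pi"
  shows "norm z \<le> 1 \<and> chord_side \<alpha> \<beta> z = 0 \<longleftrightarrow> z \<in> closed_segment (cis \<alpha>) (cis \<beta>)"
proof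
  assume z: "norm z \<le> 1 \<and> chord_side \<alpha> \<beta> z = 0"
  define m h where "m = (\<alpha> + \<beta>) / 2" and "h = (\<beta> - \<alpha>) / 2"
  define w where "w = z * cis (- m)"
  have sh: "sin h > 0" using assms by (auto simp: h_def intro!: sin_gt_zero)
  have Re: "Re w = cos h" using z by (simp add: chord_side_def w_def m_def h_def)
  have "norm w \<le> 1" using z by (simp add: w_def norm_mult)
  then have "(norm w)\<^sup>2 \<le> 1" by (simp add: power_le_one)
  then have "(Im w)\<^sup>2 \<le> (sin h)\<^sup>2"
    using Re by (simp add: cmod_power2 sin_squared_eq)
  then have Im: "\<bar>Im w\<bar> \<le> sin h" using sh by (metis abs_le_square_iff abs_of_pos)
  define u where "u = (Im w / sin h + 1) / 2"
  have u: "0 \<le> u" "u \<le> 1"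
    using Im sh by (auto simp: u_def field_simps abs_le_iff)
  have "w = (1 - u) *\<^sub>R cis (- h) + u *\<^sub>R cis h"
    using Re sh by (simp add: complex_eq_iff u_def field_simps)
  moreover have "z = w * cis m" by (simp add: w_def cis_mult mult.assoc)
  ultimately have "z = ((1 - u) *\<^sub>R cis (- h) + u *\<^sub>R cis h) * cis m" by simp
  also have "\<dots> = (1 - u) *\<^sub>R cis \<alpha> + u *\<^sub>R cis \<beta>"
  proof -
    have "m - h = \<alpha>" "m + h = \<beta>" by (simp_all add: m_def h_def field_simps)
    then show ?thesis by (simp add: algebra_simps cis_mult scaleR_conv_of_real)
  qed
  finally show "z \<in> closed_segment (cis \<alpha>) (cis \<beta>)"
    using u by (auto simp: closed_segment_def)
next
  assume "z \<in> closed_segment (cis \<alpha>) (cis \<beta>)"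
  then obtain u where u: "0 \<le> u" "u \<le> 1" "z = (1 - u) *\<^sub>R cis \<alpha> + u *\<^sub>R cis \<beta>"
    by (auto simp: closed_segment_def)
  have "z \<in> cball 0 1"
    using u convexD[OF convex_cball[of 0 1], of "cis \<alpha>" "cis \<beta>" "1 - u" u] by simp
  moreover have "chord_side \<alpha> \<beta> z = 0" using u by (simp add: chord_side_scaleR_comb)
  ultimately show "norm z \<le> 1 \<and> chord_side \<alpha> \<beta> z = 0" by simp
qed

lemma open_segment_cis_subset_ball:
  shows "open_segment (cis \<alpha>) (cis \<beta>) \<subseteq> ball 0 1"
proof
  fix z assume z: "z \<in> open_segment (cis \<alpha>) (cis \<beta>)"
  have "z \<in> cball 0 1"
    using z closed_segment_subset[OF _ _ convex_cball, of "cis \<alpha>" 0 1 "cis \<beta>"]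
    by (auto simp: open_segment_def)
  moreover have "norm z \<noteq> 1"
    using different_norm_3_collinear_points[of z "cis \<alpha>" "cis \<beta>"] z by auto
  ultimately show "z \<in> ball 0 1" by simp
qed

lemma Re_mult_cis_less:
  assumes "norm z < 1" shows "Re (z * cis \<phi>) < 1"
  using complex_Re_le_cmod[of "z * cis \<phi>"] assms by (simp add: norm_mult)

text \<open>After the common end is rotated to 1, every chord function from it is
  \<open>x * cos d + y * sin d\<close> with d half the arc length, and \<open>x < 0\<close> inside
  the disc. Eliminating y between the two chords leaves the positive term
  \<open>(- x) * sin (c - b)\<close>.\<close>

lemma chord_side_nested_left:
  assumes "\<alpha> < \<beta>" "\<beta> < \<gamma>" "\<gamma> < \<alpha> + 2 * pi" "norm z < 1" "chord_side \<alpha> \<beta> z \<ge> 0"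
  shows "chord_side \<alpha> \<gamma> z > 0"
proof -
  define b c where "b = (\<beta> - \<alpha>) / 2" and "c = (\<gamma> - \<alpha>) / 2"
  define x y where "x = Re (z * cis (- \<alpha>)) - 1" and "y = Im (z * cis (- \<alpha>))"
  have *: "chord_side \<alpha> \<delta> z = x * cos ((\<delta> - \<alpha>) / 2) + y * sin ((\<delta> - \<alpha>) / 2)" for \<delta>
  proof -
    have "cis (- ((\<alpha> + \<delta>) / 2)) = cis (- \<alpha>) * cis (- ((\<delta> - \<alpha>) / 2))"
    proof -
      have "- \<alpha> + - ((\<delta> - \<alpha>) / 2) = - ((\<alpha> + \<delta>) / 2)" by (simp add: field_simps)
      then show ?thesis by (simp only: cis_mult)
    qed
    then show ?thesis
      unfolding chord_side_def x_def y_def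
      by (simp add: algebra_simps)
  qed
  have "x < 0" using Re_mult_cis_less[OF assms(4), of "- \<alpha>"] by (simp add: x_def)
  have s: "sin b > 0" "sin c > 0" "sin (c - b) > 0"
    using assms by (auto simp: b_def c_def field_simps intro!: sin_gt_zero)
  have "sin b * chord_side \<alpha> \<gamma> z = sin c * chord_side \<alpha> \<beta> z + (- x) * sin (c - b)"
    by (simp add: * sin_diff algebra_simps flip: b_def c_def)
  also have "\<dots> > 0"
    using assms(5) s \<open>x < 0\<close> by (intro add_nonneg_pos mult_nonneg_nonneg mult_pos_pos) auto
  finally show ?thesis using s by (simp add: zero_less_mult_iff)
qed

lemma chord_side_cnj: "chord_side (- \<beta>) (- \<alpha>) (cnj z) = chord_side \<alpha> \<beta> z"
proof -
  have "- ((- \<beta> + - \<alpha>) / 2) = (\<alpha> + \<beta>) / 2" "(- \<alpha> - - \<beta>) / 2 = (\<beta> - \<alpha>) / 2"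
    by (simp_all add: field_simps)
  then show ?thesis by (simp only: chord_side_def) simp
qed

lemma chord_side_nested_right:
  assumes "\<alpha> < \<beta>" "\<beta> < \<gamma>" "\<gamma> < \<alpha> + 2 * pi" "norm z < 1" "chord_side \<beta> \<gamma> z \<ge> 0"
  shows "chord_side \<alpha> \<gamma> z > 0"
  using chord_side_nested_left[of "- \<gamma>" "- \<beta>" "- \<alpha>" "cnj z"] assms by (simp add: chord_side_cnj)

text \<open>This is nesting seen from the other side: the arc complementary to the one from \<alpha>
  to \<beta> runs from \<beta> to \<open>\<alpha> + 2 * pi\<close> and contains the arc from \<beta>
  to \<gamma>.\<close>

lemma chord_side_disjoint:
  assumes "\<alpha> < \<beta>" "\<beta> < \<gamma>" "\<gamma> < \<alpha> + 2 * pi" "norm z < 1" "chord_side \<beta> \<gamma> z \<ge> 0"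
  shows "chord_side \<alpha> \<beta> z < 0"
  using chord_side_nested_left[of \<beta> \<gamma> "\<alpha> + 2 * pi" z] assms chord_side_swap[of \<beta> \<alpha> z] by simp

section \<open>Triangulations of a convex polygon as binary trees\<close>

lemma cis_eq_imp_eq:
  assumes "cis x = cis y" "\<bar>x - y\<bar> < 2 * pi"
  shows "x = y"
proof -
  have "cis (x - y) = 1" using assms(1) by (metis cis_divide cis_neq_zero divide_self)
  then have "cos (x - y) = 1" by (simp add: complex_eq_iff)
  then obtain n :: int where n: "x - y = of_int n * 2 * pi" by (auto simp: cos_one_2pi_int)
  then have "\<bar>of_int n\<bar> * (2 * pi) < 1 * (2 * pi)" using assms(2) by (simp add: abs_mult)
  then have "\<bar>of_int n :: real\<bar> < 1" using mult_less_cancel_right_pos pi_gt_zero by force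
  then have "n = 0" by linarith
  then show ?thesis using n by simp
qed

text \<open>The usual correspondence between binary trees and triangulations of polygons. A tree
  placed at i triangulates the polygon with corners i, ..., \<open>i + width T\<close>; a leaf is a
  side, and a node is the triangle formed by the bases of its two subtrees and its own base.\<close>

datatype ptree = Side | Tri ptree ptree

primrec width :: "ptree \<Rightarrow> nat" where
  "width Side = 1"
| "width (Tri l r) = width l + width r"

primrec triangles :: "nat \<Rightarrow> ptree \<Rightarrow> (nat \<times> nat \<times> nat) set" where
  "triangles i Side = {}"
| "triangles i (Tri l r) = insert (i, i + width l, i + width l + width r)
     (triangles i l \<union> triangles (i + width l) r)"

text \<open>Sides are left out, but the base of a tree other than a leaf is included, because the
  tree sits inside a larger polygon.\<close>

primrec chords :: "nat \<Rightarrow> ptree \<Rightarrow> (nat \<times> nat) set" where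
  "chords i Side = {}"
| "chords i (Tri l r) = insert (i, i + width l + width r) (chords i l \<union> chords (i + width l) r)"

lemma width_pos [simp]: "width T > 0" "width T \<noteq> 0"
  by (induction T) auto

lemma width_eq_1_iff: "width T = Suc 0 \<longleftrightarrow> T = Side"
  by (cases T) (auto simp: add_is_1)

lemma triangles_bounds:
  "(a, b, c) \<in> triangles i T \<Longrightarrow> i \<le> a \<and> a < b \<and> b < c \<and> c \<le> i + width T"
proof (induction T arbitrary: i)
  case (Tri l r)
  have "0 < width l" "0 < width r" by simp_all
  then show ?case using Tri.prems Tri.IH(1)[of i] Tri.IH(2)[of "i + width l"]
    unfolding triangles.simps width.simps by (elim insertE UnE) (simp, linarith+)
qed simp

lemma chords_bounds:
  "(a, b) \<in> chords i T \<Longrightarrow> i \<le> a \<and> a + 1 < b \<and> b \<le> i + width T"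
proof (induction T arbitrary: i)
  case (Tri l r)
  have "Suc 0 < width l + width r" using width_pos(1)[of l] width_pos(1)[of r] by linarith
  then show ?case using Tri.prems Tri.IH(1)[of i] Tri.IH(2)[of "i + width l"]
    unfolding chords.simps width.simps by (elim insertE UnE) auto
qed simp

lemma finite_triangles [simp]: "finite (triangles i T)"
  by (induction T arbitrary: i) auto

lemma finite_chords [simp]: "finite (chords i T)"
  by (induction T arbitrary: i) auto

lemma triangle_edges:
  assumes "(a, b, c) \<in> triangles i T"
  shows "(a, c) \<in> chords i T" "b = a + 1 \<or> (a, b) \<in> chords i T" "c = b + 1 \<or> (b, c) \<in> chords i T"
proof -
  have root: "T = Side \<or> (i, i + width T) \<in> chords i T" for i T by (cases T) auto
  have "(a, c) \<in> chords i T \<and> (b = a + 1 \<or> (a, b) \<in> chords i T) \<and> (c = b + 1 \<or> (b, c) \<in> chords i T)"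
    using assms
  proof (induction T arbitrary: i)
    case (Tri l r)
    then show ?case using root[of l i] root[of r "i + width l"] by auto
  qed auto
  then show "(a, c) \<in> chords i T" "b = a + 1 \<or> (a, b) \<in> chords i T" "c = b + 1 \<or> (b, c) \<in> chords i T"
    by auto
qed

text \<open>The angles are indexed by all natural numbers, N steps being one turn, so that an arc
  through the origin is an interval \<open>(k, i + N)\<close> and no reduction modulo N
  occurs.\<close>

locale circle_points =
  fixes N :: nat and \<theta> :: "nat \<Rightarrow> real"
  assumes mono_\<theta>: "strict_mono \<theta>"
    and period_\<theta>: "\<theta> (p + N) = \<theta> p + 2 * pi"
begin

definition pt :: "nat \<Rightarrow> complex" where "pt p = cis (\<theta> p)"

text \<open>Chords are straight, but a side runs along the circle, where the gluing takes
  place.\<close>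

definition edge_path :: "nat \<Rightarrow> nat \<Rightarrow> real \<Rightarrow> complex" where
  "edge_path a b u =
     (if b = a + 1 then cis ((1 - u) * \<theta> a + u * \<theta> b) else (1 - u) *\<^sub>R pt a + u *\<^sub>R pt b)"

abbreviation arc :: "nat \<Rightarrow> nat \<Rightarrow> complex set" where
  "arc a b \<equiv> edge_path a b ` {0..1}"

abbreviation open_arc :: "nat \<Rightarrow> nat \<Rightarrow> complex set" where
  "open_arc a b \<equiv> edge_path a b ` {0<..<1}"

abbreviation cside :: "nat \<Rightarrow> nat \<Rightarrow> complex \<Rightarrow> real" where
  "cside a b \<equiv> chord_side (\<theta> a) (\<theta> b)"

text \<open>An interval of length one is a side of the polygon: it imposes no condition, so that the circular
  segment beyond it belongs to the adjacent face.\<close>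

definition half :: "nat \<Rightarrow> nat \<Rightarrow> complex set" where
  "half a b = {z. b = a + 1 \<or> cside a b z < 0}"

text \<open>The third edge enters as \<open>(k, i + N)\<close>, the arc that avoids j, so that all
  three conditions keep the point on the near side of an edge and the definition is cyclically
  symmetric.\<close>

definition region :: "nat \<Rightarrow> nat \<Rightarrow> nat \<Rightarrow> complex set" where
  "region i j k = ball 0 1 \<inter> half i j \<inter> half j k \<inter> half k (i + N)"

lemma \<theta>_less [simp]: "\<theta> a < \<theta> b \<longleftrightarrow> a < b"
  using mono_\<theta> strict_mono_less by blast

lemma \<theta>_le [simp]: "\<theta> a \<le> \<theta> b \<longleftrightarrow> a \<le> b"
  using mono_\<theta> strict_mono_less_eq by blast

lemma \<theta>_less_wrap: "\<theta> b < \<theta> a + 2 * pi \<longleftrightarrow> b < a + N"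
  using \<theta>_less[of b "a + N"] by (simp only: period_\<theta>)

lemma \<theta>_le_wrap: "\<theta> b \<le> \<theta> a + 2 * pi \<longleftrightarrow> b \<le> a + N"
  using \<theta>_le[of b "a + N"] by (simp only: period_\<theta>)

lemma pt_period [simp]: "pt (p + N) = pt p"
  by (simp add: pt_def period_\<theta> complex_eq_iff)

lemma norm_pt [simp]: "norm (pt p) = 1"
  by (simp add: pt_def)

lemma cside_swap: "cside k (i + N) z = - cside i k z"
  by (simp add: period_\<theta> chord_side_swap)

lemma edge_path_ends [simp]: "edge_path a b 0 = pt a" "edge_path a b 1 = pt b"
  by (simp_all add: edge_path_def pt_def)

lemma continuous_edge_path: "continuous_on S (edge_path a b)"
  by (cases "b = a + 1") (auto simp: edge_path_def intro!: continuous_intros)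

lemma cside_pt_nonpos:
  assumes "a < b" "b \<le> c" "c \<le> a + N"
  shows "cside a b (pt c) \<le> 0"
  using assms unfolding pt_def by (intro chord_side_arc_nonpos) (auto simp: \<theta>_le_wrap)

lemma cside_pt_neg:
  assumes "a < b" "b < c" "c < a + N"
  shows "cside a b (pt c) < 0"
  using assms unfolding pt_def by (intro chord_side_arc_neg) (auto simp: \<theta>_less_wrap)

lemma pt_neq:
  assumes "a < b" "b < a + N"
  shows "pt a \<noteq> pt b"
  using cis_eq_imp_eq[of "\<theta> a" "\<theta> b"] assms \<theta>_less[of a b] \<theta>_less_wrap[of b a] unfolding pt_def by force

lemma edge_path_image_chord:
  assumes "a + 1 < b"
  shows "arc a b = closed_segment (pt a) (pt b)"
  using assms by (auto simp: edge_path_def closed_segment_def image_iff)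

lemma edge_path_open_image_chord:
  assumes "a + 1 < b" "b < a + N"
  shows "open_arc a b = open_segment (pt a) (pt b)"
  using assms pt_neq[of a b] by (auto simp: edge_path_def open_segment_image_interval)

lemma edge_path_chord_iff:
  assumes "a + 1 < b" "b < a + N"
  shows "z \<in> arc a b \<longleftrightarrow> norm z \<le> 1 \<and> cside a b z = 0"
  using assms chord_side_eq_0_iff[of "\<theta> a" "\<theta> b" z]
  by (simp add: edge_path_image_chord \<theta>_less_wrap) (simp add: pt_def)

lemma edge_path_open_chord:
  assumes "a + 1 < b" "b < a + N" "z \<in> open_arc a b"
  shows "norm z < 1" "cside a b z = 0"
proof -
  have "z \<in> ball 0 1"
    using assms open_segment_cis_subset_ball edge_path_open_image_chord unfolding pt_def by blast
  then show "norm z < 1" by simp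
  have "z \<in> arc a b" using assms by force
  then show "cside a b z = 0" using edge_path_chord_iff assms by blast
qed

lemma edge_path_arc_image:
  "arc a (Suc a) = cis ` {\<theta> a..\<theta> (Suc a)}"
  "open_arc a (Suc a) = cis ` {\<theta> a<..<\<theta> (Suc a)}"
proof -
  have *: "edge_path a (Suc a) ` S = cis ` ((\<lambda>u. (1 - u) * \<theta> a + u * \<theta> (Suc a)) ` S)" for S
    by (simp add: edge_path_def image_image)
  have "(\<lambda>u. (1 - u) * \<theta> a + u * \<theta> (Suc a)) ` {0..1} = {\<theta> a..\<theta> (Suc a)}"
    using closed_segment_image_interval[of "\<theta> a" "\<theta> (Suc a)"]
    by (simp add: closed_segment_eq_real_ivl)
  then show "arc a (Suc a) = cis ` {\<theta> a..\<theta> (Suc a)}"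
    unfolding * by (rule arg_cong)
  have "(\<lambda>u. (1 - u) * \<theta> a + u * \<theta> (Suc a)) ` {0<..<1} = {\<theta> a<..<\<theta> (Suc a)}"
  proof -
    have "\<theta> a < \<theta> (Suc a)" by simp
    then show ?thesis
      using open_segment_image_interval[of "\<theta> a" "\<theta> (Suc a)"]
      by (simp add: open_segment_eq_real_ivl del: \<theta>_less)
  qed
  then show "open_arc a (Suc a) = cis ` {\<theta> a<..<\<theta> (Suc a)}"
    unfolding * by (rule arg_cong)
qed

lemma edge_path_in_cball: "u \<in> {0..1} \<Longrightarrow> edge_path a b u \<in> cball 0 1"
proof -
  assume u: "u \<in> {0..1}"
  show ?thesis
  proof (cases "b = a + 1")
    case False
    then show ?thesis
      using u convexD[OF convex_cball[of 0 1], of "pt a" "pt b" "1 - u" u]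
      by (simp add: edge_path_def)
  qed (simp add: edge_path_def)
qed

lemma inj_on_edge_path:
  assumes "a < b" "b < a + N"
  shows "inj_on (edge_path a b) {0..1}"
proof (cases "b = a + 1")
  case True
  show ?thesis
  proof
    fix u v :: real assume uv: "u \<in> {0..1}" "v \<in> {0..1}" "edge_path a b u = edge_path a b v"
    define x where "x = \<theta> b - \<theta> a"
    have x: "0 < x" "x < 2 * pi" using assms \<theta>_less_wrap[of b a] by (auto simp: x_def)
    have "cis (\<theta> a + u * x) = cis (\<theta> a + v * x)"
      using uv(3) True by (simp add: edge_path_def x_def algebra_simps)
    moreover have "\<bar>(u - v) * x\<bar> \<le> 1 * x"
      unfolding abs_mult using uv x by (intro mult_mono) auto
    then have "\<bar>(\<theta> a + u * x) - (\<theta> a + v * x)\<bar> < 2 * pi" using x by (simp add: left_diff_distrib)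
    ultimately have "\<theta> a + u * x = \<theta> a + v * x" by (rule cis_eq_imp_eq)
    then show "u = v" using x by simp
  qed
next
  case False
  show ?thesis
  proof
    fix u v :: real assume "edge_path a b u = edge_path a b v"
    then have "(u - v) *\<^sub>R (pt b - pt a) = 0" using False by (simp add: edge_path_def algebra_simps)
    then show "u = v" using pt_neq[OF assms] by simp
  qed
qed

end

section \<open>Closures and boundaries of the triangular regions\<close>

lemma obtain_angle:
  assumes "norm z = 1"
  obtains \<phi> where "z = cis \<phi>" "\<alpha> \<le> \<phi>" "\<phi> < \<alpha> + 2 * pi"
proof -
  define w where "w = z * cis (- \<alpha>)"
  have "norm w = 1" using assms by (simp add: w_def norm_mult)
  then have "w = cis (Arg2pi w)" using Arg2pi_eq[of w] by (simp add: cis_conv_exp mult.commute)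
  moreover have "z = w * cis \<alpha>" by (simp add: w_def cis_mult mult.assoc)
  ultimately have "z = cis (Arg2pi w + \<alpha>)" by (metis cis_mult)
  then show ?thesis
    using that[of "Arg2pi w + \<alpha>"] Arg2pi_ge_0[of w] Arg2pi_lt_2pi[of w] by simp
qed

lemma chord_side_average:
  "chord_side \<alpha> \<beta> ((1/3) *\<^sub>R (x + y + z)) = (chord_side \<alpha> \<beta> x + chord_side \<alpha> \<beta> y + chord_side \<alpha> \<beta> z) / 3"
  by (simp add: chord_side_def algebra_simps add_divide_distrib diff_divide_distrib)

context circle_points
begin

definition chalf :: "nat \<Rightarrow> nat \<Rightarrow> complex set" where
  "chalf a b = {z. b = a + 1 \<or> cside a b z \<le> 0}"

lemma open_half: "open (half a b)"
  by (cases "b = a + 1") (auto simp: half_def intro!: open_Collect_less continuous_intros)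

lemma convex_half: "convex (half a b)"
  by (cases "b = a + 1") (auto simp: half_def convex_chord_side_less)

lemma closed_chalf: "closed (chalf a b)"
  by (cases "b = a + 1") (auto simp: chalf_def intro!: closed_Collect_le continuous_intros)

lemma open_region: "open (region i j k)"
  unfolding region_def by (intro open_Int open_ball open_half)

lemma convex_region: "convex (region i j k)"
  unfolding region_def by (intro convex_Int convex_ball convex_half)

lemma region_subset_ball: "region i j k \<subseteq> ball 0 1"
  unfolding region_def by blast

lemma norm_region: "z \<in> region i j k \<Longrightarrow> norm z < 1"
  by (simp add: region_def)

lemma half_shift: "half (a + N) (b + N) = half a b"
proof -
  have "cside (a + N) (b + N) z = cside a b z" for z
    using cside_swap[of "a + N" b z] cside_swap[of b a z] by simp
  then show ?thesis by (auto simp: half_def)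
qed

lemma region_rotate: "region j k (i + N) = region i j k"
  unfolding region_def half_shift by blast

lemma cside_pt_ends [simp]: "cside a b (pt a) = 0" "cside a b (pt b) = 0"
  by (simp_all add: pt_def)

text \<open>Each edge function is affine and vanishes at two of the three corners, so at the
  centroid it is a third of its negative value at the remaining corner.\<close>

lemma centroid_in_region:
  assumes "i < j" "j < k" "k < i + N"
  shows "(1/3) *\<^sub>R (pt i + pt j + pt k) \<in> region i j k"
proof -
  let ?c = "(1/3) *\<^sub>R (pt i + pt j + pt k)"
  define m where "m = (1/2) *\<^sub>R pt i + (1/2) *\<^sub>R pt j"
  have "m \<in> open_segment (pt i) (pt j)"
    using pt_neq[of i j] assms by (auto simp: m_def in_segment intro!: exI[of _ "1/2"])
  then have "norm m < 1" using open_segment_cis_subset_ball unfolding pt_def by fastforce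
  have "?c = (2/3) *\<^sub>R m + (1/3) *\<^sub>R pt k" by (simp add: m_def algebra_simps)
  then have "norm ?c \<le> (2/3) * norm m + 1/3"
    using norm_triangle_ineq[of "(2/3) *\<^sub>R m" "(1/3) *\<^sub>R pt k"] by simp
  then have "norm ?c < 1" using \<open>norm m < 1\<close> by simp
  moreover have "cside i j ?c < 0"
    using cside_pt_neg[of i j k] assms unfolding chord_side_average by simp
  moreover have "cside j k ?c < 0"
    using cside_pt_neg[of j k "i + N"] assms unfolding chord_side_average by simp
  moreover have "cside k (i + N) ?c < 0"
  proof -
    have "cside k (i + N) (pt i) = 0" using cside_pt_ends(2)[of k "i + N"] by simp
    then show ?thesis
      using cside_pt_neg[of k "i + N" "j + N"] assms unfolding chord_side_average by simp
  qed
  ultimately show ?thesis by (simp add: region_def half_def)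
qed

text \<open>The segment from a point of the closed set to the centroid lies in the region apart from
  its first point, since a weak and a strict inequality average to a strict one.\<close>

lemma closure_region:
  assumes "i < j" "j < k" "k < i + N"
  shows "closure (region i j k) = cball 0 1 \<inter> chalf i j \<inter> chalf j k \<inter> chalf k (i + N)"
    (is "_ = ?R")
proof
  have "region i j k \<subseteq> ?R" by (auto simp: region_def half_def chalf_def)
  moreover have "closed ?R" by (intro closed_Int closed_chalf closed_cball)
  ultimately show "closure (region i j k) \<subseteq> ?R" by (rule closure_minimal)
  show "?R \<subseteq> closure (region i j k)"
  proof
    fix z assume z: "z \<in> ?R"
    define c where "c = (1/3) *\<^sub>R (pt i + pt j + pt k)"
    have c: "c \<in> region i j k" using centroid_in_region[OF assms] by (simp add: c_def)
    show "z \<in> closure (region i j k)"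
    proof (cases "z = c")
      case False
      have "open_segment z c \<subseteq> region i j k"
      proof
        fix w assume "w \<in> open_segment z c"
        then obtain u where u: "0 < u" "u < 1" "w = (1 - u) *\<^sub>R z + u *\<^sub>R c"
          by (auto simp: in_segment)
        have "norm w \<le> (1 - u) * norm z + u * norm c"
          using u norm_triangle_ineq[of "(1 - u) *\<^sub>R z" "u *\<^sub>R c"] by simp
        also have "\<dots> \<le> (1 - u) * 1 + u * norm c"
          using u z by (intro add_mono mult_left_mono) auto
        also have "\<dots> < (1 - u) * 1 + u * 1"
          using u c norm_region by (intro add_strict_left_mono mult_strict_left_mono) auto
        finally have "norm w < 1" by simp
        moreover have "w \<in> half a b" if "z \<in> chalf a b" "c \<in> half a b" for a b
        proof -
          have "cside a b w = (1 - u) * cside a b z + u * cside a b c"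
            using u by (simp add: chord_side_scaleR_comb)
          moreover have "(1 - u) * cside a b z \<le> 0" "u * cside a b c < 0" if "b \<noteq> a + 1"
            using that u \<open>z \<in> chalf a b\<close> \<open>c \<in> half a b\<close>
            by (auto simp: chalf_def half_def mult_nonneg_nonpos mult_pos_neg)
          ultimately show ?thesis unfolding half_def by fastforce
        qed
        ultimately show "w \<in> region i j k" using z c by (auto simp: region_def)
      qed
      then have "closure (open_segment z c) \<subseteq> closure (region i j k)" by (rule closure_mono)
      then show ?thesis using False by auto
    qed (use c closure_subset in auto)
  qed
qed

lemma cside_arc_nonpos:
  assumes "a < b" "b \<le> c" "d \<le> a + N" "\<theta> c \<le> \<phi>" "\<phi> \<le> \<theta> d"
  shows "cside a b (cis \<phi>) \<le> 0"
proof -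
  have "\<theta> b \<le> \<theta> c" "\<theta> d \<le> \<theta> a + 2 * pi" using assms by (simp_all add: \<theta>_le_wrap)
  then show ?thesis using assms by (intro chord_side_arc_nonpos) (auto simp del: \<theta>_le)
qed

text \<open>One edge is enough, as \<open>region_rotate\<close> carries the result to the other
  two.\<close>

lemma edge_path_subset_boundary:
  assumes "i < j" "j < k" "k < i + N"
  shows "arc i j \<subseteq> closure (region i j k) - region i j k"
proof
  fix z assume z: "z \<in> arc i j"
  have "norm z \<le> 1" using z edge_path_in_cball by auto
  show "z \<in> closure (region i j k) - region i j k"
  proof (cases "j = i + 1")
    case True
    then obtain \<phi> where \<phi>: "z = cis \<phi>" "\<theta> i \<le> \<phi>" "\<phi> \<le> \<theta> j"
      using z edge_path_arc_image(1)[of i] by auto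
    \<comment> \<open>The angle is raised by one turn to fall into the windows of the other two
      edges, which start at j and at k.\<close>
    have z': "z = cis (\<phi> + 2 * pi)" by (simp add: \<phi> complex_eq_iff)
    have "\<theta> (i + N) \<le> \<phi> + 2 * pi" "\<phi> + 2 * pi \<le> \<theta> (j + N)" using \<phi> by (simp_all add: period_\<theta>)
    then have "cside j k z \<le> 0" "cside k (i + N) z \<le> 0"
      unfolding z' using assms
      by (auto intro!: cside_arc_nonpos[of j k "i + N" "j + N"] cside_arc_nonpos[of k "i + N" "i + N" "j + N"])
    moreover have "norm z = 1" by (simp add: \<phi>)
    ultimately show ?thesis
      unfolding closure_region[OF assms] using True norm_region[of z i j k] by (auto simp: chalf_def)
  next
    case False
    then have ij: "i + 1 < j" "j < i + N" using assms by auto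
    have 0: "cside i j z = 0" using z edge_path_chord_iff[OF ij] by blast
    have "z \<in> closed_segment (pt i) (pt j)" using z edge_path_image_chord[OF ij(1)] by simp
    then obtain u where u: "0 \<le> u" "u \<le> 1" "z = (1 - u) *\<^sub>R pt i + u *\<^sub>R pt j"
      by (auto simp: closed_segment_def)
    have *: "cside a b z \<le> 0" if "cside a b (pt i) \<le> 0" "cside a b (pt j) \<le> 0" for a b
      using that u by (simp add: chord_side_scaleR_comb) (smt (verit) mult_nonneg_nonpos)
    have "cside j k z \<le> 0"
      using * cside_pt_nonpos[of j k "i + N"] cside_pt_nonpos[of j k "j + N"] assms by simp
    moreover have "cside k (i + N) z \<le> 0"
      using * cside_pt_nonpos[of k "i + N" "i + N"] cside_pt_nonpos[of k "i + N" "j + N"] assms by simp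
    ultimately show ?thesis
      using 0 False \<open>norm z \<le> 1\<close>
      unfolding closure_region[OF assms] by (auto simp: chalf_def region_def half_def)
  qed
qed

text \<open>For the harder inclusion, a boundary point inside the disc violates a strict inequality
  and so lies on a chord. A point of the circle lies over one of the three edges; if this is a
  chord, the weak inequality leaves only its ends.\<close>

lemma region_boundary:
  assumes "i < j" "j < k" "k < i + N"
  shows "closure (region i j k) - region i j k =
    arc i j \<union> arc j k \<union> arc k (i + N)" (is "?L = ?R")
proof
  show "?R \<subseteq> ?L"
    using edge_path_subset_boundary[of i j k] edge_path_subset_boundary[of j k "i + N"]
      edge_path_subset_boundary[of k "i + N" "j + N"] assms
      region_rotate[of j k i] region_rotate[of k "i + N" j] by auto
  show "?L \<subseteq> ?R"
  proof
    fix z assume z: "z \<in> ?L"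
    then have w: "norm z \<le> 1" "z \<in> chalf i j" "z \<in> chalf j k" "z \<in> chalf k (i + N)"
      by (auto simp: closure_region[OF assms])
    show "z \<in> ?R"
    proof (cases "norm z < 1")
      case True
      have *: "z \<in> arc a b" if "z \<in> chalf a b" "z \<notin> half a b" "a < b" "b < a + N" for a b
        using that True edge_path_chord_iff[of a b z] by (auto simp: chalf_def half_def)
      have "z \<notin> half i j \<or> z \<notin> half j k \<or> z \<notin> half k (i + N)"
        using z True by (auto simp: region_def)
      then show ?thesis using * w assms by (metis UnI1 UnI2 add_less_mono1 less_trans trans_less_add1)
    next
      case False
      then have "norm z = 1" using w by simp
      then obtain \<phi> where \<phi>: "z = cis \<phi>" "\<theta> i \<le> \<phi>" "\<phi> < \<theta> i + 2 * pi"
        using obtain_angle by blast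
      have *: "z \<in> arc a b"
        if "z \<in> chalf a b" "a < b" "b < a + N" "\<theta> a \<le> \<phi>" "\<phi> \<le> \<theta> b" for a b
      proof (cases "b = a + 1")
        case True
        then show ?thesis using that \<phi> edge_path_arc_image(1)[of a] by auto
      next
        case False
        have "\<not> (\<theta> a < \<phi> \<and> \<phi> < \<theta> b)"
        proof
          assume "\<theta> a < \<phi> \<and> \<phi> < \<theta> b"
          then have "cside a b z > 0"
            unfolding \<phi>(1) using that \<theta>_less_wrap[of b a] by (intro chord_side_arc_pos) auto
          then show False using that(1) False by (simp add: chalf_def)
        qed
        then have "\<phi> = \<theta> a \<or> \<phi> = \<theta> b" using that by linarith
        then have "z = pt a \<or> z = pt b" using \<phi> by (auto simp: pt_def)
        then show ?thesis
          using imageI[of 0 "{0..1}" "edge_path a b"] imageI[of 1 "{0..1}" "edge_path a b"] by auto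
      qed
      have "\<phi> \<le> \<theta> j \<or> \<theta> j \<le> \<phi> \<and> \<phi> \<le> \<theta> k \<or> \<theta> k \<le> \<phi> \<and> \<phi> \<le> \<theta> (i + N)"
        using \<phi> by (auto simp: period_\<theta>)
      then show ?thesis using * w assms \<phi> by auto
    qed
  qed
qed

text \<open>Convex sets are simply connected, so the Riemann mapping theorem provides the
  homeomorphism.\<close>

lemma region_homeomorphic_ball:
  assumes "i < j" "j < k" "k < i + N"
  shows "region i j k homeomorphic ball (0 :: complex) 1"
proof -
  have "region i j k \<noteq> {}" using centroid_in_region[OF assms] by blast
  then show ?thesis
    using simply_connected_eq_homeomorphic_to_disc[OF open_region, of i j k]
      convex_imp_simply_connected[OF convex_region] by blast
qed

lemma region_node:
  assumes "i < k"
  shows "region i j k = {z \<in> ball 0 1. (j = i + 1 \<or> cside i j z < 0) \<and> (k = j + 1 \<or> cside j k z < 0)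
     \<and> (i + N = k + 1 \<or> cside i k z > 0)}"
  by (auto simp: region_def half_def cside_swap)

text \<open>The triangles of a subtree lie beyond the base of the subtree, and the nesting of chords
  with a common end carries this over to the base of the whole tree. This is the invariant behind
  the separation of subtrees.\<close>

lemma triangle_region_subset:
  assumes "i + width T + 1 < i + N" "(a, b, c) \<in> triangles i T" "z \<in> region a b c"
  shows "cside i (i + width T) z > 0"
  using assms
proof (induction T arbitrary: i)
  case (Tri l r)
  let ?j = "i + width l" and ?k = "i + width l + width r"
  have lt: "\<theta> i < \<theta> ?j" "\<theta> ?j < \<theta> ?k" "\<theta> ?k < \<theta> i + 2 * pi"
    using Tri.prems unfolding \<theta>_less \<theta>_less_wrap by auto
  note z = norm_region[OF Tri.prems(3)]
  consider "(a, b, c) = (i, ?j, ?k)" | "(a, b, c) \<in> triangles i l" | "(a, b, c) \<in> triangles ?j r"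
    using Tri.prems by auto
  then show ?case
  proof cases
    case 1
    then have "cside i ?k z > 0" using Tri.prems by (auto simp: region_node)
    then show ?thesis by (simp add: add.assoc)
  next
    case 2
    have "cside i ?j z > 0" using Tri.IH(1)[of i] 2 Tri.prems by auto
    then show ?thesis using chord_side_nested_left[OF lt z] by (simp add: add.assoc)
  next
    case 3
    have "cside ?j ?k z > 0" using Tri.IH(2)[of ?j] 3 Tri.prems by auto
    then show ?thesis using chord_side_nested_right[OF lt z] by (simp add: add.assoc)
  qed
qed simp

lemma open_chord_subset:
  assumes "i + width T + 1 < i + N" "(a, b) \<in> chords i T" "(a, b) \<noteq> (i, i + width T)"
    "z \<in> open_arc a b"
  shows "cside i (i + width T) z > 0"
  using assms
proof (induction T arbitrary: i)
  case (Tri l r)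
  let ?j = "i + width l" and ?k = "i + width l + width r"
  have lt: "\<theta> i < \<theta> ?j" "\<theta> ?j < \<theta> ?k" "\<theta> ?k < \<theta> i + 2 * pi"
    using Tri.prems unfolding \<theta>_less \<theta>_less_wrap by auto
  have ab: "a + 1 < b" "b < a + N" using chords_bounds[OF Tri.prems(2)] Tri.prems(1) by auto
  note z = edge_path_open_chord[OF ab Tri.prems(4)]
  consider "(a, b) \<in> chords i l" | "(a, b) \<in> chords ?j r"
    using Tri.prems by (auto simp: add.assoc)
  then show ?case
  proof cases
    case 1
    have "cside i ?j z \<ge> 0"
      using Tri.IH(1)[of i] 1 Tri.prems z by (cases "(a, b) = (i, ?j)") auto
    then show ?thesis using chord_side_nested_left[OF lt z(1)] by (simp add: add.assoc)
  next
    case 2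
    have "cside ?j ?k z \<ge> 0"
      using Tri.IH(2)[of ?j] 2 Tri.prems z by (cases "(a, b) = (?j, ?k)") auto
    then show ?thesis using chord_side_nested_right[OF lt z(1)] by (simp add: add.assoc)
  qed
qed simp

end

section \<open>Disjointness and covering for the pieces of a tree\<close>

context circle_points
begin

lemma triangle_region_pos:
  assumes "width T + 1 < N" "(a, b, c) \<in> triangles i T" "z \<in> region a b c" "j = i + width T"
  shows "norm z < 1" "j \<noteq> i + 1" "cside i j z \<ge> 0"
proof -
  show "norm z < 1" by (rule norm_region[OF assms(3)])
  show "j \<noteq> i + 1" using triangles_bounds[OF assms(2)] assms(4) by auto
  show "cside i j z \<ge> 0" using triangle_region_subset[of i T a b c z] assms by simp
qed

lemma open_chord_pos:
  assumes "width T + 1 < N" "(a, b) \<in> chords i T" "z \<in> open_arc a b" "j = i + width T"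
  shows "norm z < 1" "j \<noteq> i + 1" "cside i j z \<ge> 0"
proof -
  have "a + 1 < b" "b < a + N" using chords_bounds[OF assms(2)] assms(1) by auto
  note z = edge_path_open_chord[OF this assms(3)]
  show "norm z < 1" by (fact z)
  show "j \<noteq> i + 1" using chords_bounds[OF assms(2)] assms(4) by auto
  show "cside i j z \<ge> 0"
    using z open_chord_subset[of i T a b z] assms by (cases "(a, b) = (i, j)") auto
qed

text \<open>Sibling subtrees stand over adjacent arcs, so no point of the open disc is beyond both
  of their bases.\<close>

lemma cside_split:
  assumes "i < j" "j < k" "k < i + N" "norm z < 1" "cside j k z \<ge> 0"
  shows "cside i j z < 0"
  using assms by (intro chord_side_disjoint[of _ _ "\<theta> k"]) (auto simp: \<theta>_less_wrap)

text \<open>The signs at the bases of the two children decide where a point belongs: the triangle of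
  the node is on the near side of both, a triangle of a child is beyond the base of that
  child.\<close>

lemma triangle_regions_disjoint:
  assumes "width T + 1 < N" "(a, b, c) \<in> triangles i T" "(a', b', c') \<in> triangles i T"
    "z \<in> region a b c" "z \<in> region a' b' c'"
  shows "(a, b, c) = (a', b', c')"
  using assms
proof (induction T arbitrary: i)
  case (Tri l r)
  let ?j = "i + width l" and ?k = "i + width l + width r"
  have w: "width l + 1 < N" "width r + 1 < N" "i < ?j" "?j < ?k" "?k < i + N" using Tri.prems(1) by auto
  note L = triangle_region_pos[OF w(1) _ _ refl] and R = triangle_region_pos[OF w(2) _ _ refl]
  have root: "?j = i + 1 \<or> cside i ?j z < 0" "?k = ?j + 1 \<or> cside ?j ?k z < 0"
    if "z \<in> region i ?j ?k"
    using that by (auto simp: region_def half_def)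
  have lr: False if "(a, b, c) \<in> triangles i l" "(a', b', c') \<in> triangles ?j r"
    "z \<in> region a b c" "z \<in> region a' b' c'" for a b c a' b' c'
    using L[OF that(1,3)] R[OF that(2,4)] cside_split[OF w(3-5), of z] by auto
  have rl: False if "(a, b, c) \<in> triangles i l" "z \<in> region a b c" "z \<in> region i ?j ?k" for a b c
    using L[OF that(1,2)] root[OF that(3)] by auto
  have rr: False if "(a, b, c) \<in> triangles ?j r" "z \<in> region a b c" "z \<in> region i ?j ?k" for a b c
    using R[OF that(1,2)] root[OF that(3)] by auto
  show ?case
    using Tri.prems(2-5) Tri.IH(1)[OF w(1), of i] Tri.IH(2)[OF w(2), of ?j] lr rl rr
    unfolding triangles.simps by (elim insertE UnE; clarify?; blast)
qed simp

lemma triangle_region_chord_disjoint: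
  assumes "width T + 1 < N" "(a, b, c) \<in> triangles i T" "(d, e) \<in> chords i T"
    "z \<in> region a b c" "z \<in> open_arc d e"
  shows False
  using assms
proof (induction T arbitrary: i)
  case (Tri l r)
  let ?j = "i + width l" and ?k = "i + width l + width r"
  have w: "width l + 1 < N" "width r + 1 < N" "i < ?j" "?j < ?k" "?k < i + N" using Tri.prems(1) by auto
  note L = triangle_region_pos[OF w(1) _ _ refl] and R = triangle_region_pos[OF w(2) _ _ refl]
  note L' = open_chord_pos[OF w(1) _ _ refl] and R' = open_chord_pos[OF w(2) _ _ refl]
  have root: "?j = i + 1 \<or> cside i ?j z < 0" "?k = ?j + 1 \<or> cside ?j ?k z < 0"
    if "z \<in> region i ?j ?k"
    using that by (auto simp: region_def half_def)
  have lr: False if "(a, b, c) \<in> triangles i l" "(d, e) \<in> chords ?j r"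
    using L[OF that(1) Tri.prems(4)] R'[OF that(2) Tri.prems(5)] cside_split[OF w(3-5), of z] by auto
  have rl: False if "(a, b, c) \<in> triangles ?j r" "(d, e) \<in> chords i l"
    using R[OF that(1) Tri.prems(4)] L'[OF that(2) Tri.prems(5)] cside_split[OF w(3-5), of z] by auto
  have nl: False if "(a, b, c) = (i, ?j, ?k)" "(d, e) \<in> chords i l"
    using L'[OF that(2) Tri.prems(5)] root that Tri.prems(4) by auto
  have nr: False if "(a, b, c) = (i, ?j, ?k)" "(d, e) \<in> chords ?j r"
    using R'[OF that(2) Tri.prems(5)] root that Tri.prems(4) by auto
  have top: False if "(d, e) = (i, ?k)"
  proof -
    have "cside i ?k z = 0"
      using edge_path_open_chord[of i ?k z] that w Tri.prems(5) by auto
    moreover have "cside i ?k z > 0"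
      using triangle_region_subset[OF _ Tri.prems(2,4)] Tri.prems(1) by (simp add: add.assoc)
    ultimately show False by simp
  qed
  show ?case
    using Tri.prems(2-5) Tri.IH(1)[OF w(1), of i] Tri.IH(2)[OF w(2), of ?j] lr rl nl nr top
    unfolding triangles.simps chords.simps by (elim insertE UnE) blast+
qed simp

lemma open_chords_disjoint:
  assumes "width T + 1 < N" "(a, b) \<in> chords i T" "(d, e) \<in> chords i T"
    "z \<in> open_arc a b" "z \<in> open_arc d e"
  shows "(a, b) = (d, e)"
  using assms
proof (induction T arbitrary: i)
  case (Tri l r)
  let ?j = "i + width l" and ?k = "i + width l + width r"
  have w: "width l + 1 < N" "width r + 1 < N" "i < ?j" "?j < ?k" "?k < i + N" using Tri.prems(1) by auto
  note L' = open_chord_pos[OF w(1) _ _ refl] and R' = open_chord_pos[OF w(2) _ _ refl]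
  have lr: False if "(a, b) \<in> chords i l" "(d, e) \<in> chords ?j r"
    "z \<in> open_arc a b" "z \<in> open_arc d e" for a b d e
    using L'[OF that(1,3)] R'[OF that(2,4)] cside_split[OF w(3-5), of z] by auto
  have top: "(a, b) = (i, ?k)" if "(a, b) \<in> chords i (Tri l r)" "z \<in> open_arc a b"
    "z \<in> open_arc i ?k" for a b
  proof (rule ccontr)
    assume "(a, b) \<noteq> (i, ?k)"
    then have "cside i ?k z > 0"
      using open_chord_subset[OF _ that(1) _ that(2)] Tri.prems(1) by (simp add: add.assoc)
    moreover have "cside i ?k z = 0" using edge_path_open_chord[of i ?k z] that w by auto
    ultimately show False by simp
  qed
  show ?case
  proof (cases "(a, b) = (i, ?k) \<or> (d, e) = (i, ?k)")
    case True
    then show ?thesis using top[OF Tri.prems(2,4)] top[OF Tri.prems(3,5)] Tri.prems(4,5) by force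
  next
    case False
    then show ?thesis
      using Tri.prems(2-5) Tri.IH(1)[OF w(1), of i] Tri.IH(2)[OF w(2), of ?j] lr
      unfolding chords.simps by (elim insertE UnE) blast+
  qed
qed simp

lemma region_or_boundary:
  assumes "i < j" "j < k" "k < i + N" "norm z \<le> 1"
    "z \<in> chalf i j" "z \<in> chalf j k" "z \<in> chalf k (i + N)"
  shows "z \<in> region i j k \<union> (arc i j \<union> arc j k \<union> arc k (i + N))"
  using region_boundary[OF assms(1-3)] closure_region[OF assms(1-3)] assms(4-7) by auto

text \<open>Seen as a chord, \<open>(k, i + N)\<close> is the segment of \<open>(i, k)\<close>
  reversed. The two hypotheses make both intervals longer than one, as otherwise one of them would
  be drawn as a circular arc.\<close>

lemma edge_path_wrap:
  assumes "i + 1 < k" "k + 1 < i + N"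
  shows "arc k (i + N) = arc i k"
  using assms by (simp add: edge_path_image_chord closed_segment_commute)

text \<open>Descent in the tree: a point beyond the base of a child is passed on to that child, and
  every other point lies in the closed triangle of the node.\<close>

lemma tree_cover:
  assumes "width T + 1 < N" "T \<noteq> Side" "norm z \<le> 1" "cside i (i + width T) z \<ge> 0"
  shows "z \<in> (\<Union>(a, b, c)\<in>triangles i T. region a b c) \<union> (\<Union>(a, b)\<in>chords i T. arc a b)
    \<union> (\<Union>p\<in>{i..<i + width T}. arc p (Suc p))"
  using assms
proof (induction T arbitrary: i)
  case (Tri l r)
  let ?j = "i + width l" and ?k = "i + width l + width r"
  have w: "width l + 1 < N" "width r + 1 < N" "i < ?j" "?j < ?k" "?k < i + N" using Tri.prems(1) by auto
  consider "l \<noteq> Side" "cside i ?j z \<ge> 0" | "r \<noteq> Side" "cside ?j ?k z \<ge> 0"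
    | "z \<in> chalf i ?j" "z \<in> chalf ?j ?k"
    by (force simp: chalf_def)
  then show ?case
  proof cases
    case 1
    then show ?thesis using Tri.IH(1)[OF w(1) 1(1) Tri.prems(3) 1(2)] by auto
  next
    case 2
    then show ?thesis using Tri.IH(2)[OF w(2) 2(1) Tri.prems(3) 2(2)] by auto
  next
    case 3
    have "z \<in> chalf ?k (i + N)"
      using Tri.prems(4) by (auto simp: chalf_def cside_swap add.assoc)
    then have "z \<in> region i ?j ?k \<union> (arc i ?j \<union> arc ?j ?k \<union> arc i ?k)"
      using region_or_boundary[OF w(3-5) Tri.prems(3) 3] edge_path_wrap[of i ?k] w Tri.prems(1) by simp
    then consider "z \<in> region i ?j ?k" | "z \<in> arc i ?j" | "z \<in> arc ?j ?k"
      | "z \<in> arc i ?k" by blast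
    then show ?thesis
    proof cases
      case 2
      show ?thesis
      proof (cases "l = Side")
        case True
        then have "z \<in> arc i (Suc i)" "i \<in> {i..<i + width (Tri l r)}" using 2 by auto
        then show ?thesis by blast
      next
        case False
        then have "(i, ?j) \<in> chords i (Tri l r)" by (cases l) auto
        then show ?thesis using 2 by blast
      qed
    next
      case 3
      show ?thesis
      proof (cases "r = Side")
        case True
        then have "z \<in> arc ?j (Suc ?j)" "?j \<in> {i..<i + width (Tri l r)}" using 3 by auto
        then show ?thesis by blast
      next
        case False
        then have "(?j, ?k) \<in> chords i (Tri l r)" by (cases r) auto
        then show ?thesis using 3 by blast
      qed
    qed auto
  qed
qed simp

end

text \<open>A tree of width \<open>N - 1\<close> would have a polygon side as its base, whereas the
  inductions above need the base to be a straight chord. So the tree stops at \<open>N - 2\<close>,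
  and the triangle cut off at the corner \<open>N - 1\<close> is added separately.\<close>

locale triangulated_circle = circle_points +
  fixes W :: ptree
  assumes width_W: "width W + 2 = N" and W_not_Side: "W \<noteq> Side"
begin

definition all_triangles :: "(nat \<times> nat \<times> nat) set" where
  "all_triangles = insert (0, N - 2, N - 1) (triangles 0 W)"

lemma N_ge: "N \<ge> 4"
  using width_W W_not_Side width_eq_1_iff[of W] width_pos(1)[of W] by linarith

lemma width_W': "width W = N - 2" "width W + 1 < N"
  using width_W by simp_all

lemma root_chord: "(0, N - 2) \<in> chords 0 W"
  using W_not_Side width_W'(1) by (cases W) auto

lemma all_triangles_bounds:
  assumes "(a, b, c) \<in> all_triangles" shows "a < b" "b < c" "c < a + N" "c < N"
  using assms triangles_bounds[of a b c 0 W] N_ge by (auto simp: all_triangles_def width_W')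

lemma root_region: "region 0 (N - 2) (N - 1) = {z \<in> ball 0 1. cside 0 (N - 2) z < 0}"
  using N_ge by (auto simp: region_def half_def)

lemma root_chord_nonneg:
  assumes "(a, b) \<in> chords 0 W" "z \<in> open_arc a b"
  shows "cside 0 (N - 2) z \<ge> 0"
  using open_chord_pos(3)[OF width_W'(2) assms refl] by (simp add: width_W')

lemma all_regions_disjoint:
  assumes "(a, b, c) \<in> all_triangles" "(a', b', c') \<in> all_triangles"
    "z \<in> region a b c" "z \<in> region a' b' c'"
  shows "(a, b, c) = (a', b', c')"
proof -
  have *: False if "(a, b, c) \<in> triangles 0 W" "z \<in> region a b c" "z \<in> region 0 (N - 2) (N - 1)" for a b c
    using triangle_region_pos(3)[OF width_W'(2) that(1,2) refl] that(3)
    unfolding root_region by (simp add: width_W')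
  show ?thesis
    using assms * triangle_regions_disjoint[OF width_W'(2), of a b c 0 a' b' c' z]
    unfolding all_triangles_def by (elim insertE) blast+
qed

lemma region_chord_disjoint:
  assumes "(a, b, c) \<in> all_triangles" "(d, e) \<in> chords 0 W"
    "z \<in> region a b c" "z \<in> open_arc d e"
  shows False
proof (cases "(a, b, c) \<in> triangles 0 W")
  case True
  then show ?thesis using triangle_region_chord_disjoint[OF width_W'(2) True assms(2-4)] by simp
next
  case False
  then have "z \<in> region 0 (N - 2) (N - 1)" using assms unfolding all_triangles_def by blast
  then have "cside 0 (N - 2) z < 0" unfolding root_region by simp
  then show ?thesis using root_chord_nonneg[OF assms(2,4)] by simp
qed

lemma chords_disjoint:
  assumes "(a, b) \<in> chords 0 W" "(d, e) \<in> chords 0 W"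
    "z \<in> open_arc a b" "z \<in> open_arc d e"
  shows "(a, b) = (d, e)"
  using open_chords_disjoint[OF width_W'(2) assms] .

lemma disc_cover:
  assumes "norm z \<le> 1"
  shows "z \<in> (\<Union>(a, b, c)\<in>all_triangles. region a b c) \<union> (\<Union>(a, b)\<in>chords 0 W. arc a b)
    \<union> (\<Union>p\<in>{..<N}. arc p (Suc p))"
proof (cases "cside 0 (N - 2) z \<ge> 0")
  case True
  then show ?thesis
    using tree_cover[OF width_W'(2) W_not_Side assms, of 0] by (fastforce simp: width_W' all_triangles_def)
next
  case False
  have "z \<in> chalf (N - 2) (N - 1)" "z \<in> chalf (N - 1) (0 + N)" "z \<in> chalf 0 (N - 2)"
    using False N_ge by (auto simp: chalf_def)
  then have "z \<in> region 0 (N - 2) (N - 1) \<union> (arc 0 (N - 2) \<union> arc (N - 2) (N - 1)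
      \<union> arc (N - 1) (0 + N))"
    using N_ge assms by (intro region_or_boundary) auto
  moreover have "N - 1 = Suc (N - 2)" "0 + N = Suc (N - 1)" "N - 1 < N" "N - 2 < N" using N_ge by auto
  ultimately show ?thesis using root_chord unfolding all_triangles_def by (metis (no_types, lifting) UN_iff Un_iff case_prod_conv insertI1 lessThan_iff)
qed

end

section \<open>Quotients of the closed disc\<close>

text \<open>The complement of a block is the union of the other blocks, so every block is clopen and
  absorbs each connected set that meets it.\<close>

lemma connected_components_of_open_partition:
  assumes opn: "\<And>U. U \<in> \<U> \<Longrightarrow> openin X U" and con: "\<And>U. U \<in> \<U> \<Longrightarrow> connectedin X U"
    and ne: "\<And>U. U \<in> \<U> \<Longrightarrow> U \<noteq> {}" and dj: "\<And>U V. U \<in> \<U> \<Longrightarrow> V \<in> \<U> \<Longrightarrow> U \<noteq> V \<Longrightarrow> U \<inter> V = {}"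
    and cover: "\<Union>\<U> = topspace X"
  shows "connected_components_of X = \<U>"
proof -
  have comp: "connected_component_of_set X x = U" if "U \<in> \<U>" "x \<in> U" for x U
  proof (rule connected_component_of_unique[OF that(2) con[OF that(1)]])
    fix C assume C: "x \<in> C \<and> connectedin X C"
    have "V \<subseteq> topspace X - U" if "V \<in> \<U> - {U}" for V
      using that dj[of U V] \<open>U \<in> \<U>\<close> cover by auto
    then have "topspace X - U = \<Union>(\<U> - {U})" using cover by fast
    then have "openin X (topspace X - U)" using opn by auto
    then have "closedin X U" using opn[OF that(1)] openin_subset by (simp add: closedin_def)
    then show "C \<subseteq> U"
      using C opn[OF that(1)] connectedin_clopen_cases[of X C U] that(2) by (auto simp: disjnt_def)
  qed
  show ?thesis
  proof
    show "connected_components_of X \<subseteq> \<U>"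
    proof
      fix C assume "C \<in> connected_components_of X"
      then obtain x where x: "x \<in> topspace X" "C = connected_component_of_set X x"
        unfolding connected_components_of_def by blast
      then obtain U where "U \<in> \<U>" "x \<in> U" using cover by blast
      then show "C \<in> \<U>" using comp[of U x] x by simp
    qed
    show "\<U> \<subseteq> connected_components_of X"
    proof
      fix U assume "U \<in> \<U>"
      then obtain x where x: "x \<in> U" using ne by blast
      then have "x \<in> topspace X" using \<open>U \<in> \<U>\<close> cover by blast
      then show "U \<in> connected_components_of X"
        using comp[OF \<open>U \<in> \<U>\<close> x] unfolding connected_components_of_def by blast
    qed
  qed
qed

lemma homeomorphic_imp_homeomorphic_space:
  assumes "S homeomorphic T"
  shows "top_of_set S homeomorphic_space top_of_set T"
proof -
  obtain f g where fg: "homeomorphism S T f g" using assms by (auto simp: homeomorphic_def)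
  then have "homeomorphic_maps (top_of_set S) (top_of_set T) f g"
    by (auto simp: homeomorphism_def homeomorphic_maps_def)
  then show ?thesis by (auto simp: homeomorphic_space_def)
qed

locale disc_quotient =
  fixes X :: "'a topology" and q :: "complex \<Rightarrow> 'a"
  assumes Hausdorff_X: "Hausdorff_space X"
    and quotient_q: "quotient_map (top_of_set (cball 0 1)) X q"
    and inj_ball: "\<And>x y. x \<in> ball 0 1 \<Longrightarrow> y \<in> cball 0 1 \<Longrightarrow> q x = q y \<Longrightarrow> x = y"
begin

lemma continuous_q: "continuous_map (top_of_set (cball 0 1)) X q"
  using quotient_q quotient_imp_continuous_map by blast

lemma topspace_X: "topspace X = q ` cball 0 1"
  using quotient_q by (simp add: quotient_map_def)

text \<open>By \<open>inj_ball\<close> the set \<open>U\<close> is saturated, so its openness passes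
  to the quotient.\<close>

lemma openin_image:
  assumes "open U" "U \<subseteq> ball 0 1"
  shows "openin X (q ` U)"
proof -
  have "{x \<in> cball 0 1. q x \<in> q ` U} = U"
  proof (intro equalityI subsetI)
    fix x assume "x \<in> {x \<in> cball 0 1. q x \<in> q ` U}"
    then have x: "x \<in> cball 0 1" "q x \<in> q ` U" by blast+
    then obtain u where "q x = q u" "u \<in> U" by blast
    moreover have "u = x" by (rule inj_ball) (use calculation x assms(2) in auto)
    ultimately show "x \<in> U" by simp
  qed (use assms(2) in auto)
  moreover have "openin (top_of_set (cball 0 1)) U"
    using assms by (metis Int_absorb1 ball_subset_cball openin_open subset_trans)
  moreover have "q ` U \<subseteq> topspace X" using assms(2) topspace_X by force
  note quotient_q[unfolded quotient_map_def topspace_euclidean_subtopology, THEN conjunct2, rule_format, OF this]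
  ultimately show ?thesis by (simp only:)
qed

lemma image_homeomorphic_space:
  assumes "open U" "U \<subseteq> ball 0 1"
  shows "top_of_set U homeomorphic_space subtopology X (q ` U)"
proof (rule homeomorphic_map_imp_homeomorphic_space[OF bijective_open_imp_homeomorphic_map])
  have U: "U \<subseteq> cball 0 1" using assms(2) by force
  then have "continuous_map (top_of_set U) X q"
    using continuous_map_from_subtopology[OF continuous_q, of U] by (simp add: subtopology_subtopology Int_absorb1)
  then show "continuous_map (top_of_set U) (subtopology X (q ` U)) q"
    by (auto simp: continuous_map_in_subtopology)
  show "open_map (top_of_set U) (subtopology X (q ` U)) q"
    unfolding open_map_def
  proof (intro allI impI)
    fix A assume A: "openin (top_of_set U) A"
    then have "open A" "A \<subseteq> U" using assms(1) openin_open_eq by auto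
    then have "openin X (q ` A)" "q ` A \<subseteq> q ` U" using openin_image assms by (blast, blast)
    then show "openin (subtopology X (q ` U)) (q ` A)"
      by (metis openin_subtopology_Int2 inf.absorb_iff2)
  qed
  show "q ` topspace (top_of_set U) = topspace (subtopology X (q ` U))"
    using U topspace_X by auto
  show "inj_on q (topspace (top_of_set U))"
  proof
    fix x y assume "x \<in> topspace (top_of_set U)" "y \<in> topspace (top_of_set U)" "q x = q y"
    then show "x = y" by (intro inj_ball) (use U assms(2) in auto)
  qed
qed

text \<open>A continuous map from the compact disc to a Hausdorff space is closed, and continuous
  closed maps commute with closure.\<close>

lemma closure_of_image:
  assumes "U \<subseteq> cball 0 1"
  shows "X closure_of (q ` U) = q ` closure U"
proof -
  have c: "closure U \<subseteq> cball 0 1" using assms by (simp add: closure_minimal)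
  then have *: "top_of_set (cball 0 1) closure_of U = closure U"
    using assms by (simp add: closure_of_subtopology Int_absorb1 Int_absorb2)
  have "closed_map (top_of_set (cball 0 1)) X q"
    using continuous_imp_closed_map[OF continuous_q] Hausdorff_X
    by (simp add: compact_space_subtopology compactin_euclidean_iff)
  then have "X closure_of (q ` U) \<subseteq> q ` closure U"
    using assms * unfolding closed_map_closure_of_image by (metis topspace_euclidean_subtopology)
  moreover have "q ` closure U \<subseteq> X closure_of (q ` U)"
    using continuous_map_image_closure_subset[OF continuous_q, of U] * by simp
  ultimately show ?thesis by blast
qed

lemma frontier_of_image:
  assumes "open U" "U \<subseteq> ball 0 1"
  shows "X frontier_of (q ` U) = q ` (closure U - U)"
proof -
  have c: "closure U \<subseteq> cball 0 1" using assms(2) by (metis closure_mono closure_ball zero_less_one zero_neq_one)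
  then have "q ` closure U - q ` U = q ` (closure U - U)"
  proof (intro equalityI subsetI)
    fix y assume "y \<in> q ` (closure U - U)"
    then obtain x where x: "y = q x" "x \<in> closure U" "x \<notin> U" by blast
    have "y \<notin> q ` U"
    proof
      assume "y \<in> q ` U"
      then obtain u where "u \<in> U" "y = q u" by blast
      moreover have "u = x" by (rule inj_ball) (use calculation x c assms(2) in auto)
      ultimately show False using x by simp
    qed
    then show "y \<in> q ` closure U - q ` U" using x by blast
  qed blast
  moreover have "U \<subseteq> cball 0 1" using assms(2) by force
  ultimately show ?thesis
    using openin_image[OF assms] closure_of_image[of U] by (simp add: frontier_of_def interior_of_openin)
qed

lemma connectedin_image:
  assumes "convex U" "U \<subseteq> cball 0 1"
  shows "connectedin X (q ` U)"
  using assms connectedin_continuous_map_image[OF continuous_q, of U]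
  by (simp add: connectedin_subtopology convex_connected)

end

section \<open>Gluing a triangulated polygon\<close>

text \<open>An edge of the glued graph is just the set of its ends, so the ends must determine the
  drawn curve. For sides this is \<open>side_same\<close> and \<open>side_diff\<close>, and
  \<open>side_pairs\<close> says that each side is glued to exactly one other. The assumptions on
  chords exclude loops and multiple edges.\<close>

locale glued_triangulation = triangulated_circle N \<theta> W + disc_quotient X q
  for N \<theta> W and X :: "'a topology" and q +
  assumes inj_side: "\<And>p. p < N \<Longrightarrow> inj_on q (arc p (Suc p))"
    and side_vertex: "\<And>p r z. p < N \<Longrightarrow> r < N \<Longrightarrow> z \<in> open_arc p (Suc p) \<Longrightarrow> q z \<noteq> q (pt r)"
    and side_same: "\<And>p r. p < N \<Longrightarrow> r < N \<Longrightarrow> {q (pt p), q (pt (Suc p))} = {q (pt r), q (pt (Suc r))} \<Longrightarrow>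
      q ` arc p (Suc p) = q ` arc r (Suc r)"
    and side_diff: "\<And>p r. p < N \<Longrightarrow> r < N \<Longrightarrow> {q (pt p), q (pt (Suc p))} \<noteq> {q (pt r), q (pt (Suc r))} \<Longrightarrow>
      q ` open_arc p (Suc p) \<inter> q ` open_arc r (Suc r) = {}"
    and side_pairs: "\<And>p. p < N \<Longrightarrow>
      card {r. r < N \<and> {q (pt r), q (pt (Suc r))} = {q (pt p), q (pt (Suc p))}} = 2"
    and chord_neq: "\<And>a b. (a, b) \<in> chords 0 W \<Longrightarrow> q (pt a) \<noteq> q (pt b)"
    and chord_inj: "\<And>a b c d. (a, b) \<in> chords 0 W \<Longrightarrow> (c, d) \<in> chords 0 W \<Longrightarrow>
      {q (pt a), q (pt b)} = {q (pt c), q (pt d)} \<Longrightarrow> (a, b) = (c, d)"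
    and chord_not_side: "\<And>a b p. (a, b) \<in> chords 0 W \<Longrightarrow> p < N \<Longrightarrow>
      {q (pt a), q (pt b)} \<noteq> {q (pt p), q (pt (Suc p))}"
begin

section \<open>The graph in the quotient and its faces\<close>

definition vertex :: "nat \<Rightarrow> 'a" where "vertex p = q (pt p)"

definition vertices :: "'a set" where "vertices = vertex ` {..<N}"

definition pair_edge :: "nat \<times> nat \<Rightarrow> 'a set" where "pair_edge ab = {vertex (fst ab), vertex (snd ab)}"

definition sides :: "(nat \<times> nat) set" where "sides = (\<lambda>p. (p, Suc p)) ` {..<N}"

abbreviation edge_pairs :: "(nat \<times> nat) set" where "edge_pairs \<equiv> chords 0 W \<union> sides"

definition graph_edges :: "'a set set" where "graph_edges = pair_edge ` (edge_pairs)"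

text \<open>A curve has to be a function of the edge as a set of vertices, so a pair of positions is
  chosen. For a glued side either copy may be taken; by \<open>side_same\<close> the image does not
  depend on the choice.\<close>

definition edge_index :: "'a set \<Rightarrow> nat \<times> nat" where
  "edge_index e = (SOME ab. ab \<in> edge_pairs \<and> pair_edge ab = e)"

definition edge_curve :: "'a set \<Rightarrow> real \<Rightarrow> 'a" where
  "edge_curve e = q \<circ> edge_path (fst (edge_index e)) (snd (edge_index e))"

lemma edge_index:
  assumes "e \<in> graph_edges"
  shows "edge_index e \<in> edge_pairs" "pair_edge (edge_index e) = e"
  using assms someI_ex[of "\<lambda>ab. ab \<in> edge_pairs \<and> pair_edge ab = e"]
  unfolding graph_edges_def edge_index_def by blast+

lemma vertex_period [simp]: "vertex (p + N) = vertex p"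
  by (simp add: vertex_def)

lemma vertex_N: "vertex N = vertex 0"
  using vertex_period[of 0] by simp

lemma vertex_in_vertices: "p \<le> N \<Longrightarrow> vertex p \<in> vertices"
  using vertex_N N_ge by (cases "p = N") (auto simp: vertices_def)

lemma index_bounds:
  assumes "(a, b) \<in> edge_pairs"
  shows "a < b" "b \<le> N" "b < a + N" "a < N"
  using assms chords_bounds[of a b 0 W] N_ge by (auto simp: sides_def width_W')

lemma pt_in_edge_path: "pt a \<in> arc a b" "pt b \<in> arc a b"
  using imageI[of 0 "{0..1}" "edge_path a b"] imageI[of 1 "{0..1}" "edge_path a b"] by auto

lemma vertex_neq:
  assumes "(a, b) \<in> edge_pairs"
  shows "vertex a \<noteq> vertex b"
proof (cases "(a, b) \<in> chords 0 W")
  case False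
  then have p: "a < N" "b = Suc a" using assms by (auto simp: sides_def)
  note pt_in_edge_path(1)[of a "Suc a"] pt_in_edge_path(2)[of "Suc a" a]
  moreover have "pt a \<noteq> pt (Suc a)" using pt_neq[of a "Suc a"] N_ge by auto
  ultimately show ?thesis using inj_on_eq_iff[OF inj_side[OF p(1)]] p(2) unfolding vertex_def by metis
qed (auto simp: vertex_def chord_neq)

lemma norm_open_chord:
  assumes "(a, b) \<in> chords 0 W" "z \<in> open_arc a b"
  shows "norm z < 1"
  using edge_path_open_chord(1)[OF _ _ assms(2)] chords_bounds[OF assms(1)] width_W' by auto

lemma norm_side: "z \<in> edge_path p (Suc p) ` S \<Longrightarrow> norm z = 1"
  by (auto simp: edge_path_def)

lemma q_eq_imp_eq:
  assumes "norm x < 1" "norm y \<le> 1" "q x = q y" shows "x = y"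
  using inj_ball[of x y] assms by simp

lemma image_closed_unit:
  fixes f :: "real \<Rightarrow> 'b"
  shows "f ` {0..1} = insert (f 0) (insert (f 1) (f ` {0<..<1}))"
proof -
  have "{0..1::real} = insert 0 (insert 1 {0<..<1})" by auto
  then show ?thesis by (metis image_insert)
qed

lemma inj_on_q_edge:
  assumes "(a, b) \<in> edge_pairs"
  shows "inj_on q (arc a b)"
proof (cases "(a, b) \<in> chords 0 W")
  case True
  show ?thesis
  proof
    fix x y assume xy: "x \<in> arc a b" "y \<in> arc a b" "q x = q y"
    have nrm: "norm x \<le> 1" "norm y \<le> 1" using xy edge_path_in_cball by auto
    show "x = y"
    proof (cases "norm x < 1 \<or> norm y < 1")
      case True
      then show ?thesis using q_eq_imp_eq[of x y] q_eq_imp_eq[of y x] nrm xy by metis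
    next
      case False
      then have "x \<in> {pt a, pt b}" "y \<in> {pt a, pt b}"
        using xy norm_open_chord[OF True] by (auto simp: image_closed_unit[of "edge_path a b"])
      then show ?thesis using xy(3) chord_neq[OF True] by auto
    qed
  qed
next
  case False
  then show ?thesis using assms inj_side by (auto simp: sides_def)
qed

lemma edge_curve_image:
  assumes "(a, b) \<in> edge_pairs"
  shows "edge_curve (pair_edge (a, b)) ` {0..1} = q ` arc a b"
proof -
  let ?e = "pair_edge (a, b)"
  obtain c d where cd: "edge_index ?e = (c, d)" by force
  have "?e \<in> graph_edges" using assms by (auto simp: graph_edges_def)
  note idx = edge_index[OF this, unfolded cd]
  have eq: "{q (pt c), q (pt d)} = {q (pt a), q (pt b)}" using idx(2) by (simp add: pair_edge_def vertex_def)
  have "q ` arc c d = q ` arc a b"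
  proof (cases "(c, d) \<in> chords 0 W")
    case True
    have "(a, b) \<in> chords 0 W"
    proof (rule ccontr)
      assume "(a, b) \<notin> chords 0 W"
      then have "a < N" "b = Suc a" using assms by (auto simp: sides_def)
      then show False using chord_not_side[OF True, of a] eq by simp
    qed
    then show ?thesis using chord_inj[OF True _ eq] by simp
  next
    case False
    then have cd': "c < N" "d = Suc c" using idx(1) by (auto simp: sides_def)
    have "(a, b) \<notin> chords 0 W" using chord_not_side[of a b c] cd' eq by auto
    then have "a < N" "b = Suc a" using assms by (auto simp: sides_def)
    then show ?thesis using side_same[of c a] cd' eq by simp
  qed
  then show ?thesis by (simp add: edge_curve_def cd image_comp)
qed

text \<open>The interior of a chord lies in the open disc, where q identifies nothing, so any
  coincidence already happens in the disc. The sides are covered by the assumptions of the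
  locale.\<close>

lemma embedded_graph_glued: "embedded_graph X vertices graph_edges edge_curve"
  unfolding embedded_graph_def
proof (intro conjI ballI impI)
  show "finite vertices" by (simp add: vertices_def)
  show "vertices \<subseteq> topspace X" by (auto simp: vertices_def vertex_def topspace_X)
next
  fix e assume e: "e \<in> graph_edges"
  obtain a b where ab: "edge_index e = (a, b)" by force
  note idx = edge_index[OF e, unfolded ab]
  have e_eq: "e = {vertex a, vertex b}" using idx(2) by (simp add: pair_edge_def)
  show "e \<subseteq> vertices" using index_bounds[OF idx(1)] vertex_in_vertices e_eq by auto
  show "card e = 2" using vertex_neq[OF idx(1)] e_eq by simp
  have curve: "edge_curve e = q \<circ> edge_path a b" by (simp add: edge_curve_def ab)
  have "continuous_map (top_of_set {0..1}) (top_of_set (cball 0 1)) (edge_path a b)"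
    using edge_path_in_cball continuous_edge_path by auto
  then show "continuous_map (top_of_set {0..1}) X (edge_curve e)"
    unfolding curve using continuous_q by (rule continuous_map_compose)
  show "inj_on (edge_curve e) {0..1}"
    unfolding curve using index_bounds[OF idx(1)] inj_on_q_edge[OF idx(1)]
    by (intro comp_inj_on inj_on_edge_path)
  show "{edge_curve e 0, edge_curve e 1} = e" 
    unfolding curve by (simp add: e_eq vertex_def)
  show "edge_curve e ` {0<..<1} \<inter> vertices = {}"
  proof (cases "(a, b) \<in> chords 0 W")
    case True
    have "q z \<noteq> q (pt r)" if "z \<in> open_arc a b" for z r
      using q_eq_imp_eq[of z "pt r"] norm_open_chord[OF True that] by auto
    then show ?thesis by (auto simp: curve vertices_def vertex_def)
  next
    case False
    then have "a < N" "b = Suc a" using idx(1) by (auto simp: sides_def)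
    then show ?thesis using side_vertex[of a] by (auto simp: curve vertices_def vertex_def)
  qed
next
  fix e e' assume e: "e \<in> graph_edges" "e' \<in> graph_edges" "e \<noteq> e'"
  obtain a b c d where ab: "edge_index e = (a, b)" "edge_index e' = (c, d)" by force
  note idx = edge_index[OF e(1), unfolded ab] and idx' = edge_index[OF e(2), unfolded ab]
  have neq: "{q (pt a), q (pt b)} \<noteq> {q (pt c), q (pt d)}"
    using idx(2) idx'(2) e(3) by (auto simp: pair_edge_def vertex_def)
  have "q x \<noteq> q y" if xy: "x \<in> open_arc a b" "y \<in> open_arc c d" for x y
  proof
    assume qxy: "q x = q y"
    have nrm: "norm x \<le> 1" "norm y \<le> 1" using xy edge_path_in_cball by auto
    consider "(a, b) \<in> chords 0 W" "(c, d) \<in> chords 0 W" | "(a, b) \<in> chords 0 W" "(c, d) \<in> sides"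
      | "(a, b) \<in> sides" "(c, d) \<in> chords 0 W" | "(a, b) \<in> sides" "(c, d) \<in> sides"
      using idx idx' by blast
    then show False
    proof cases
      case 1
      have "x = y" using q_eq_imp_eq[OF norm_open_chord[OF 1(1) xy(1)] nrm(2) qxy] .
      then show ?thesis using chords_disjoint[OF 1] xy neq by auto
    next
      case 2
      have "x = y" using q_eq_imp_eq[OF norm_open_chord[OF 2(1) xy(1)] nrm(2) qxy] .
      moreover have "d = Suc c" using 2 by (auto simp: sides_def)
      then have "norm y = 1" using norm_side xy(2) by blast
      ultimately show ?thesis using norm_open_chord[OF 2(1) xy(1)] by simp
    next
      case 3
      have "y = x" using q_eq_imp_eq[OF norm_open_chord[OF 3(2) xy(2)] nrm(1)] qxy by simp
      moreover have "b = Suc a" using 3 by (auto simp: sides_def)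
      then have "norm x = 1" using norm_side xy(1) by blast
      ultimately show ?thesis using norm_open_chord[OF 3(2) xy(2)] by simp
    next
      case 4
      then have "a < N" "b = Suc a" "c < N" "d = Suc c" by (auto simp: sides_def)
      then show ?thesis using side_diff[of a c] neq xy qxy by blast
    qed
  qed
  then show "edge_curve e ` {0<..<1} \<inter> edge_curve e' ` {0<..<1} = {}"
    by (auto simp: edge_curve_def ab)
qed

lemma drawn_graph:
  "vertices \<union> drawn_edges edge_curve graph_edges = (\<Union>(a, b)\<in>edge_pairs. q ` arc a b)"
proof -
  have "drawn_edges edge_curve graph_edges = (\<Union>ab\<in>edge_pairs. edge_curve (pair_edge ab) ` {0..1})"
    by (auto simp: drawn_edges_def graph_edges_def)
  also have "\<dots> = (\<Union>(a, b)\<in>edge_pairs. q ` arc a b)"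
    by (rule SUP_cong[OF refl]) (metis (no_types, lifting) case_prod_conv edge_curve_image surj_pair)
  finally have *: "drawn_edges edge_curve graph_edges = (\<Union>(a, b)\<in>edge_pairs. q ` arc a b)" .
  have "vertices \<subseteq> (\<Union>(a, b)\<in>edge_pairs. q ` arc a b)"
  proof
    fix v assume "v \<in> vertices"
    then obtain p where p: "p < N" "v = q (pt p)" by (auto simp: vertices_def vertex_def)
    have "v \<in> q ` arc p (Suc p)" using p(2) pt_in_edge_path by blast
    moreover have "(p, Suc p) \<in> sides" using p(1) by (auto simp: sides_def)
    ultimately show "v \<in> (\<Union>(a, b)\<in>edge_pairs. q ` arc a b)" by blast
  qed
  then show ?thesis using * by blast
qed

lemma region_image_avoids_graph:
  assumes "(a, b, c) \<in> all_triangles" "(d, e) \<in> edge_pairs"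
  shows "q ` region a b c \<inter> q ` arc d e = {}"
proof -
  have "q x \<noteq> q y" if x: "x \<in> region a b c" and y: "y \<in> arc d e" for x y
  proof
    assume "q x = q y"
    moreover have "norm y \<le> 1" using y edge_path_in_cball by auto
    ultimately have xy: "x = y" using q_eq_imp_eq norm_region[OF x] by blast
    show False
    proof (cases "(d, e) \<in> chords 0 W")
      case True
      then show ?thesis
        using region_chord_disjoint[OF assms(1) True x] y norm_region[OF x] xy
        by (auto simp: image_closed_unit[of "edge_path d e"])
    next
      case False
      then have "e = Suc d" using assms(2) by (auto simp: sides_def)
      then have "norm y = 1" using norm_side y by blast
      then show ?thesis using norm_region[OF x] xy by simp
    qed
  qed
  then show ?thesis by blast
qed

text \<open>The images of the open triangles are open, connected, disjoint and cover the complement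
  of the drawing, hence they are its components.\<close>

lemma faces_glued: "faces X vertices graph_edges edge_curve = (\<lambda>(a, b, c). q ` region a b c) ` all_triangles"
proof -
  let ?U = "(\<lambda>(a, b, c). q ` region a b c) ` all_triangles"
  let ?S = "topspace X - (vertices \<union> drawn_edges edge_curve graph_edges)"
  have cover: "\<Union>?U = ?S"
  proof (intro equalityI subsetI)
    fix y assume "y \<in> \<Union>?U"
    then obtain a b c where abc: "(a, b, c) \<in> all_triangles" "y \<in> q ` region a b c" by auto
    then have "y \<in> topspace X" using region_subset_ball[of a b c] by (auto simp: topspace_X)
    then show "y \<in> ?S" using abc region_image_avoids_graph[OF abc(1)] unfolding drawn_graph by blast
  next
    fix y assume y: "y \<in> ?S"
    then obtain x where x: "norm x \<le> 1" "y = q x" by (auto simp: topspace_X)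
    have "x \<notin> (\<Union>(a, b)\<in>chords 0 W. arc a b)"
      "x \<notin> (\<Union>p\<in>{..<N}. arc p (Suc p))"
      using y x unfolding drawn_graph by (auto simp: sides_def)
    then show "y \<in> \<Union>?U" using disc_cover[OF x(1)] x(2) by auto
  qed
  have opn: "openin X (q ` region a b c)" for a b c
    by (rule openin_image[OF open_region region_subset_ball])
  have sub: "U \<subseteq> ?S" if "U \<in> ?U" for U
    unfolding cover[symmetric] using that by (rule Union_upper)
  show ?thesis
    unfolding faces_def
  proof (rule connected_components_of_open_partition)
    fix U assume U: "U \<in> ?U"
    then obtain a b c where abc: "(a, b, c) \<in> all_triangles" "U = q ` region a b c" by auto
    show "openin (subtopology X ?S) U"
      using opn[of a b c] sub[OF U] unfolding abc(2) by (metis inf.absorb_iff2 openin_subtopology_Int2)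
    show "connectedin (subtopology X ?S) U"
      unfolding connectedin_subtopology abc(2)
      using connectedin_image[OF convex_region subset_trans[OF region_subset_ball ball_subset_cball]] sub[OF U] abc(2)
      by simp
    show "U \<noteq> {}" using centroid_in_region[of a b c] all_triangles_bounds[OF abc(1)] abc(2) by auto
  next
    fix U U' assume U: "U \<in> ?U" "U' \<in> ?U" "U \<noteq> U'"
    from U(1) obtain a b c where 1: "(a, b, c) \<in> all_triangles" "U = q ` region a b c" by auto
    from U(2) obtain a' b' c' where 2: "(a', b', c') \<in> all_triangles" "U' = q ` region a' b' c'" by auto
    note * = 1 2
    have "q x \<noteq> q y" if "x \<in> region a b c" "y \<in> region a' b' c'" for x y
    proof
      assume "q x = q y"
      then have "x = y" using q_eq_imp_eq[of x y] norm_region[OF that(1)] norm_region[OF that(2)] by simp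
      then show False using all_regions_disjoint[OF *(1,3)] that U(3) * by auto
    qed
    then show "U \<inter> U' = {}" using * by auto
  next
    show "\<Union>?U = topspace (subtopology X ?S)" using cover by auto
  qed
qed

text \<open>The third edge is special because the boundary of a region lists it as
  \<open>(c, a + N)\<close>. For a triangle of the tree it is the chord \<open>(a, c)\<close>; for
  the added triangle it is the side from \<open>N - 1\<close> to \<open>N\<close>, which ends in the
  vertex of position 0.\<close>

lemma triangle_index_aux:
  assumes "(a, b, c) \<in> all_triangles"
  shows "(a, b) \<in> edge_pairs \<and> (b, c) \<in> edge_pairs \<and>
    (\<exists>ab \<in> edge_pairs. pair_edge ab = {vertex a, vertex c} \<and>
       arc c (a + N) = arc (fst ab) (snd ab))"
proof (cases "(a, b, c) \<in> triangles 0 W")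
  case True
  note t = triangle_edges[OF True] and bd = triangles_bounds[OF True]
  have "arc c (a + N) = arc a c"
    using bd width_W' by (intro edge_path_wrap) auto
  moreover have "a < N" "b < N" using bd width_W' by auto
  ultimately show ?thesis
    using t by (auto simp: sides_def pair_edge_def intro!: bexI[of _ "(a, c)"])
next
  case False
  then have abc: "a = 0" "b = N - 2" "c = N - 1" using assms by (auto simp: all_triangles_def)
  have "(b, c) \<in> sides" using N_ge abc by (auto simp: sides_def)
  moreover have "(c, N) \<in> sides" using N_ge abc by (auto simp: sides_def image_iff)
  ultimately show ?thesis
    using root_chord abc vertex_N by (auto simp: pair_edge_def insert_commute intro!: bexI[of _ "(c, N)"])
qed

lemmas triangle_index = triangle_index_aux[THEN conjunct1] triangle_index_aux[THEN conjunct2, THEN conjunct1]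
  triangle_index_aux[THEN conjunct2, THEN conjunct2]

lemma surface_triangulation_glued: "surface_triangulation X vertices graph_edges edge_curve"
  unfolding surface_triangulation_def
proof (intro conjI ballI embedded_graph_glued)
  fix F assume "F \<in> faces X vertices graph_edges edge_curve"
  then obtain a b c where abc: "(a, b, c) \<in> all_triangles" and F: "F = q ` region a b c"
    unfolding faces_glued by auto
  note bd = all_triangles_bounds[OF abc]
  have "top_of_set (region a b c) homeomorphic_space subtopology X F"
    unfolding F by (rule image_homeomorphic_space[OF open_region region_subset_ball])
  moreover have "top_of_set (region a b c) homeomorphic_space top_of_set (ball (0 :: complex) 1)"
    using region_homeomorphic_ball[OF bd(1-3)] by (rule homeomorphic_imp_homeomorphic_space)
  ultimately show "subtopology X F homeomorphic_space top_of_set (ball (0 :: complex) 1)"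
    using homeomorphic_space_sym homeomorphic_space_trans by blast
  note idx = triangle_index[OF abc]
  obtain d e where de: "(d, e) \<in> edge_pairs" "pair_edge (d, e) = {vertex a, vertex c}"
    "arc c (a + N) = arc d e" using idx(3) by (metis prod.collapse)
  define C where "C = {pair_edge (a, b), pair_edge (b, c), pair_edge (d, e)}"
  have "vertex a \<noteq> vertex c"
    using vertex_neq[OF de(1)] de(2) by (auto simp: pair_edge_def doubleton_eq_iff)
  moreover have "C \<subseteq> graph_edges"
    unfolding C_def graph_edges_def using idx(1,2) de(1) by blast
  moreover have "C = {{vertex a, vertex b}, {vertex b, vertex c}, {vertex a, vertex c}}"
    unfolding C_def de(2) by (simp add: pair_edge_def)
  ultimately have "three_cycle graph_edges C"
    using vertex_neq[OF idx(1)] vertex_neq[OF idx(2)] unfolding three_cycle_def by blast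
  moreover have "X frontier_of F = drawn_edges edge_curve C"
  proof -
    have "X frontier_of F = q ` (closure (region a b c) - region a b c)"
      unfolding F by (rule frontier_of_image[OF open_region region_subset_ball])
    also have "\<dots> = drawn_edges edge_curve C"
      unfolding region_boundary[OF bd(1-3)] drawn_edges_def C_def de(3)
      using edge_curve_image[OF idx(1)] edge_curve_image[OF idx(2)] edge_curve_image[OF de(1)]
      by (simp add: image_Un Un_assoc)
    finally show ?thesis .
  qed
  ultimately show "\<exists>C. three_cycle graph_edges C \<and> X frontier_of F = drawn_edges edge_curve C" by blast
qed

end

section \<open>Energy and frustrated triangles\<close>

text \<open>Every chord borders two triangles of the tree, except for the base, which borders one;
  every side borders one. For a leaf the side and the base are the same and cancel.\<close>

lemma tree_sum:
  fixes w :: "nat \<Rightarrow> nat \<Rightarrow> int"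
  shows "(\<Sum>(a, b, c)\<in>triangles i T. w a b + w b c + w a c) =
    2 * (\<Sum>(a, b)\<in>chords i T. w a b) + (\<Sum>p = i..<i + width T. w p (Suc p)) - w i (i + width T)"
proof (induction T arbitrary: i)
  case (Tri l r)
  let ?j = "i + width l" and ?k = "i + width l + width r"
  have pos: "0 < width l" "0 < width r" by simp_all
  have t1: "(i, ?j, ?k) \<notin> triangles i l \<union> triangles ?j r"
    using triangles_bounds[of i ?j ?k i l] triangles_bounds[of i ?j ?k ?j r] pos by auto
  have t2: "triangles i l \<inter> triangles ?j r = {}"
    using triangles_bounds[of _ _ _ i l] triangles_bounds[of _ _ _ ?j r] by force
  have c1: "(i, ?k) \<notin> chords i l \<union> chords ?j r"
    using chords_bounds[of i ?k i l] chords_bounds[of i ?k ?j r] pos by auto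
  have c2: "chords i l \<inter> chords ?j r = {}"
    using chords_bounds[of _ _ i l] chords_bounds[of _ _ ?j r] by force
  have "(\<Sum>p = i..<i + width (Tri l r). w p (Suc p)) = (\<Sum>p = i..<?j. w p (Suc p)) + (\<Sum>p = ?j..<?k. w p (Suc p))"
    using sum.atLeastLessThan_concat[of i ?j ?k "\<lambda>p. w p (Suc p)"] by (simp add: add.assoc)
  then show ?case
    using Tri.IH(1)[of i] Tri.IH(2)[of ?j] t1 c1
    by (simp add: sum.union_disjoint[OF _ _ t2] sum.union_disjoint[OF _ _ c2] add.assoc)
qed simp

lemma spin_triangle:
  fixes x y z :: int
  assumes "x \<in> {1, -1}" "y \<in> {1, -1}" "z \<in> {1, -1}"
  shows "x * y + y * z + x * z \<ge> -1" "x * y + y * z + x * z = -1 \<longleftrightarrow> \<not> (x = y \<and> y = z)"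
  using assms by auto

context glued_triangulation
begin

lemma pair_edge_prod:
  fixes \<sigma> :: "'a \<Rightarrow> int"
  assumes "(a, b) \<in> edge_pairs"
  shows "(\<Prod>v\<in>pair_edge (a, b). \<sigma> v) = \<sigma> (vertex a) * \<sigma> (vertex b)"
  using vertex_neq[OF assms] by (simp add: pair_edge_def)

text \<open>Every edge borders two faces. For chords this is \<open>tree_sum\<close>, with the added
  triangle on the other side of the base; a glued side borders one triangle at each of its two
  positions.\<close>

lemma energy_eq_triangle_sum:
  fixes \<sigma> :: "'a \<Rightarrow> int"
  shows "2 * ising_energy graph_edges \<sigma> =
    (\<Sum>(a, b, c)\<in>all_triangles. \<sigma> (vertex a) * \<sigma> (vertex b) + \<sigma> (vertex b) * \<sigma> (vertex c) + \<sigma> (vertex a) * \<sigma> (vertex c))"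
proof -
  define w where "w a b = \<sigma> (vertex a) * \<sigma> (vertex b)" for a b
  define f where "f e = (\<Prod>v\<in>e. \<sigma> v)" for e
  have f: "f (pair_edge (a, b)) = w a b" if "(a, b) \<in> edge_pairs" for a b
    using pair_edge_prod[OF that] by (simp add: f_def w_def)
  have disj: "pair_edge ` chords 0 W \<inter> pair_edge ` sides = {}"
    using chord_not_side by (auto simp: pair_edge_def sides_def vertex_def)
  have inj: "inj_on pair_edge (chords 0 W)"
    using chord_inj by (auto simp: inj_on_def pair_edge_def vertex_def)
  have ch: "sum f (pair_edge ` chords 0 W) = (\<Sum>(a, b)\<in>chords 0 W. w a b)"
    by (subst sum.reindex[OF inj]) (auto intro!: sum.cong simp: f)
  \<comment> \<open>The positions are grouped by their glued edge, and \<open>side_pairs\<close>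
    gives each group two members.\<close>
  have "(\<Sum>p<N. w p (Suc p)) = (\<Sum>e\<in>(\<lambda>p. pair_edge (p, Suc p)) ` {..<N}.
      \<Sum>p\<in>{p \<in> {..<N}. pair_edge (p, Suc p) = e}. w p (Suc p))"
    by (rule sum.image_gen) simp
  also have "\<dots> = (\<Sum>e\<in>(\<lambda>p. pair_edge (p, Suc p)) ` {..<N}. 2 * f e)"
  proof (rule sum.cong[OF refl])
    fix e assume "e \<in> (\<lambda>p. pair_edge (p, Suc p)) ` {..<N}"
    then obtain r where r: "r < N" "e = pair_edge (r, Suc r)" by auto
    have "(\<Sum>p\<in>{p \<in> {..<N}. pair_edge (p, Suc p) = e}. w p (Suc p)) = (\<Sum>p\<in>{p \<in> {..<N}. pair_edge (p, Suc p) = e}. f e)"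
      by (rule sum.cong[OF refl]) (use f in \<open>force simp: sides_def\<close>)
    also have "\<dots> = 2 * f e"
      using side_pairs[OF r(1)] by (simp add: r(2) pair_edge_def vertex_def)
    finally show "(\<Sum>p\<in>{p \<in> {..<N}. pair_edge (p, Suc p) = e}. w p (Suc p)) = 2 * f e" .
  qed
  also have "\<dots> = 2 * sum f (pair_edge ` sides)"
    by (simp add: sides_def image_image sum_distrib_left)
  finally have sd: "(\<Sum>p<N. w p (Suc p)) = 2 * sum f (pair_edge ` sides)" .
  have "ising_energy graph_edges \<sigma> = sum f (pair_edge ` chords 0 W) + sum f (pair_edge ` sides)"
    unfolding ising_energy_def graph_edges_def f_def[symmetric] image_Un
    by (rule sum.union_disjoint) (use disj in \<open>auto simp: sides_def\<close>)
  then have "2 * ising_energy graph_edges \<sigma> = 2 * (\<Sum>(a, b)\<in>chords 0 W. w a b) + (\<Sum>p<N. w p (Suc p))"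
    using ch sd by simp
  moreover have "(\<Sum>p<N. w p (Suc p)) = (\<Sum>p = 0..<width W. w p (Suc p)) + w (N - 2) (N - 1) + w (N - 1) 0"
  proof -
    have "{..<N} = insert (N - 1) (insert (N - 2) {0..<width W})"
      using width_W by auto
    moreover have "w (N - 1) (Suc (N - 1)) = w (N - 1) 0" "Suc (N - 2) = N - 1"
      using N_ge vertex_N by (simp_all add: w_def)
    ultimately show ?thesis using width_W by simp
  qed
  moreover have "(\<Sum>(a, b, c)\<in>all_triangles. w a b + w b c + w a c) =
      (w 0 (N - 2) + w (N - 2) (N - 1) + w 0 (N - 1)) + (\<Sum>(a, b, c)\<in>triangles 0 W. w a b + w b c + w a c)"
    unfolding all_triangles_def
    by (subst sum.insert) (use triangles_bounds[of 0 "N - 2" "N - 1" 0 W] width_W in auto)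
  moreover have "w 0 (N - 1) = w (N - 1) 0" by (simp add: w_def)
  ultimately have "2 * ising_energy graph_edges \<sigma> = (\<Sum>(a, b, c)\<in>all_triangles. w a b + w b c + w a c)"
    using tree_sum[of w 0 W] by (simp add: width_W')
  then show ?thesis by (simp add: w_def)
qed

section \<open>Groundstates as states without monochromatic triangles\<close>

lemma finite_all_triangles: "finite all_triangles"
  by (simp add: all_triangles_def)

definition satisfied :: "('a \<Rightarrow> int) \<Rightarrow> bool" where
  "satisfied \<sigma> \<longleftrightarrow> (\<forall>(a, b, c)\<in>all_triangles. \<not> (\<sigma> (vertex a) = \<sigma> (vertex b) \<and> \<sigma> (vertex b) = \<sigma> (vertex c)))"

lemma energy_bound:
  assumes "\<sigma> \<in> states vertices"
  shows "2 * ising_energy graph_edges \<sigma> \<ge> - int (card all_triangles)"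
    "2 * ising_energy graph_edges \<sigma> = - int (card all_triangles) \<longleftrightarrow> satisfied \<sigma>"
proof -
  define t where "t = (\<lambda>(a, b, c). \<sigma> (vertex a) * \<sigma> (vertex b) + \<sigma> (vertex b) * \<sigma> (vertex c) + \<sigma> (vertex a) * \<sigma> (vertex c))"
  have E: "2 * ising_energy graph_edges \<sigma> = sum t all_triangles"
    by (simp add: energy_eq_triangle_sum t_def)
  have spin: "\<sigma> (vertex p) \<in> {1, -1}" if "p < N" for p
    using assms that by (auto simp: states_def vertices_def PiE_iff)
  have t: "t (a, b, c) \<ge> -1" "t (a, b, c) = -1 \<longleftrightarrow> \<not> (\<sigma> (vertex a) = \<sigma> (vertex b) \<and> \<sigma> (vertex b) = \<sigma> (vertex c))"
    if "(a, b, c) \<in> all_triangles" for a b c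
    using all_triangles_bounds[OF that] spin_triangle[of "\<sigma> (vertex a)" "\<sigma> (vertex b)" "\<sigma> (vertex c)"] spin
    by (simp_all add: t_def)
  have nn: "\<forall>x\<in>all_triangles. 0 \<le> t x + 1" using t(1) by fastforce
  have S: "sum t all_triangles + int (card all_triangles) = (\<Sum>x\<in>all_triangles. t x + 1)"
    by (simp add: sum.distrib)
  have "(\<Sum>x\<in>all_triangles. t x + 1) \<ge> 0" using nn by (intro sum_nonneg) auto
  then show "2 * ising_energy graph_edges \<sigma> \<ge> - int (card all_triangles)" using E S by linarith
  have "(\<Sum>x\<in>all_triangles. t x + 1) = 0 \<longleftrightarrow> (\<forall>x\<in>all_triangles. t x + 1 = 0)"
    using sum_nonneg_eq_0_iff[OF finite_all_triangles, of "\<lambda>x. t x + 1"] nn by simp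
  also have "\<dots> \<longleftrightarrow> satisfied \<sigma>"
    unfolding satisfied_def using t(2) by (auto simp: eq_neg_iff_add_eq_0)
  finally show "2 * ising_energy graph_edges \<sigma> = - int (card all_triangles) \<longleftrightarrow> satisfied \<sigma>"
    using E S by linarith
qed

text \<open>The spins s show that the bound of \<open>energy_bound\<close> is attained, so the
  groundstates are exactly the satisfying states, and uniqueness up to sign leaves two. The spins
  are given on positions, where the labels live; \<open>wd\<close> makes them functions of the
  vertex.\<close>

lemma nondegenerate_if_unique:
  fixes s :: "nat \<Rightarrow> int"
  assumes spin: "\<And>p. p < N \<Longrightarrow> s p \<in> {1, -1}"
    and wd: "\<And>p r. p < N \<Longrightarrow> r < N \<Longrightarrow> vertex p = vertex r \<Longrightarrow> s p = s r"
    and sat: "\<And>a b c. (a, b, c) \<in> all_triangles \<Longrightarrow> \<not> (s a = s b \<and> s b = s c)"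
    and uniq: "\<And>\<sigma>. \<sigma> \<in> states vertices \<Longrightarrow> satisfied \<sigma> \<Longrightarrow> \<exists>\<epsilon>\<in>{1, -1}. \<forall>p<N. \<sigma> (vertex p) = \<epsilon> * s p"
  shows "nondegenerate_groundstate vertices graph_edges"
proof -
  \<comment> \<open>States are extensional functions on the vertex set, hence
    \<open>restrict\<close>.\<close>
  define st where "st \<epsilon> = restrict (\<lambda>x. \<epsilon> * s (SOME p. p < N \<and> vertex p = x)) vertices" for \<epsilon> :: int
  have st: "st \<epsilon> (vertex p) = \<epsilon> * s p" if "p < N" for \<epsilon> p
  proof -
    define r where "r = (SOME r. r < N \<and> vertex r = vertex p)"
    have "r < N \<and> vertex r = vertex p"
      unfolding r_def by (rule someI[of _ p]) (use that in simp)
    then have "s r = s p" using wd that by blast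
    then show ?thesis using that by (simp add: st_def vertices_def r_def)
  qed
  have st_states: "st \<epsilon> \<in> states vertices" if "\<epsilon> \<in> {1, -1}" for \<epsilon>
    unfolding states_def
  proof (rule PiE_I)
    fix x assume "x \<in> vertices"
    then obtain p where "p < N" "x = vertex p" by (auto simp: vertices_def)
    then show "st \<epsilon> x \<in> {1, -1}" using st[of p \<epsilon>] spin[of p] that by auto
  qed (simp add: st_def)
  have st_sat: "satisfied (st \<epsilon>)" if "\<epsilon> \<in> {1, -1}" for \<epsilon>
    unfolding satisfied_def
  proof clarify
    fix a b c assume abc: "(a, b, c) \<in> all_triangles" "st \<epsilon> (vertex a) = st \<epsilon> (vertex b)" "st \<epsilon> (vertex b) = st \<epsilon> (vertex c)"
    then show False using sat[OF abc(1)] all_triangles_bounds[OF abc(1)] that by (auto simp: st)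
  qed
  have min: "\<sigma> \<in> groundstates vertices graph_edges \<longleftrightarrow> \<sigma> \<in> states vertices \<and> satisfied \<sigma>" for \<sigma>
  proof
    assume g: "\<sigma> \<in> groundstates vertices graph_edges"
    then have "\<sigma> \<in> states vertices" "ising_energy graph_edges \<sigma> \<le> ising_energy graph_edges (st 1)"
      using st_states[of 1] by (auto simp: groundstates_def)
    then show "\<sigma> \<in> states vertices \<and> satisfied \<sigma>"
      using energy_bound[of \<sigma>] energy_bound(2)[of "st 1"] st_states[of 1] st_sat[of 1] by auto
  next
    assume "\<sigma> \<in> states vertices \<and> satisfied \<sigma>"
    then show "\<sigma> \<in> groundstates vertices graph_edges"
      using energy_bound(2)[of \<sigma>] energy_bound(1) by (fastforce simp: groundstates_def)
  qed
  have "groundstates vertices graph_edges = {st 1, st (-1)}"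
  proof (intro equalityI subsetI)
    fix \<sigma> assume "\<sigma> \<in> groundstates vertices graph_edges"
    then have \<sigma>: "\<sigma> \<in> states vertices" "satisfied \<sigma>" using min by auto
    then obtain \<epsilon> where \<epsilon>: "\<epsilon> \<in> {1, -1}" "\<forall>p<N. \<sigma> (vertex p) = \<epsilon> * s p" using uniq by blast
    have "\<sigma> = st \<epsilon>"
    proof (rule PiE_ext)
      show "\<sigma> \<in> vertices \<rightarrow>\<^sub>E {1, -1}" using \<sigma> by (simp add: states_def)
      show "st \<epsilon> \<in> vertices \<rightarrow>\<^sub>E {1, -1}" using st_states[OF \<epsilon>(1)] by (simp add: states_def)
      fix x assume "x \<in> vertices"
      then show "\<sigma> x = st \<epsilon> x" using \<epsilon>(2) st by (auto simp: vertices_def)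
    qed
    then show "\<sigma> \<in> {st 1, st (-1)}" using \<epsilon>(1) by auto
  next
    fix \<sigma> assume "\<sigma> \<in> {st 1, st (-1)}"
    then show "\<sigma> \<in> groundstates vertices graph_edges" using min st_states st_sat by auto
  qed
  moreover have "st 1 \<noteq> st (-1)"
  proof
    assume "st 1 = st (-1)"
    then have "s 0 = - s 0" using st[of 0 1] st[of 0 "-1"] N_ge by simp
    then show False using spin[of 0] N_ge by auto
  qed
  ultimately show ?thesis by (simp add: nondegenerate_groundstate_def)
qed

end

section \<open>Triangulated handles\<close>

text \<open>All triangles of this fan share its last corner; those of \<open>fan_left\<close> share
  the first.\<close>

definition fan_right :: "nat \<Rightarrow> ptree" where "fan_right k = (Tri Side ^^ k) Side"

definition fan_left :: "nat \<Rightarrow> ptree" where "fan_left k = ((\<lambda>T. Tri T Side) ^^ k) Side"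

text \<open>One turn of a strip of triangles: a side is split off at the left end, then one at the
  right end, and the strip continues with \<open>T\<close>.\<close>

definition zigzag :: "ptree \<Rightarrow> ptree" where "zigzag T = Tri Side (Tri T Side)"

text \<open>The base joins a_1 to b_1. The strip runs between a_1, a_2, v, b_1, b_2 at the start of
  the block and b_1, ..., b_5 at its end. \<open>fan_right (3 + 2 * m)\<close> is the fan of a_2
  over b_3, ..., b_(5+2m), v, and \<open>fan_left (1 + 2 * m)\<close> is the fan of a_1 over v,
  b_(5+2m), ..., b_5 on the other copy of b.\<close>

definition handle :: "nat \<Rightarrow> ptree" where
  "handle m = zigzag (zigzag (zigzag (zigzag
     (Tri Side (Tri (Tri (fan_right (3 + 2 * m)) Side) (fan_left (1 + 2 * m)))))))"

text \<open>Two copies of a with 3 edges each and two copies of b with \<open>6 + 2 * m\<close>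
  edges each.\<close>

definition period :: "nat \<Rightarrow> nat" where "period m = 18 + 4 * m"

text \<open>\<open>Tri Side Side\<close> is the triangle on b_1 of the previous handle, v and a_1 of
  the next one; the other two nodes connect it and the new handle to a_1 of the first
  handle.\<close>

primrec handles :: "nat \<Rightarrow> nat \<Rightarrow> ptree" where
  "handles m 0 = handle m"
| "handles m (Suc k) = Tri (Tri (handles m k) (Tri Side Side)) (handle m)"

lemma width_fan_right: "width (fan_right k) = k + 1"
  unfolding fan_right_def by (induction k) auto

lemma width_fan_left: "width (fan_left k) = k + 1"
  unfolding fan_left_def by (induction k) auto

lemma width_handle: "width (handle m) = 16 + 4 * m"
  by (simp add: handle_def zigzag_def width_fan_left width_fan_right)

lemma width_handles: "width (handles m k) + 2 = (k + 1) * period m"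
  by (induction k) (simp_all add: width_handle period_def)

lemma chords_fan_right: "chords i (fan_right k) = (\<lambda>a. (i + a, i + k + 1)) ` {..<k}"
proof (induction k arbitrary: i)
  case (Suc k)
  have "fan_right (Suc k) = Tri Side (fan_right k)" by (simp add: fan_right_def)
  then have "chords i (fan_right (Suc k)) = insert (i, i + k + 2) ((\<lambda>a. (i + Suc a, i + k + 2)) ` {..<k})"
    using Suc by (simp add: width_fan_right)
  also have "\<dots> = (\<lambda>a. (i + a, i + Suc k + 1)) ` {..<Suc k}"
    by (simp add: lessThan_Suc_eq_insert_0 image_image del: add_Suc_right) simp
  finally show ?case .
qed (simp add: fan_right_def)

lemma triangles_fan_right: "triangles i (fan_right k) = (\<lambda>a. (i + a, i + a + 1, i + k + 1)) ` {..<k}"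
proof (induction k arbitrary: i)
  case (Suc k)
  have "fan_right (Suc k) = Tri Side (fan_right k)" by (simp add: fan_right_def)
  then have "triangles i (fan_right (Suc k)) = insert (i, i + 1, i + k + 2) ((\<lambda>a. (i + Suc a, i + Suc a + 1, i + k + 2)) ` {..<k})"
    using Suc by (simp add: width_fan_right)
  also have "\<dots> = (\<lambda>a. (i + a, i + a + 1, i + Suc k + 1)) ` {..<Suc k}"
    by (simp add: lessThan_Suc_eq_insert_0 image_image del: add_Suc_right) simp
  finally show ?case .
qed (simp add: fan_right_def)

lemma chords_fan_left: "chords i (fan_left k) = (\<lambda>a. (i, i + a + 2)) ` {..<k}"
proof (induction k)
  case (Suc k)
  have "fan_left (Suc k) = Tri (fan_left k) Side" by (simp add: fan_left_def)
  then show ?case using Suc by (auto simp: width_fan_left lessThan_Suc)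
qed (simp add: fan_left_def)

lemma triangles_fan_left: "triangles i (fan_left k) = (\<lambda>a. (i, i + a + 1, i + a + 2)) ` {..<k}"
proof (induction k)
  case (Suc k)
  have "fan_left (Suc k) = Tri (fan_left k) Side" by (simp add: fan_left_def)
  then show ?case using Suc by (auto simp: width_fan_left lessThan_Suc)
qed (simp add: fan_left_def)

lemma zigzag_simps:
  assumes "j = i + 1" "e = i + width T + 2"
  shows "chords i (zigzag T) = {(i, e), (j, e)} \<union> chords j T"
    "d = i + width T + 1 \<Longrightarrow> triangles i (zigzag T) = {(i, j, e), (j, d, e)} \<union> triangles j T"
  using assms by (auto simp: zigzag_def)

lemma handle_core:
  fixes m i :: nat
  defines "T \<equiv> Tri Side (Tri (Tri (fan_right (3 + 2 * m)) Side) (fan_left (1 + 2 * m)))"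
  shows "width T = 8 + 4 * m"
    "chords (i + 4) T = {(i + 4, i + 12 + 4 * m), (i + 5, i + 12 + 4 * m), (i + 5, i + 10 + 2 * m)} \<union>
      (\<lambda>a. (i + 5 + a, i + 9 + 2 * m)) ` {..<3 + 2 * m} \<union>
      (\<lambda>a. (i + 10 + 2 * m, i + 12 + 2 * m + a)) ` {..<1 + 2 * m}"
    "triangles (i + 4) T = {(i + 4, i + 5, i + 12 + 4 * m), (i + 5, i + 10 + 2 * m, i + 12 + 4 * m),
        (i + 5, i + 9 + 2 * m, i + 10 + 2 * m)} \<union>
      (\<lambda>a. (i + 5 + a, i + 6 + a, i + 9 + 2 * m)) ` {..<3 + 2 * m} \<union>
      (\<lambda>a. (i + 10 + 2 * m, i + 11 + 2 * m + a, i + 12 + 2 * m + a)) ` {..<1 + 2 * m}"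
proof -
  have p: "i + 4 + 1 = i + 5" "i + 5 + (3 + 2 * m + 1) = i + 9 + 2 * m" "i + 9 + 2 * m + 1 = i + 10 + 2 * m"
    "i + 10 + 2 * m + (1 + 2 * m + 1) = i + 12 + 4 * m" "i + 5 + (3 + 2 * m + 1 + 1) = i + 10 + 2 * m"
    "i + 5 + (3 + 2 * m + 1 + 1 + (1 + 2 * m + 1)) = i + 12 + 4 * m" "i + 5 + (3 + 2 * m) + 1 = i + 9 + 2 * m"
    "i + 10 + 2 * m + a + 2 = i + 12 + 2 * m + a" "i + 10 + 2 * m + a + 1 = i + 11 + 2 * m + a"
    "i + 5 + a + 1 = i + 6 + a" "i + 6 + (3 + 2 * m) = i + 9 + 2 * m" for a
    by simp_all
  show "width T = 8 + 4 * m" by (simp add: T_def width_fan_left width_fan_right)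
  show "chords (i + 4) T = {(i + 4, i + 12 + 4 * m), (i + 5, i + 12 + 4 * m), (i + 5, i + 10 + 2 * m)} \<union>
      (\<lambda>a. (i + 5 + a, i + 9 + 2 * m)) ` {..<3 + 2 * m} \<union>
      (\<lambda>a. (i + 10 + 2 * m, i + 12 + 2 * m + a)) ` {..<1 + 2 * m}"
    unfolding T_def chords.simps width.simps width_fan_left width_fan_right p chords_fan_left chords_fan_right by blast
  show "triangles (i + 4) T = {(i + 4, i + 5, i + 12 + 4 * m), (i + 5, i + 10 + 2 * m, i + 12 + 4 * m),
        (i + 5, i + 9 + 2 * m, i + 10 + 2 * m)} \<union>
      (\<lambda>a. (i + 5 + a, i + 6 + a, i + 9 + 2 * m)) ` {..<3 + 2 * m} \<union>
      (\<lambda>a. (i + 10 + 2 * m, i + 11 + 2 * m + a, i + 12 + 2 * m + a)) ` {..<1 + 2 * m}"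
    unfolding T_def triangles.simps width.simps width_fan_left width_fan_right p triangles_fan_left triangles_fan_right by blast
qed

lemma chords_handle:
  "chords i (handle m) =
    {(i, i + 16 + 4 * m), (i + 1, i + 16 + 4 * m), (i + 1, i + 15 + 4 * m), (i + 2, i + 15 + 4 * m),
     (i + 2, i + 14 + 4 * m), (i + 3, i + 14 + 4 * m), (i + 3, i + 13 + 4 * m), (i + 4, i + 13 + 4 * m),
     (i + 4, i + 12 + 4 * m), (i + 5, i + 12 + 4 * m), (i + 5, i + 10 + 2 * m)} \<union>
    (\<lambda>a. (i + 5 + a, i + 9 + 2 * m)) ` {..<3 + 2 * m} \<union>
    (\<lambda>a. (i + 10 + 2 * m, i + 12 + 2 * m + a)) ` {..<1 + 2 * m}"
proof -
  define T where "T = Tri Side (Tri (Tri (fan_right (3 + 2 * m)) Side) (fan_left (1 + 2 * m)))"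
  note c = handle_core(1)[where m = m, folded T_def] handle_core(2,3)[where m = m and i = i, folded T_def]
  have w: "width (zigzag T) = 10 + 4 * m" "width (zigzag (zigzag T)) = 12 + 4 * m"
    "width (zigzag (zigzag (zigzag T))) = 14 + 4 * m"
    by (simp_all add: zigzag_def c(1))
  have z4: "chords (i + 3) (zigzag (T)) = {(i + 3, i + 13 + 4 * m), (i + 4, i + 13 + 4 * m)} \<union> chords (i + 4) (T)"
    by (rule zigzag_simps(1)) (simp_all add: c(1) w)
  have z3: "chords (i + 2) (zigzag (zigzag T)) = {(i + 2, i + 14 + 4 * m), (i + 3, i + 14 + 4 * m)} \<union> chords (i + 3) (zigzag T)"
    by (rule zigzag_simps(1)) (simp_all add: c(1) w)
  have z2: "chords (i + 1) (zigzag (zigzag (zigzag T))) = {(i + 1, i + 15 + 4 * m), (i + 2, i + 15 + 4 * m)} \<union> chords (i + 2) (zigzag (zigzag T))"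
    by (rule zigzag_simps(1)) (simp_all add: c(1) w)
  have z1: "chords (i) (zigzag (zigzag (zigzag (zigzag T)))) = {(i, i + 16 + 4 * m), (i + 1, i + 16 + 4 * m)} \<union> chords (i + 1) (zigzag (zigzag (zigzag T)))"
    by (rule zigzag_simps(1)) (simp_all add: c(1) w)
  have h: "handle m = zigzag (zigzag (zigzag (zigzag T)))" by (simp add: handle_def T_def)
  show ?thesis unfolding h z1 z2 z3 z4 c(2) by (simp only: Un_insert_left Un_empty_left Un_assoc)
qed

lemma triangles_handle:
  "triangles i (handle m) =
    {(i, i + 1, i + 16 + 4 * m), (i + 1, i + 15 + 4 * m, i + 16 + 4 * m),
     (i + 1, i + 2, i + 15 + 4 * m), (i + 2, i + 14 + 4 * m, i + 15 + 4 * m),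
     (i + 2, i + 3, i + 14 + 4 * m), (i + 3, i + 13 + 4 * m, i + 14 + 4 * m),
     (i + 3, i + 4, i + 13 + 4 * m), (i + 4, i + 12 + 4 * m, i + 13 + 4 * m),
     (i + 4, i + 5, i + 12 + 4 * m), (i + 5, i + 10 + 2 * m, i + 12 + 4 * m),
     (i + 5, i + 9 + 2 * m, i + 10 + 2 * m)} \<union>
    (\<lambda>a. (i + 5 + a, i + 6 + a, i + 9 + 2 * m)) ` {..<3 + 2 * m} \<union>
    (\<lambda>a. (i + 10 + 2 * m, i + 11 + 2 * m + a, i + 12 + 2 * m + a)) ` {..<1 + 2 * m}"
proof -
  define T where "T = Tri Side (Tri (Tri (fan_right (3 + 2 * m)) Side) (fan_left (1 + 2 * m)))"
  note c = handle_core(1)[where m = m, folded T_def] handle_core(2,3)[where m = m and i = i, folded T_def]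
  have w: "width (zigzag T) = 10 + 4 * m" "width (zigzag (zigzag T)) = 12 + 4 * m"
    "width (zigzag (zigzag (zigzag T))) = 14 + 4 * m"
    by (simp_all add: zigzag_def c(1))
  have z4: "triangles (i + 3) (zigzag (T)) = {(i + 3, i + 4, i + 13 + 4 * m), (i + 4, i + 12 + 4 * m, i + 13 + 4 * m)} \<union> triangles (i + 4) (T)"
    by (rule zigzag_simps(2)) (simp_all add: c(1) w)
  have z3: "triangles (i + 2) (zigzag (zigzag T)) = {(i + 2, i + 3, i + 14 + 4 * m), (i + 3, i + 13 + 4 * m, i + 14 + 4 * m)} \<union> triangles (i + 3) (zigzag T)"
    by (rule zigzag_simps(2)) (simp_all add: c(1) w)
  have z2: "triangles (i + 1) (zigzag (zigzag (zigzag T))) = {(i + 1, i + 2, i + 15 + 4 * m), (i + 2, i + 14 + 4 * m, i + 15 + 4 * m)} \<union> triangles (i + 2) (zigzag (zigzag T))"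
    by (rule zigzag_simps(2)) (simp_all add: c(1) w)
  have z1: "triangles (i) (zigzag (zigzag (zigzag (zigzag T)))) = {(i, i + 1, i + 16 + 4 * m), (i + 1, i + 15 + 4 * m, i + 16 + 4 * m)} \<union> triangles (i + 1) (zigzag (zigzag (zigzag T)))"
    by (rule zigzag_simps(2)) (simp_all add: c(1) w)
  have h: "handle m = zigzag (zigzag (zigzag (zigzag T)))" by (simp add: handle_def T_def)
  show ?thesis unfolding h z1 z2 z3 z4 c(3) by (simp only: Un_insert_left Un_empty_left Un_assoc)
qed

lemma chords_handles:
  assumes "(a, b) \<in> chords 0 (handles m k)"
  obtains j where "j \<le> k" "(a, b) \<in> chords (j * period m) (handle m)"
  | j where "0 < j" "j \<le> k" "(a, b) \<in> {(0, j * period m), (0, j * period m + 16 + 4 * m), (j * period m - 2, j * period m)}"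
proof -
  have "(\<exists>j\<le>k. (a, b) \<in> chords (j * period m) (handle m)) \<or>
    (\<exists>j. 0 < j \<and> j \<le> k \<and> (a, b) \<in> {(0, j * period m), (0, j * period m + 16 + 4 * m), (j * period m - 2, j * period m)})"
    using assms
  proof (induction k)
    case (Suc k)
    have w: "width (handles m k) = Suc k * period m - 2" "width (handles m k) + 2 = Suc k * period m"
      using width_handles[of m k] by auto
    have "(a, b) \<in> chords 0 (handles m k) \<or> (a, b) \<in> chords (Suc k * period m) (handle m) \<or>
      (a, b) \<in> {(0, Suc k * period m), (0, Suc k * period m + 16 + 4 * m), (Suc k * period m - 2, Suc k * period m)}"
      using Suc.prems w by (auto simp: width_handle add.assoc simp del: mult_Suc)
    then show ?case using Suc.IH by (meson le_Suc_eq zero_less_Suc le_refl)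
  qed auto
  then show ?thesis using that by blast
qed

lemma triangles_handles:
  assumes "(a, b, c) \<in> triangles 0 (handles m k)"
  obtains j where "j \<le> k" "(a, b, c) \<in> triangles (j * period m) (handle m)"
  | j where "0 < j" "j \<le> k" "(a, b, c) \<in> {(0, j * period m - 2, j * period m),
      (0, j * period m, j * period m + 16 + 4 * m), (j * period m - 2, j * period m - 1, j * period m)}"
proof -
  have "(\<exists>j\<le>k. (a, b, c) \<in> triangles (j * period m) (handle m)) \<or>
    (\<exists>j. 0 < j \<and> j \<le> k \<and> (a, b, c) \<in> {(0, j * period m - 2, j * period m),
      (0, j * period m, j * period m + 16 + 4 * m), (j * period m - 2, j * period m - 1, j * period m)})"
    using assms
  proof (induction k)
    case (Suc k)
    have w: "width (handles m k) = Suc k * period m - 2" "width (handles m k) + 2 = Suc k * period m"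
      "Suc (width (handles m k)) = Suc k * period m - 1"
      using width_handles[of m k] by auto
    have "(a, b, c) \<in> triangles 0 (handles m k) \<or> (a, b, c) \<in> triangles (Suc k * period m) (handle m) \<or>
      (a, b, c) \<in> {(0, Suc k * period m - 2, Suc k * period m),
      (0, Suc k * period m, Suc k * period m + 16 + 4 * m), (Suc k * period m - 2, Suc k * period m - 1, Suc k * period m)}"
      using Suc.prems w by (auto simp: width_handle add.assoc simp del: mult_Suc)
    then show ?case using Suc.IH by (meson le_Suc_eq zero_less_Suc le_refl)
  qed auto
  then show ?thesis using that by blast
qed

lemma triangles_handle_in_handles:
  "j \<le> k \<Longrightarrow> triangles (j * period m) (handle m) \<subseteq> triangles 0 (handles m k)"
proof (induction k)
  case (Suc k)
  have w: "width (handles m k) + 2 = Suc k * period m"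
    using width_handles[of m k] by auto
  have "triangles (Suc k * period m) (handle m) \<subseteq> triangles 0 (handles m (Suc k))"
    using w by (auto simp: add.assoc simp del: mult_Suc)
  then show ?case using Suc by (cases "j = Suc k") auto
qed auto

section \<open>Vertex labels\<close>

text \<open>Positions are counted from a corner of the polygon, with \<open>period m\<close> positions for each handle. Within
  a handle the labels \<open>1\<close>, \<open>2\<close>, \<open>3\<close> and \<open>3 + i\<close> stand for the vertices $a_1$, $a_2$, $v$ and $b_i$.\<close>

definition local_label :: "nat \<Rightarrow> nat \<Rightarrow> nat" where
  "local_label m j =
     (if j \<in> {0, 3, 9 + 2 * m, 12 + 2 * m} then 3 else if j < 9 + 2 * m then j
      else if j < 12 + 2 * m then 12 + 2 * m - j else 21 + 4 * m - j)"

text \<open>All corners are one vertex, so the label 3 is not shifted with the block. Every other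
  label is the earlier of the two positions of its vertex.\<close>

definition label :: "nat \<Rightarrow> nat \<Rightarrow> nat" where
  "label m p = (if local_label m (p mod period m) = 3 then 3
     else p div period m * period m + local_label m (p mod period m))"

lemma period_pos [simp]: "period m > 0" "period m \<noteq> 0"
  by (simp_all add: period_def)

lemma label_add:
  assumes "x < period m"
  shows "label m (j * period m + x) = (if local_label m x = 3 then 3 else j * period m + local_label m x)"
  using assms by (simp add: label_def)

lemma local_label_bounds: "j < period m \<Longrightarrow> local_label m j < period m" "j < period m \<Longrightarrow> 0 < local_label m j"
  "j < period m \<Longrightarrow> local_label m j \<le> 8 + 2 * m"
  by (auto simp: local_label_def period_def)

text \<open>A left inverse of the labelling of chords: its existence shows that the graph has no multiple edges.\<close>

definition chord_of_locals :: "nat \<Rightarrow> nat \<Rightarrow> nat \<Rightarrow> nat \<times> nat" where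
  "chord_of_locals m u v =
     (if u = 1 \<and> v = 6 then (5, 10 + 2 * m) else if u = 1 \<and> v \<ge> 8 then (10 + 2 * m, 20 + 4 * m - v)
      else if u = 2 \<and> v \<ge> 6 then (v - 1, 9 + 2 * m) else (u - 1, 20 + 4 * m - v))"

text \<open>Positions in the tree are one less than those carrying the labels. The last conditions
  separate chords from sides: \<open>u + 2 \<le> v\<close> excludes consecutive labels, and from the
  corner vertex chords lead only to b_2 and b_3 (labels 5 and 6), whereas sides lead to a_1, a_2,
  b_1 and b_(5+2m).\<close>

definition chord_labelling :: "nat \<Rightarrow> nat \<Rightarrow> nat \<Rightarrow> nat \<Rightarrow> nat \<Rightarrow> bool" where
  "chord_labelling m x y u v \<longleftrightarrow> x + 1 < period m \<and> y + 1 < period m \<and>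
     (local_label m (x + 1) = u \<and> local_label m (y + 1) = v \<or> local_label m (x + 1) = v \<and> local_label m (y + 1) = u) \<and>
     0 < u \<and> u + 2 \<le> v \<and> v \<le> 8 + 2 * m \<and> (u = 3 \<longrightarrow> v = 5 \<or> v = 6) \<and> v \<noteq> 3 \<and> chord_of_locals m u v = (x, y)"

lemma handle_chord_labelling:
  assumes "(a, b) \<in> chords i (handle m)"
  shows "\<exists>x y u v. a = i + x \<and> b = i + y \<and> chord_labelling m x y u v"
proof -
  note defs = chord_labelling_def local_label_def chord_of_locals_def period_def
  have c: "chord_labelling m 0 (16 + 4 * m) 1 4" "chord_labelling m 1 (16 + 4 * m) 2 4"
    "chord_labelling m 1 (15 + 4 * m) 2 5" "chord_labelling m 2 (15 + 4 * m) 3 5"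
    "chord_labelling m 2 (14 + 4 * m) 3 6" "chord_labelling m 3 (14 + 4 * m) 4 6"
    "chord_labelling m 3 (13 + 4 * m) 4 7" "chord_labelling m 4 (13 + 4 * m) 5 7"
    "chord_labelling m 4 (12 + 4 * m) 5 8" "chord_labelling m 5 (12 + 4 * m) 6 8"
    "chord_labelling m 5 (10 + 2 * m) 1 6"
    by (auto simp: defs)
  have f: "chord_labelling m (5 + r) (9 + 2 * m) 2 (6 + r)" if "r < 3 + 2 * m" for r
    using that by (auto simp: defs)
  have f': "chord_labelling m (10 + 2 * m) (12 + 2 * m + r) 1 (8 + 2 * m - r)" if "r < 1 + 2 * m" for r
    using that by (auto simp: defs)
  consider "\<exists>x y u v. (a, b) = (i + x, i + y) \<and> chord_labelling m x y u v"
    | r where "r < 3 + 2 * m" "(a, b) = (i + 5 + r, i + 9 + 2 * m)"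
    | r where "r < 1 + 2 * m" "(a, b) = (i + 10 + 2 * m, i + 12 + 2 * m + r)"
    using assms c unfolding chords_handle by (elim UnE insertE emptyE imageE) (metis add.assoc add_0_right lessThan_iff)+
  then show ?thesis
  proof cases
    case (2 r)
    then show ?thesis using f[of r] by (auto simp: add.assoc)
  next
    case (3 r)
    then show ?thesis using f'[of r] by (auto simp: add.assoc)
  qed auto
qed

text \<open>The block is read off from \<open>B\<close>, as \<open>A\<close> may be the label 3
  common to all blocks. Labels from different blocks belong to the joining chords: from a_1 of the
  first handle to a_1 or b_1 of a later one, or from b_1 of a handle to a_1 of the next.\<close>

definition chord_of_labels :: "nat \<Rightarrow> nat \<Rightarrow> nat \<Rightarrow> nat \<times> nat" where
  "chord_of_labels m A B =
     (if A = 3 \<or> A div period m = B div period m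
      then map_prod ((+) (B div period m * period m)) ((+) (B div period m * period m))
        (chord_of_locals m (if A = 3 then 3 else A mod period m) (B mod period m))
      else if A = 1 then (0, if B mod period m = 1 then B - 1 else B + 12 + 4 * m) else (B - 3, B - 1))"

lemma chord_labels:
  assumes "(a, b) \<in> chords 0 (handles m k)"
  obtains A B where
    "label m (a + 1) = A \<and> label m (b + 1) = B \<or> label m (a + 1) = B \<and> label m (b + 1) = A"
    "A + 2 \<le> B" "A = 3 \<longrightarrow> B mod period m \<in> {5, 6}" "B \<noteq> 3" "chord_of_labels m A B = (a, b)"
  using assms
proof (cases rule: chords_handles)
  case (1 j)
  let ?M = "period m"
  obtain x y u v where xy: "a = j * ?M + x" "b = j * ?M + y" "chord_labelling m x y u v"
    using handle_chord_labelling[OF 1(2)] by blast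
  \<comment> \<open>An offset of at most 3 forces the first block, so that the value 3 cannot arise
    from a vertex other than the corner.\<close>
  have j0: "j = 0" if "j * ?M \<le> 3" using that by (cases j) (auto simp: period_def)
  define A where "A = (if u = 3 then 3 else j * ?M + u)"
  define B where "B = j * ?M + v"
  note c = xy(3)[unfolded chord_labelling_def]
  have uv: "u < ?M" "v < ?M" using c by (auto simp: period_def)
  have la: "label m (a + 1) = (if local_label m (x + 1) = 3 then 3 else j * ?M + local_label m (x + 1))"
    "label m (b + 1) = (if local_label m (y + 1) = 3 then 3 else j * ?M + local_label m (y + 1))"
    using c label_add[of "x + 1" m j] label_add[of "y + 1" m j] xy by (simp_all add: add.assoc)
  show ?thesis
  proof (rule that)
    show "label m (a + 1) = A \<and> label m (b + 1) = B \<or> label m (a + 1) = B \<and> label m (b + 1) = A"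
      unfolding la A_def B_def using c by auto
    show "A + 2 \<le> B" using c by (auto simp: A_def B_def)
    show "A = 3 \<longrightarrow> B mod ?M \<in> {5, 6}"
    proof
      assume "A = 3"
      have "u = 3"
      proof (rule ccontr)
        assume "u \<noteq> 3"
        then have "j * ?M + u = 3" using \<open>A = 3\<close> by (simp add: A_def)
        then show False using j0 \<open>u \<noteq> 3\<close> by fastforce
      qed
      then show "B mod ?M \<in> {5, 6}" using c uv by (auto simp: B_def)
    qed
    show "B \<noteq> 3"
    proof
      assume "B = 3"
      then have "j = 0" using j0 by (simp add: B_def)
      then show False using \<open>B = 3\<close> c by (simp add: B_def)
    qed
    have "chord_of_labels m A B = map_prod ((+) (j * ?M)) ((+) (j * ?M)) (chord_of_locals m u v)"
    proof (cases "u = 3")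
      case True
      then show ?thesis using uv by (simp add: chord_of_labels_def A_def B_def)
    next
      case False
      have "A \<noteq> 3 \<or> u = 3"
      proof (rule ccontr)
        assume "\<not> (A \<noteq> 3 \<or> u = 3)"
        then have "j * ?M + u = 3" "u \<noteq> 3" by (auto simp: A_def split: if_splits)
        then show False using j0 by fastforce
      qed
      then show ?thesis using False uv by (simp add: chord_of_labels_def A_def B_def)
    qed
    then show "chord_of_labels m A B = (a, b)" using c xy by simp
  qed
next
  case (2 j)
  let ?M = "period m"
  have jM: "j * ?M = (j - 1) * ?M + ?M" using 2(1) by (cases j) auto
  have M: "?M = 18 + 4 * m" by (simp add: period_def)
  have ll: "local_label m 1 = 1" "local_label m (17 + 4 * m) = 4" by (auto simp: local_label_def)
  have l: "label m 1 = 1" "label m (j * ?M + 1) = j * ?M + 1" "label m (j * ?M + (17 + 4 * m)) = j * ?M + 4"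
    "label m ((j - 1) * ?M + (17 + 4 * m)) = (j - 1) * ?M + 4"
    using label_add[of 1 m 0] label_add[of 1 m j] label_add[of "17 + 4 * m" m j] label_add[of "17 + 4 * m" m "j - 1"] ll M
    by simp_all
  have dm: "(i * ?M + x) div ?M = i" "(i * ?M + x) mod ?M = x" if "x < ?M" for i x
    using that by simp_all
  have d: "(j * ?M + 1) div ?M = j" "(j * ?M + 4) div ?M = j" "((j - 1) * ?M + 4) div ?M = j - 1" "1 div ?M = 0"
    "(j * ?M + 1) mod ?M = 1" "(j * ?M + 4) mod ?M = 4"
    by (rule dm, simp add: M)+ (simp add: M, (rule dm, simp add: M)+)
  consider "(a, b) = (0, j * ?M)" | "(a, b) = (0, j * ?M + 16 + 4 * m)" | "(a, b) = (j * ?M - 2, j * ?M)"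
    using 2(3) by auto
  then show ?thesis
  proof cases
    case 1
    show ?thesis
      by (rule that[of 1 "j * ?M + 1"]) (use 1 l d M jM 2(1) in \<open>auto simp: chord_of_labels_def\<close>)
  next
    case 2
    have b: "b + 1 = j * ?M + (17 + 4 * m)" using 2 by simp
    have "label m (a + 1) = 1" "label m (b + 1) = j * ?M + 4" unfolding b l using 2 l(1) by simp_all
    moreover have "chord_of_labels m 1 (j * ?M + 4) = (a, b)"
      unfolding chord_of_labels_def d using 2 \<open>0 < j\<close> by simp
    ultimately show ?thesis by (intro that[of 1 "j * ?M + 4"]) simp_all
  next
    case 3
    have a: "a + 1 = (j - 1) * ?M + (17 + 4 * m)" using 3 jM M by simp
    have "label m (a + 1) = (j - 1) * ?M + 4" "label m (b + 1) = j * ?M + 1" 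
      by (simp only: a l, use 3 l(2) in simp)
    moreover have "(j - 1) * ?M + 4 + 2 \<le> j * ?M + 1" using jM M by simp
    moreover have "chord_of_labels m ((j - 1) * ?M + 4) (j * ?M + 1) = (a, b)"
      unfolding chord_of_labels_def d using 3 \<open>0 < j\<close> by (auto simp del: mult_eq_if)
    ultimately show ?thesis using jM M by (intro that[of "(j - 1) * ?M + 4" "j * ?M + 1"]) auto
  qed
qed

lemma chord_label_neq:
  assumes "(a, b) \<in> chords 0 (handles m k)"
  shows "label m (a + 1) \<noteq> label m (b + 1)"
  by (rule chord_labels[OF assms]) auto

text \<open>The order \<open>A + 2 \<le> B\<close> turns the set of labels into an ordered pair, to
  which the left inverse applies.\<close>

lemma chord_label_inj:
  assumes "(a, b) \<in> chords 0 (handles m k)" "(c, d) \<in> chords 0 (handles m k)"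
    "{label m (a + 1), label m (b + 1)} = {label m (c + 1), label m (d + 1)}"
  shows "(a, b) = (c, d)"
proof -
  obtain A B where 1: "label m (a + 1) = A \<and> label m (b + 1) = B \<or> label m (a + 1) = B \<and> label m (b + 1) = A"
    "A + 2 \<le> B" "chord_of_labels m A B = (a, b)" by (rule chord_labels[OF assms(1)])
  obtain C D where 2: "label m (c + 1) = C \<and> label m (d + 1) = D \<or> label m (c + 1) = D \<and> label m (d + 1) = C"
    "C + 2 \<le> D" "chord_of_labels m C D = (c, d)" by (rule chord_labels[OF assms(2)])
  have "{label m (a + 1), label m (b + 1)} = {A, B}" "{label m (c + 1), label m (d + 1)} = {C, D}"
    using 1(1) 2(1) by auto
  then have "{A, B} = {C, D}" using assms(3) by simp
  then have "A = C \<and> B = D" using 1(2) 2(2) by (auto simp: doubleton_eq_iff)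
  then show ?thesis using 1(3) 2(3) by simp
qed

text \<open>Away from the corners a side has consecutive labels and starts at the smaller one. At
  the corner vertex, the first copies of the four sides of a handle start at the local positions 0,
  2, 3 and \<open>8 + 2 * m\<close>: one before the other label if that is 1 or 4, and at it if that
  is 2 or \<open>8 + 2 * m\<close>.\<close>

definition side_of_labels :: "nat \<Rightarrow> nat \<Rightarrow> nat \<Rightarrow> nat" where
  "side_of_labels m A B =
     (let spoke = (\<lambda>x. if x mod period m = 1 \<or> x mod period m = 4 then x - 1 else x)
      in if A = 3 then spoke B else if B = 3 then spoke A else min A B)"

lemma side_of_labels_commute: "side_of_labels m A B = side_of_labels m B A"
  by (auto simp: side_of_labels_def Let_def min.commute)

text \<open>The earlier of the two copies of a side. The constants are one below those of
  \<open>local_label\<close>, because reflection turns the far end of a side into the start of its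
  copy.\<close>

definition first_side :: "nat \<Rightarrow> nat \<Rightarrow> nat" where
  "first_side m p = p div period m * period m +
     (let j = p mod period m in if j < 9 + 2 * m then j else if j < 12 + 2 * m then 11 + 2 * m - j else 20 + 4 * m - j)"

lemma side_labels:
  fixes m p :: nat
  defines "A \<equiv> label m p" and "B \<equiv> label m (p + 1)"
  shows "A = 3 \<and> B \<noteq> 3 \<and> B mod period m \<notin> {5, 6} \<or> B = 3 \<and> A \<noteq> 3 \<and> A mod period m \<notin> {5, 6}
      \<or> A \<noteq> 3 \<and> B \<noteq> 3 \<and> (A = B + 1 \<or> B = A + 1)"
    "side_of_labels m A B = first_side m p"
proof -
  let ?M = "period m"
  define k j where "k = p div ?M" and "j = p mod ?M"
  have p: "p = k * ?M + j" "j < ?M" by (simp_all add: k_def j_def)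
  have M: "?M = 18 + 4 * m" by (simp add: period_def)
  have A: "A = (if local_label m j = 3 then 3 else k * ?M + local_label m j)"
    using label_add[OF p(2), of k] by (simp add: A_def p)
  have k3: "k = 0" if "k * ?M + x = 3" for x using that by (cases k) (auto simp: M)
  have n3: "k * ?M + x \<noteq> 3" if "x \<noteq> 3" for x using k3[of x] that by (cases k) (auto simp: M)
  have n2: "k * ?M + x \<noteq> 2" if "x \<noteq> 2" for x using n3[of "x + 1"] that by auto
  have md: "(k * ?M + x) mod ?M = x" if "x < ?M" for x using that by simp
  have fs: "first_side m p = k * ?M + (if j < 9 + 2 * m then j else if j < 12 + 2 * m then 11 + 2 * m - j else 20 + 4 * m - j)"
    by (simp add: first_side_def k_def j_def Let_def)
  have B: "B = (if j = 17 + 4 * m \<or> local_label m (j + 1) = 3 then 3 else k * ?M + local_label m (j + 1))"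
  proof (cases "j = 17 + 4 * m")
    case True
    then have "p + 1 = (k + 1) * ?M + 0" using p M by simp
    then have "B = 3" using label_add[of 0 m "k + 1"] by (simp add: B_def local_label_def)
    then show ?thesis using True by simp
  next
    case False
    then show ?thesis using label_add[of "j + 1" m k] p M by (simp add: B_def add.assoc)
  qed
  have sp: "side_of_labels m 3 (k * ?M + x) = k * ?M + (if x = 1 \<or> x = 4 then x - 1 else x)"
    "side_of_labels m (k * ?M + x) 3 = k * ?M + (if x = 1 \<or> x = 4 then x - 1 else x)" if "x < ?M" "x \<noteq> 3" for x
    using md[OF that(1)] n3[OF that(2)] by (auto simp: side_of_labels_def)
  have sn: "side_of_labels m (k * ?M + x) (k * ?M + y) = k * ?M + min x y" if "x \<noteq> 3" "y \<noteq> 3" for x y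
    using n3 that by (auto simp: side_of_labels_def)
  define a b where "a = local_label m j" and "b = (if j = 17 + 4 * m then 3 else local_label m (j + 1))"
  have ab: "A = (if a = 3 then 3 else k * ?M + a)" "B = (if b = 3 then 3 else k * ?M + b)"
    using A B by (auto simp: a_def b_def)
  define f where "f = (if j < 9 + 2 * m then j else if j < 12 + 2 * m then 11 + 2 * m - j else 20 + 4 * m - j)"
  have main: "a < ?M \<and> b < ?M \<and> (a = 3 \<and> b \<notin> {3, 5, 6} \<and> f = (if b = 1 \<or> b = 4 then b - 1 else b) \<or>
     b = 3 \<and> a \<notin> {3, 5, 6} \<and> f = (if a = 1 \<or> a = 4 then a - 1 else a) \<or>
     a \<noteq> 3 \<and> b \<noteq> 3 \<and> (a = b + 1 \<or> b = a + 1) \<and> f = min a b)"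
  proof -
    have "j < 18 + 4 * m" using p(2) M by simp
    \<comment> \<open>The sides next to a corner are split off, since the label jumps to 3
      there.\<close>
    then have "j = 0 \<or> j = 1 \<or> j = 2 \<or> j = 3 \<or> 3 < j \<and> j < 8 + 2 * m \<or> j = 8 + 2 * m \<or> j = 9 + 2 * m \<or> j = 10 + 2 * m \<or> j = 11 + 2 * m \<or> j = 12 + 2 * m \<or> 12 + 2 * m < j \<and> j < 17 + 4 * m \<or> j = 17 + 4 * m" by presburger
    then consider "j = 0" | "j = 1" | "j = 2" | "j = 3" | "3 < j" "j < 8 + 2 * m" | "j = 8 + 2 * m"
      | "j = 9 + 2 * m" | "j = 10 + 2 * m" | "j = 11 + 2 * m" | "j = 12 + 2 * m"
      | "12 + 2 * m < j" "j < 17 + 4 * m" | "j = 17 + 4 * m" by blast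
    then show ?thesis
    proof cases
      case 5
      then have "a = j" "b = j + 1" "f = j" by (auto simp: a_def b_def f_def local_label_def)
      then show ?thesis using 5 by (simp add: M)
    next
      case 11
      then have "a = 21 + 4 * m - j" "b = 20 + 4 * m - j" "f = 20 + 4 * m - j"
        by (auto simp: a_def b_def f_def local_label_def)
      then have "a = b + 1" "4 \<le> b" "f = b" "b \<le> 7 + 2 * m" using 11 by linarith+
      then show ?thesis by (simp add: M)
    qed (simp_all add: a_def b_def f_def local_label_def M)
  qed
  have fs': "first_side m p = k * ?M + f" using fs by (simp add: f_def)
  show "A = 3 \<and> B \<noteq> 3 \<and> B mod ?M \<notin> {5, 6} \<or> B = 3 \<and> A \<noteq> 3 \<and> A mod ?M \<notin> {5, 6}
      \<or> A \<noteq> 3 \<and> B \<noteq> 3 \<and> (A = B + 1 \<or> B = A + 1)"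
    using main unfolding ab by (elim conjE disjE) (simp_all add: n3 n2 md)
  show "side_of_labels m A B = first_side m p"
    using main sn[of a b] unfolding ab fs' by (elim conjE disjE) (simp_all add: sp)
qed

lemma chord_label_not_side:
  assumes "(a, b) \<in> chords 0 (handles m k)"
  shows "{label m (a + 1), label m (b + 1)} \<noteq> {label m p, label m (p + 1)}"
proof -
  obtain A B where 1: "label m (a + 1) = A \<and> label m (b + 1) = B \<or> label m (a + 1) = B \<and> label m (b + 1) = A"
    "A + 2 \<le> B" "A = 3 \<longrightarrow> B mod period m \<in> {5, 6}" "B \<noteq> 3" by (rule chord_labels[OF assms])
  have "{A, B} \<noteq> {label m p, label m (p + 1)}"
    using 1(2-4) side_labels(1)[of m p] by (auto simp: doubleton_eq_iff)
  moreover have "{label m (a + 1), label m (b + 1)} = {A, B}" using 1(1) by auto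
  ultimately show ?thesis by simp
qed

lemma first_side_eq_if_labels_eq:
  assumes "{label m p, label m (p + 1)} = {label m r, label m (r + 1)}"
  shows "first_side m p = first_side m r"
  using assms side_labels(2)[of m p] side_labels(2)[of m r] side_of_labels_commute
  by (metis doubleton_eq_iff)

section \<open>The unique satisfying state\<close>

text \<open>The forced solution is the parity of the label: v, a_1 and the b_i with even i have odd
  labels, a_2 and the b_i with odd i have even ones.\<close>

definition spin :: "nat \<Rightarrow> nat \<Rightarrow> int" where
  "spin m p = (if even (label m p) then 1 else - 1)"

text \<open>The number \<open>period m\<close> is even, so the offset of the block does not affect
  parity.\<close>

lemma even_label:
  assumes "x < period m"
  shows "even (label m (j * period m + x)) \<longleftrightarrow> even (local_label m x)"
  unfolding label_add[OF assms] by (simp add: period_def)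

text \<open>The triangles outside the two fans, relative to the start of the handle; their number
  does not depend on m.\<close>

definition handle_core_triangles :: "nat \<Rightarrow> (nat \<times> nat \<times> nat) set" where
  "handle_core_triangles m = {(0, 1, 16 + 4 * m), (1, 15 + 4 * m, 16 + 4 * m), (1, 2, 15 + 4 * m),
      (2, 14 + 4 * m, 15 + 4 * m), (2, 3, 14 + 4 * m), (3, 13 + 4 * m, 14 + 4 * m), (3, 4, 13 + 4 * m),
      (4, 12 + 4 * m, 13 + 4 * m), (4, 5, 12 + 4 * m), (5, 10 + 2 * m, 12 + 4 * m), (5, 9 + 2 * m, 10 + 2 * m)}"

lemma triangles_handle_shift:
  "triangles i (handle m) = (\<lambda>(x, y, z). (i + x, i + y, i + z)) ` handle_core_triangles m \<union>
    (\<lambda>r. (i + (5 + r), i + (6 + r), i + (9 + 2 * m))) ` {..<3 + 2 * m} \<union>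
    (\<lambda>r. (i + (10 + 2 * m), i + (11 + 2 * m + r), i + (12 + 2 * m + r))) ` {..<1 + 2 * m}"
  unfolding triangles_handle handle_core_triangles_def by (simp add: add.assoc)

lemma handle_triangle_parity:
  assumes "(a, b, c) \<in> triangles (j * period m) (handle m)"
  shows "\<not> (spin m (a + 1) = spin m (b + 1) \<and> spin m (b + 1) = spin m (c + 1))"
proof -
  let ?i = "j * period m"
  have s: "spin m (?i + x + 1) = (if even (local_label m (x + 1)) then 1 else - 1)" if "x + 1 < period m" for x
    using even_label[OF that, of j] by (simp add: spin_def add.assoc)
  have M: "period m = 18 + 4 * m" by (simp add: period_def)
  define P where "P x y z \<longleftrightarrow> x + 1 < period m \<and> y + 1 < period m \<and> z + 1 < period m \<and>
    \<not> (even (local_label m (x + 1)) = even (local_label m (y + 1)) \<and> even (local_label m (y + 1)) = even (local_label m (z + 1)))" for x y z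
  note defs = P_def M local_label_def
  have P0: "P x y z" if "(x, y, z) \<in> handle_core_triangles m" for x y z
    using that unfolding handle_core_triangles_def by (elim insertE emptyE) (simp_all add: defs)
  \<comment> \<open>The last triangle of the fan meets the corner, whose label 3 has the same parity
    as \<open>9 + 2 * m\<close>, the value that would continue the sequence.\<close>
  have P1: "P (5 + r) (6 + r) (9 + 2 * m)" if "r < 3 + 2 * m" for r
    using that by (cases "r = 2 + 2 * m") (simp_all add: defs)
  have P2: "P (10 + 2 * m) (11 + 2 * m + r) (12 + 2 * m + r)" if "r < 1 + 2 * m" for r
  proof (cases "r = 0")
    case False
    have "local_label m (11 + 2 * m + r + 1) = 9 + 2 * m - r" "local_label m (12 + 2 * m + r + 1) = 8 + 2 * m - r"
      using that False by (auto simp: local_label_def)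
    moreover have "9 + 2 * m - r = Suc (8 + 2 * m - r)" using that by simp
    ultimately show ?thesis using that by (simp add: P_def M)
  qed (simp add: defs)
  have "\<exists>x y z. (a, b, c) = (?i + x, ?i + y, ?i + z) \<and> P x y z"
    using assms unfolding triangles_handle_shift
  proof (elim UnE imageE)
    fix t assume "t \<in> handle_core_triangles m" "(a, b, c) = (case t of (x, y, z) \<Rightarrow> (?i + x, ?i + y, ?i + z))"
    moreover obtain x y z where "t = (x, y, z)" by (cases t)
    ultimately show ?thesis using P0[of x y z] by auto
  next
    fix r assume "r \<in> {..<3 + 2 * m}" "(a, b, c) = (?i + (5 + r), ?i + (6 + r), ?i + (9 + 2 * m))"
    then show ?thesis using P1[of r] by blast
  next
    fix r assume "r \<in> {..<1 + 2 * m}" "(a, b, c) = (?i + (10 + 2 * m), ?i + (11 + 2 * m + r), ?i + (12 + 2 * m + r))"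
    then show ?thesis using P2[of r] by blast
  qed
  then obtain x y z where xyz: "(a, b, c) = (?i + x, ?i + y, ?i + z)" "P x y z" by blast
  then show ?thesis using s[of x] s[of y] s[of z] by (auto simp: P_def split: if_splits)
qed

text \<open>Each joining triangle, as well as the root triangle, contains an a_1 (odd label) and a
  b_1 (even label).\<close>

lemma handles_triangle_parity:
  assumes "(a, b, c) \<in> insert (0, (k + 1) * period m - 2, (k + 1) * period m - 1) (triangles 0 (handles m k))"
  shows "\<not> (spin m (a + 1) = spin m (b + 1) \<and> spin m (b + 1) = spin m (c + 1))"
proof -
  let ?M = "period m"
  have M: "?M = 18 + 4 * m" by (simp add: period_def)
  have s: "spin m (j * ?M + x) = (if even (local_label m x) then 1 else - 1)" if "x < ?M" for j x
    using even_label[OF that, of j] by (simp add: spin_def)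
  have sj: "spin m (j * ?M) = - 1" "spin m (j * ?M + 1) = - 1" "spin m (j * ?M + (17 + 4 * m)) = 1" for j
    using s[of 0 j] s[of 1 j] s[of "17 + 4 * m" j] by (simp_all add: M local_label_def)
  have sm: "spin m (j * ?M - 1) = 1" "j * ?M - 2 + 1 = j * ?M - 1" "j * ?M - 1 + 1 = j * ?M" if pos: "0 < j" for j
  proof -
    obtain i where "j = Suc i" using pos gr0_implies_Suc by blast
    then have "j * ?M - 1 = i * ?M + (17 + 4 * m)" using M by simp
    then show "spin m (j * ?M - 1) = 1" by (simp only: sj)
    show "j * ?M - 2 + 1 = j * ?M - 1" "j * ?M - 1 + 1 = j * ?M"
      using \<open>j = Suc i\<close> M by auto
  qed
  have s1: "spin m 1 = - 1" using sj(2)[of 0] by simp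
  consider "(a, b, c) = (0, (k + 1) * ?M - 2, (k + 1) * ?M - 1)" | "(a, b, c) \<in> triangles 0 (handles m k)"
    using assms by blast
  then show ?thesis
  proof cases
    case 1
    then show ?thesis using sm[of "k + 1"] sj(1)[of "k + 1"] s1 by auto
  next
    case 2
    then show ?thesis
    proof (cases rule: triangles_handles)
      case (1 j)
      then show ?thesis using handle_triangle_parity by blast
    next
      case (2 j)
      have "j * ?M + 16 + 4 * m + 1 = j * ?M + (17 + 4 * m)" by simp
      then have "spin m (j * ?M + 16 + 4 * m + 1) = 1" using sj(3)[of j] by presburger
      then show ?thesis using 2 sm[OF 2(1)] sj[of j] s1 by auto
    qed
  qed
qed

text \<open>If \<open>a1 = a2\<close>, then b1 and b3 are opposite to it, v and b4 agree with it, b2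
  is opposite, so b5 agrees with it and b4, b5, a2 is monochromatic. If
  \<open>a1 \<noteq> a2\<close>, the last hypothesis supplies the parity relation. The proof
  enumerates the 2^8 choices of spins.\<close>

lemma handle_core_unique:
  fixes v a1 a2 b1 b2 b3 b4 b5 :: int
  assumes "v \<in> {1, -1}" "a1 \<in> {1, -1}" "a2 \<in> {1, -1}" "b1 \<in> {1, -1}" "b2 \<in> {1, -1}" "b3 \<in> {1, -1}"
    "b4 \<in> {1, -1}" "b5 \<in> {1, -1}"
    and "\<not> (a1 = a2 \<and> a2 = b1)" "\<not> (a2 = b2 \<and> b2 = b1)" "\<not> (a2 = v \<and> v = b2)" "\<not> (v = b3 \<and> b3 = b2)"
    "\<not> (v = b1 \<and> b1 = b3)" "\<not> (b1 = b4 \<and> b4 = b3)" "\<not> (b1 = b2 \<and> b2 = b4)" "\<not> (b2 = b5 \<and> b5 = b4)"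
    "\<not> (b2 = b3 \<and> b3 = b5)" "\<not> (b3 = a1 \<and> a1 = b5)" "\<not> (b3 = a2 \<and> a2 = a1)"
    "\<not> (b3 = b4 \<and> b4 = a2)" "\<not> (b4 = b5 \<and> b5 = a2)" "a1 \<noteq> a2 \<longrightarrow> b5 = - v"
  shows "a1 = v \<and> a2 = - v \<and> b1 = - v \<and> b2 = v \<and> b3 = - v \<and> b4 = v \<and> b5 = - v"
  using assms(1-8) assms(9-) by (elim insertE emptyE; hypsubst; simp)

text \<open>The function f lives on tree positions, so \<open>f 2\<close> is the spin of v at
  position 3 of the first block; the minus sign appears because the label 3 has spin -1. Each handle
  is solved separately, and all of them share this value.\<close>

lemma handle_unique:
  fixes f :: "nat \<Rightarrow> int"
  assumes pm: "\<And>p. p < (k + 1) * period m \<Longrightarrow> f p \<in> {1, -1}"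
    and wd: "\<And>p r. p < (k + 1) * period m \<Longrightarrow> r < (k + 1) * period m \<Longrightarrow> label m (p + 1) = label m (r + 1) \<Longrightarrow> f p = f r"
    and sat: "\<And>a b c. (a, b, c) \<in> triangles 0 (handles m k) \<Longrightarrow> \<not> (f a = f b \<and> f b = f c)"
    and p: "p < (k + 1) * period m"
  shows "f p = - f 2 * spin m (p + 1)"
proof -
  let ?M = "period m"
  have M: "?M = 18 + 4 * m" by (simp add: period_def)
  define j x where "j = p div ?M" and "x = p mod ?M"
  have jx: "p = j * ?M + x" "x < ?M" by (simp_all add: j_def x_def)
  have j: "j \<le> k" using less_mult_imp_div_less[OF p] by (simp add: j_def)
  have lt: "j * ?M + y < (k + 1) * ?M" if "y < ?M" for y
  proof -
    have "(k + 1) * ?M = k * ?M + ?M" by simp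
    then show ?thesis using mult_le_mono1[OF j, of ?M] that by linarith
  qed
  \<comment> \<open>The value at local position c of handle j; the subtraction passes to tree
    positions.\<close>
  define F where "F c = f (j * ?M + c - 1)" for c
  have lab3: "f r = f 2" if "r < (k + 1) * ?M" "label m (r + 1) = 3" for r
  proof (rule wd[OF that(1)])
    show "2 < (k + 1) * ?M" by (simp add: M)
    have "label m (0 * ?M + 3) = 3" by (subst label_add) (simp_all add: M local_label_def)
    then show "label m (r + 1) = label m (2 + 1)" using that(2) by (simp add: numeral_3_eq_3)
  qed
  have fF: "f (j * ?M + y) = F (local_label m (y + 1))" if "y + 1 < ?M" for y
  proof -
    let ?c = "local_label m (y + 1)"
    have c: "0 < ?c" "?c \<le> 8 + 2 * m" "local_label m ?c = ?c" using that by (auto simp: local_label_def M)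
    have "?c < ?M" using c M by simp
    then have "label m (j * ?M + y + 1) = label m (j * ?M + ?c - 1 + 1)"
      using label_add[OF that, of j] label_add[of ?c m j] c by (simp add: add.assoc)
    moreover have "j * ?M + ?c - 1 = j * ?M + (?c - 1)" using c by simp
    ultimately show ?thesis unfolding F_def using lt[of y] lt[of "?c - 1"] that \<open>?c < ?M\<close> by (intro wd) auto
  qed
  have Fpm: "F c \<in> {1, -1}" if "0 < c" "c < ?M" for c
    unfolding F_def using pm lt[of "c - 1"] that by (simp add: add.commute)
  have F3: "F 3 = f 2"
  proof -
    have "F 3 = f (j * ?M + 2)" by (simp add: F_def)
    moreover have "label m (j * ?M + 3) = 3" by (subst label_add) (simp_all add: M local_label_def)
    then have "label m (j * ?M + 2 + 1) = 3" by (simp add: numeral_3_eq_3)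
    ultimately show ?thesis using lab3 lt[of 2] by (simp add: M)
  qed
  have tri: "\<not> (F (local_label m (u + 1)) = F (local_label m (v + 1)) \<and> F (local_label m (v + 1)) = F (local_label m (w + 1)))"
    if "(j * ?M + u, j * ?M + v, j * ?M + w) \<in> triangles (j * ?M) (handle m)" "u + 1 < ?M" "v + 1 < ?M" "w + 1 < ?M" for u v w
    using sat[of "j * ?M + u" "j * ?M + v" "j * ?M + w"] that triangles_handle_in_handles[OF j, of m] fF by auto
  note ll = local_label_def
  \<comment> \<open>The path b_3, ..., b_(5+2m) is prolonged to the corner at local position
    \<open>9 + 2 * m\<close>, whose label is 3.\<close>
  define G where "G i = (if i = 9 + 2 * m then F 3 else F i)" for i
  have fan1: "\<not> (G i = G (i + 1) \<and> G (i + 1) = F 2)" if "6 \<le> i" "i \<le> 8 + 2 * m" for i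
  proof -
    have l: "local_label m (5 + (i - 6) + 1) = i" "local_label m (9 + 2 * m + 1) = 2"
      "local_label m (6 + (i - 6) + 1) = (if i = 8 + 2 * m then 3 else i + 1)"
      using that by (auto simp: ll)
    have "(j * ?M + (5 + (i - 6)), j * ?M + (6 + (i - 6)), j * ?M + (9 + 2 * m)) \<in> triangles (j * ?M) (handle m)"
    proof -
      have "i - 6 \<in> {..<3 + 2 * m}" using that by auto
      then show ?thesis unfolding triangles_handle_shift by blast
    qed
    then show ?thesis
      using tri[of "5 + (i - 6)" "6 + (i - 6)" "9 + 2 * m"] that unfolding l by (auto simp: M G_def)
  qed
  have fan2: "\<not> (F 1 = G (i + 1) \<and> G (i + 1) = G i)" if "8 \<le> i" "i \<le> 8 + 2 * m" for i
  proof -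
    define r where "r = 8 + 2 * m - i"
    have r: "i = 8 + 2 * m - r" "r \<le> 2 * m" using that by (auto simp: r_def)
    have l: "local_label m (10 + 2 * m + 1) = 1" "local_label m (12 + 2 * m + r + 1) = i"
      "local_label m (11 + 2 * m + r + 1) = (if i = 8 + 2 * m then 3 else i + 1)"
      using r by (auto simp: ll)
    have "(j * ?M + (10 + 2 * m), j * ?M + (11 + 2 * m + r), j * ?M + (12 + 2 * m + r)) \<in> triangles (j * ?M) (handle m)"
    proof -
      have "r \<in> {..<1 + 2 * m}" using r by auto
      then show ?thesis unfolding triangles_handle_shift by blast
    qed
    then show ?thesis
      using tri[of "10 + 2 * m" "11 + 2 * m + r" "12 + 2 * m + r"] r unfolding l by (auto simp: M G_def)
  qed
  have Gpm: "G i \<in> {1, -1}" if "6 \<le> i" "i \<le> 9 + 2 * m" for i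
    using Fpm[of i] Fpm[of 3] that by (simp add: G_def M)
  \<comment> \<open>Equal neighbours on the path would agree with a_1 or with a_2 when these differ,
    and one of the two fans would contain a monochromatic triangle.\<close>
  have alt: "G (8 + d) = (if even d then G 8 else - G 8)" if "F 1 \<noteq> F 2" "d \<le> 1 + 2 * m" for d
    using that(2)
  proof (induction d)
    case (Suc d)
    have "G (8 + d) \<noteq> G (8 + d + 1)"
      using fan1[of "8 + d"] fan2[of "8 + d"] Suc.prems that(1) Fpm[of 1] Fpm[of 2] Gpm[of "8 + d"] by (auto simp: M)
    then have "G (8 + Suc d) = - G (8 + d)"
      using Gpm[of "8 + d"] Gpm[of "8 + d + 1"] Suc.prems by auto
    then show ?case using Suc by simp
  qed simp
  have G8: "G 8 = F 8" "G 6 = F 6" "G 7 = F 7" by (simp_all add: G_def)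
  \<comment> \<open>From b_5 to v there are \<open>1 + 2 * m\<close> steps, an odd number.\<close>
  have last: "F 8 = - F 3" if "F 1 \<noteq> F 2"
    using alt[OF that, of "1 + 2 * m"] G8 by (simp add: G_def)
  have core: "F 1 = F 3 \<and> F 2 = - F 3 \<and> F 4 = - F 3 \<and> F 5 = F 3 \<and> F 6 = - F 3 \<and> F 7 = F 3 \<and> F 8 = - F 3"
  proof (rule handle_core_unique)
    have T: "\<not> (F (local_label m (u + 1)) = F (local_label m (v + 1)) \<and> F (local_label m (v + 1)) = F (local_label m (w + 1)))"
      if "(u, v, w) \<in> handle_core_triangles m" for u v w
    proof (rule tri)
      show "(j * ?M + u, j * ?M + v, j * ?M + w) \<in> triangles (j * ?M) (handle m)"
        unfolding triangles_handle_shift using imageI[OF that, of "\<lambda>(x, y, z). (j * ?M + x, j * ?M + y, j * ?M + z)"] by simp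
      show "u + 1 < ?M" "v + 1 < ?M" "w + 1 < ?M" using that by (auto simp: handle_core_triangles_def M)
    qed
    have L: "local_label m (0 + 1) = 1" "local_label m (1 + 1) = 2" "local_label m (2 + 1) = 3" "local_label m (3 + 1) = 4"
      "local_label m (4 + 1) = 5" "local_label m (5 + 1) = 6" "local_label m (9 + 2 * m + 1) = 2" "local_label m (10 + 2 * m + 1) = 1"
      "local_label m (12 + 4 * m + 1) = 8" "local_label m (13 + 4 * m + 1) = 7" "local_label m (14 + 4 * m + 1) = 6" "local_label m (15 + 4 * m + 1) = 5"
      "local_label m (16 + 4 * m + 1) = 4"
      by (simp_all add: local_label_def)
    show "\<not> (F 1 = F 2 \<and> F 2 = F 4)" using T[of 0 1 "16 + 4 * m", unfolded L] by (simp add: handle_core_triangles_def)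
    show "\<not> (F 2 = F 5 \<and> F 5 = F 4)" using T[of 1 "15 + 4 * m" "16 + 4 * m", unfolded L] by (simp add: handle_core_triangles_def)
    show "\<not> (F 2 = F 3 \<and> F 3 = F 5)" using T[of 1 2 "15 + 4 * m", unfolded L] by (simp add: handle_core_triangles_def)
    show "\<not> (F 3 = F 6 \<and> F 6 = F 5)" using T[of 2 "14 + 4 * m" "15 + 4 * m", unfolded L] by (simp add: handle_core_triangles_def)
    show "\<not> (F 3 = F 4 \<and> F 4 = F 6)" using T[of 2 3 "14 + 4 * m", unfolded L] by (simp add: handle_core_triangles_def)
    show "\<not> (F 4 = F 7 \<and> F 7 = F 6)" using T[of 3 "13 + 4 * m" "14 + 4 * m", unfolded L] by (simp add: handle_core_triangles_def)
    show "\<not> (F 4 = F 5 \<and> F 5 = F 7)" using T[of 3 4 "13 + 4 * m", unfolded L] by (simp add: handle_core_triangles_def)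
    show "\<not> (F 5 = F 8 \<and> F 8 = F 7)" using T[of 4 "12 + 4 * m" "13 + 4 * m", unfolded L] by (simp add: handle_core_triangles_def)
    show "\<not> (F 5 = F 6 \<and> F 6 = F 8)" using T[of 4 5 "12 + 4 * m", unfolded L] by (simp add: handle_core_triangles_def)
    show "\<not> (F 6 = F 1 \<and> F 1 = F 8)" using T[of 5 "10 + 2 * m" "12 + 4 * m", unfolded L] by (simp add: handle_core_triangles_def)
    show "\<not> (F 6 = F 2 \<and> F 2 = F 1)" using T[of 5 "9 + 2 * m" "10 + 2 * m", unfolded L] by (simp add: handle_core_triangles_def)
    show "\<not> (F 6 = F 7 \<and> F 7 = F 2)" using fan1[of 6] by (simp add: G_def)
    show "\<not> (F 7 = F 8 \<and> F 8 = F 2)" using fan1[of 7] by (simp add: G_def)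
    show "F 1 \<noteq> F 2 \<longrightarrow> F 8 = - F 3" using last by blast
  qed (rule Fpm; simp add: M)+
  have Fval: "F c = - F 3 * (if even c then 1 else - 1)" if "0 < c" "c \<le> 8 + 2 * m" for c
  proof (cases "c \<le> 8")
    case True
    then have "c = 1 \<or> c = 2 \<or> c = 3 \<or> c = 4 \<or> c = 5 \<or> c = 6 \<or> c = 7 \<or> c = 8" using that by presburger
    then show ?thesis using core by (elim disjE) simp_all
  next
    case False
    then have "G (8 + (c - 8)) = (if even (c - 8) then G 8 else - G 8)"
      using alt[of "c - 8"] core Fpm[of 3] that by (auto simp: M)
    moreover have "even (c - 8) \<longleftrightarrow> even c" using False by simp
    ultimately show ?thesis using False core G8 that by (simp add: G_def)
  qed
  show ?thesis
  proof (cases "x + 1 < ?M")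
    case True
    have "f p = F (local_label m (x + 1))" using fF[OF True] jx by simp
    also have "\<dots> = - F 3 * (if even (local_label m (x + 1)) then 1 else - 1)"
      using True by (intro Fval) (auto simp: ll M)
    also have "(if even (local_label m (x + 1)) then 1 else - 1) = spin m (p + 1)"
      using even_label[OF True, of j] by (simp add: spin_def jx(1) add.assoc)
    finally show ?thesis by (simp add: F3)
  next
    case False
    \<comment> \<open>The last tree position of a block is the corner at which the next block
      starts.\<close>
    then have "p + 1 = (j + 1) * ?M + 0" using jx by simp
    then have "label m (p + 1) = 3" using label_add[of 0 m "j + 1"] by (simp add: ll)
    then show ?thesis using lab3[OF p] by (simp add: spin_def)
  qed
qed

section \<open>The boundary of the glued polygon\<close>

text \<open>The two-to-one folding of the boundary of the polygon onto the sides $a_k$ and $b_k$: it is constant exactly on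
  the classes of the gluing.\<close>

definition fold_param :: "real \<Rightarrow> real" where
  "fold_param u = (if u \<in> \<int> then 0 else
     let k = of_int \<lfloor>u / 4\<rfloor> in if u < 4 * k + 2 then u else if u < 4 * k + 3 then 8 * k + 3 - u else 8 * k + 5 - u)"

lemma not_Ints_between:
  fixes u :: real
  assumes "of_int n < u" "u < of_int n + 1"
  shows "u \<notin> \<int>"
proof
  assume "u \<in> \<int>"
  then obtain i where "u = of_int i" by (auto elim: Ints_cases)
  then have "n < i" "i < n + 1" using assms by linarith+
  then show False by linarith
qed

lemma floor_quarter:
  fixes u :: real
  assumes "4 * real k \<le> u" "u < 4 * real k + 4"
  shows "\<lfloor>u / 4\<rfloor> = int k"
  using assms by (intro floor_unique) (auto simp: field_simps)

lemma fold_param_a: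
  assumes "4 * real k < u" "u < 4 * real k + 1"
  shows "fold_param u = u"
  using assms floor_quarter[of k u] not_Ints_between[of "4 * int k" u] by (simp add: fold_param_def Let_def)

lemma fold_param_b:
  assumes "4 * real k + 1 < u" "u < 4 * real k + 2"
  shows "fold_param u = u"
  using assms floor_quarter[of k u] not_Ints_between[of "4 * int k + 1" u] by (simp add: fold_param_def Let_def)

lemma fold_param_a_inv:
  assumes "4 * real k + 2 < u" "u < 4 * real k + 3"
  shows "fold_param u = 8 * real k + 3 - u"
  using assms floor_quarter[of k u] not_Ints_between[of "4 * int k + 2" u] by (simp add: fold_param_def Let_def)

lemma fold_param_b_inv:
  assumes "4 * real k + 3 < u" "u < 4 * real k + 4"
  shows "fold_param u = 8 * real k + 5 - u"
  using assms floor_quarter[of k u] not_Ints_between[of "4 * int k + 3" u] by (simp add: fold_param_def Let_def)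

lemma fold_param_nat: "fold_param (real n) = 0"
  by (simp add: fold_param_def)

lemma fold_param_pairing_a:
  assumes "0 \<le> s" "s \<le> 1"
  shows "fold_param (real (4 * k) + s) = fold_param (real (4 * k) + 3 - s)"
proof -
  consider "s = 0" | "s = 1" | "0 < s" "s < 1" using assms by linarith
  then show ?thesis
  proof cases
    case 1
    then show ?thesis using fold_param_nat[of "4 * k"] fold_param_nat[of "4 * k + 3"] by simp
  next
    case 2
    then show ?thesis using fold_param_nat[of "4 * k + 1"] fold_param_nat[of "4 * k + 2"] by (simp add: add.commute)
  next
    case 3
    then show ?thesis by (simp add: fold_param_a[of k] fold_param_a_inv[of k])
  qed
qed

lemma fold_param_pairing_b:
  assumes "0 \<le> s" "s \<le> 1"
  shows "fold_param (real (4 * k) + 1 + s) = fold_param (real (4 * k) + 4 - s)"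
proof -
  consider "s = 0" | "s = 1" | "0 < s" "s < 1" using assms by linarith
  then show ?thesis
  proof cases
    case 1
    then show ?thesis using fold_param_nat[of "4 * k + 1"] fold_param_nat[of "4 * k + 4"] by (simp add: add.commute)
  next
    case 2
    then show ?thesis using fold_param_nat[of "4 * k + 2"] fold_param_nat[of "4 * k + 3"] by (simp add: add.commute)
  next
    case 3
    then show ?thesis by (simp add: fold_param_b[of k] fold_param_b_inv[of k])
  qed
qed

section \<open>The fold as a complete invariant of the gluing\<close>

lemma norm_polygon_boundary [simp]: "norm (polygon_boundary g t) = 1"
  by (simp add: polygon_boundary_def)

lemma polygon_boundary_period:
  assumes "g > 0"
  shows "polygon_boundary g (t + 4 * real g) = polygon_boundary g t"
proof -
  have "2 * pi * (t + 4 * real g) / real (4 * g) = 2 * pi * t / real (4 * g) + 2 * pi"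
    using assms by (simp add: field_simps)
  then show ?thesis by (simp add: polygon_boundary_def complex_eq_iff)
qed

text \<open>The gluing relates points rather than parameters, so an invariant of the generated
  relation has to be a function of the point.\<close>

definition boundary_class :: "nat \<Rightarrow> complex \<Rightarrow> real" where
  "boundary_class g z = fold_param (4 * real g * Arg2pi z / (2 * pi))"

text \<open>The parameters 0 and \<open>4 * g\<close> give the same point; as integers, both fold to
  0.\<close>

lemma boundary_class_polygon_boundary:
  assumes "g > 0" "0 \<le> u" "u \<le> 4 * real g"
  shows "boundary_class g (polygon_boundary g u) = fold_param u"
proof (cases "u = 4 * real g")
  case True
  then have "polygon_boundary g u = 1" using assms(1) by (simp add: polygon_boundary_def complex_eq_iff)
  moreover have "Arg2pi 1 = 0" using Arg2pi_of_real[of 1] by simp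
  ultimately have "boundary_class g (polygon_boundary g u) = fold_param (real 0)"
    by (simp add: boundary_class_def)
  then show ?thesis using True fold_param_nat[of "4 * g"] fold_param_nat[of 0] by simp
next
  case False
  then have "u / (4 * real g) < 1" using assms by simp
  then have "2 * pi * (u / (4 * real g)) < 2 * pi * 1" by (intro mult_strict_left_mono) auto
  moreover have eq: "2 * pi * u / real (4 * g) = 2 * pi * (u / (4 * real g))" by simp
  ultimately have "Arg2pi (polygon_boundary g u) = 2 * pi * u / real (4 * g)"
    using assms by (intro Arg2pi_unique[of 1]) (auto simp: polygon_boundary_def cis_conv_exp)
  then show ?thesis using assms by (simp add: boundary_class_def field_simps)
qed

lemma side_pairing_class:
  assumes "(x, y) \<in> side_pairing g" "g > 0"
  shows "boundary_class g x = boundary_class g y"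
proof -
  consider k s where "k < g" "0 \<le> s" "s \<le> 1" "x = polygon_boundary g (real (4 * k) + s)" "y = polygon_boundary g (real (4 * k) + 3 - s)"
    | k s where "k < g" "0 \<le> s" "s \<le> 1" "x = polygon_boundary g (real (4 * k) + 1 + s)" "y = polygon_boundary g (real (4 * k) + 4 - s)"
    using assms(1) unfolding side_pairing_def by auto
  then show ?thesis
  proof cases
    case 1
    have "real k + 1 \<le> real g" using 1(1) by simp
    then show ?thesis
      using 1 fold_param_pairing_a[OF 1(2,3), of k] boundary_class_polygon_boundary[OF assms(2)] by simp
  next
    case 2
    have "real k + 1 \<le> real g" using 2(1) by simp
    then show ?thesis
      using 2 fold_param_pairing_b[OF 2(2,3), of k] boundary_class_polygon_boundary[OF assms(2)] by simp
  qed
qed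

lemma side_pairing_norm: "(x, y) \<in> side_pairing g \<Longrightarrow> norm x = 1 \<and> norm y = 1"
  unfolding side_pairing_def by auto

locale glued_polygon =
  fixes g :: nat and q :: "complex \<Rightarrow> 'a"
  assumes g_pos: "g > 0"
    and q_eq_iff: "\<And>x y. x \<in> cball 0 1 \<Longrightarrow> y \<in> cball 0 1 \<Longrightarrow>
      q x = q y \<longleftrightarrow> (x, y) \<in> (side_pairing g \<union> (side_pairing g)\<inverse>)\<^sup>*"
begin

definition bpoint :: "real \<Rightarrow> 'a" where "bpoint u = q (polygon_boundary g u)"

text \<open>A non-trivial chain of the generated relation can only start on the circle.\<close>

lemma q_inj_ball:
  assumes "x \<in> ball 0 1" "y \<in> cball 0 1" "q x = q y"
  shows "x = y"
proof -
  have "(x, y) \<in> (side_pairing g \<union> (side_pairing g)\<inverse>)\<^sup>*" using q_eq_iff[of x y] assms by auto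
  then show ?thesis
  proof (cases rule: converse_rtranclE)
    case (step z)
    then have "norm x = 1" using side_pairing_norm[of x z] side_pairing_norm[of z x] by auto
    then show ?thesis using assms(1) by simp
  qed
qed

text \<open>Each step of a chain preserves \<open>boundary_class\<close>, hence so does the
  generated equivalence.\<close>

lemma fold_eq_if_bpoint_eq:
  assumes "bpoint u = bpoint w" "0 \<le> u" "u \<le> 4 * real g" "0 \<le> w" "w \<le> 4 * real g"
  shows "fold_param u = fold_param w"
proof -
  have "(polygon_boundary g u, polygon_boundary g w) \<in> (side_pairing g \<union> (side_pairing g)\<inverse>)\<^sup>*"
    using assms(1) q_eq_iff by (simp add: bpoint_def)
  then have "boundary_class g (polygon_boundary g u) = boundary_class g (polygon_boundary g w)"
  proof (induction rule: rtrancl_induct)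
    case (step y z)
    then show ?case using side_pairing_class[OF _ g_pos] by auto
  qed simp
  then show ?thesis using boundary_class_polygon_boundary[OF g_pos] assms by simp
qed

lemma bpoint_pairing:
  assumes "(polygon_boundary g u, polygon_boundary g w) \<in> side_pairing g"
  shows "bpoint u = bpoint w"
  unfolding bpoint_def using assms by (subst q_eq_iff) auto

lemma bpoint_a:
  assumes "k < g" "4 * real k \<le> u" "u \<le> 4 * real k + 1"
  shows "bpoint u = bpoint (8 * real k + 3 - u)"
proof (rule bpoint_pairing)
  define s where "s = u - 4 * real k"
  have "(polygon_boundary g (real (4 * k) + s), polygon_boundary g (real (4 * k) + 3 - s)) \<in> side_pairing g"
    unfolding side_pairing_def using assms by (intro UnI1 CollectI exI[of _ k] exI[of _ s]) (auto simp: s_def)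
  moreover have "real (4 * k) + s = u" "real (4 * k) + 3 - s = 8 * real k + 3 - u" by (simp_all add: s_def)
  ultimately show "(polygon_boundary g u, polygon_boundary g (8 * real k + 3 - u)) \<in> side_pairing g"
    by (simp only:)
qed

lemma bpoint_b:
  assumes "k < g" "4 * real k + 1 \<le> u" "u \<le> 4 * real k + 2"
  shows "bpoint u = bpoint (8 * real k + 5 - u)"
proof (rule bpoint_pairing)
  define s where "s = u - 4 * real k - 1"
  have "(polygon_boundary g (real (4 * k) + 1 + s), polygon_boundary g (real (4 * k) + 4 - s)) \<in> side_pairing g"
    unfolding side_pairing_def using assms by (intro UnI2 CollectI exI[of _ k] exI[of _ s]) (auto simp: s_def)
  moreover have "real (4 * k) + 1 + s = u" "real (4 * k) + 4 - s = 8 * real k + 5 - u" by (simp_all add: s_def)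
  ultimately show "(polygon_boundary g u, polygon_boundary g (8 * real k + 5 - u)) \<in> side_pairing g"
    by (simp only:)
qed

text \<open>Side a glues 4k to 4k+3 and 4k+1 to 4k+2; side b glues 4k+1 to 4k+4 and 4k+2 to 4k+3.
  These pairs connect all five corners.\<close>

lemma bpoint_corners:
  assumes "k < g"
  shows "bpoint (4 * real k + 1) = bpoint (4 * real k)" "bpoint (4 * real k + 2) = bpoint (4 * real k)"
    "bpoint (4 * real k + 3) = bpoint (4 * real k)" "bpoint (4 * real k + 4) = bpoint (4 * real k)"
  using bpoint_a[OF assms, of "4 * real k"] bpoint_a[OF assms, of "4 * real k + 1"]
    bpoint_b[OF assms, of "4 * real k + 1"] bpoint_b[OF assms, of "4 * real k + 2"]
  by (simp_all add: algebra_simps)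

lemma bpoint_nat:
  assumes "n \<le> 4 * g"
  shows "bpoint (real n) = bpoint 0"
proof -
  have *: "bpoint (4 * real k) = bpoint 0" if "k \<le> g" for k
    using that
  proof (induction k)
    case (Suc k)
    have "4 * real (Suc k) = 4 * real k + 4" by simp
    then show ?case using Suc bpoint_corners(4)[of k] by (simp only:)
  qed simp
  show ?thesis
  proof (cases "n = 4 * g")
    case True
    then show ?thesis using *[of g] by simp
  next
    case False
    then have k: "n div 4 < g" using assms by linarith
    have "n mod 4 = 0 \<or> n mod 4 = 1 \<or> n mod 4 = 2 \<or> n mod 4 = 3" by presburger
    moreover have "real n = 4 * real (n div 4) + real (n mod 4)"
      by (metis mult_div_mod_eq of_nat_add of_nat_mult of_nat_numeral)
    ultimately show ?thesis using bpoint_corners[OF k] *[of "n div 4"] k by (elim disjE) simp_all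
  qed
qed

text \<open>This is the converse of the invariance: a non-corner is fixed by the fold or glued to
  its image in one step, and a corner is glued to the corner 0.\<close>

lemma bpoint_fold:
  assumes "0 \<le> u" "u \<le> 4 * real g"
  shows "bpoint u = bpoint (fold_param u)"
proof (cases "u \<in> \<int>")
  case True
  then obtain i where i: "u = of_int i" by (auto elim: Ints_cases)
  then have "u = real (nat i)" "nat i \<le> 4 * g" using assms by linarith+
  then show ?thesis using bpoint_nat[of "nat i"] True by (simp add: fold_param_def)
next
  case False
  define k where "k = nat \<lfloor>u / 4\<rfloor>"
  have "\<lfloor>u / 4\<rfloor> \<ge> 0" using assms by simp
  then have fl: "of_int \<lfloor>u / 4\<rfloor> = real k" by (simp add: k_def)
  then have k1: "4 * real k \<le> u" "u < 4 * real k + 4" by linarith+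
  have "u \<noteq> real (4 * g)" using False by auto
  then have "4 * real k < 4 * real g" using assms k1 by auto
  then have k: "k < g" by simp
  have "u \<noteq> real (4 * k + 2)" "u \<noteq> real (4 * k + 3)" using False Ints_of_nat by metis+
  then have ne: "u \<noteq> 4 * real k + 2" "u \<noteq> 4 * real k + 3" by simp_all
  consider "u < 4 * real k + 2" | "4 * real k + 2 < u" "u < 4 * real k + 3" | "4 * real k + 3 < u" using ne by linarith
  then show ?thesis
  proof cases
    case 1
    then show ?thesis using False fl by (simp add: fold_param_def)
  next
    case 2
    then show ?thesis using fold_param_a_inv[OF 2] bpoint_a[OF k, of "8 * real k + 3 - u"] by simp
  next
    case 3
    then show ?thesis using fold_param_b_inv[OF 3 k1(2)] bpoint_b[OF k, of "8 * real k + 5 - u"] k1 by simp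
  qed
qed

lemma bpoint_eq_iff:
  assumes "0 \<le> u" "u \<le> 4 * real g" "0 \<le> w" "w \<le> 4 * real g"
  shows "bpoint u = bpoint w \<longleftrightarrow> fold_param u = fold_param w"
proof
  assume "fold_param u = fold_param w"
  then show "bpoint u = bpoint w" using bpoint_fold[OF assms(1,2)] bpoint_fold[OF assms(3,4)] by simp
qed (rule fold_eq_if_bpoint_eq[OF _ assms])

end

section \<open>Subdivision of the polygon sides\<close>

text \<open>A copy of a is cut into 3 equal pieces and a copy of b into \<open>6 + 2 * m\<close>, so
  that the reflections of the side pairing respect the subdivision.\<close>

definition tau_local :: "nat \<Rightarrow> nat \<Rightarrow> real" where
  "tau_local m j =
     (if j \<le> 3 then real j / 3 else if j \<le> 9 + 2 * m then 1 + (real j - 3) / (6 + 2 * real m)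
      else if j \<le> 12 + 2 * m then 2 + (real j - 9 - 2 * real m) / 3
      else 3 + (real j - 12 - 2 * real m) / (6 + 2 * real m))"

definition tau :: "nat \<Rightarrow> nat \<Rightarrow> real" where
  "tau m p = 4 * real (p div period m) + tau_local m (p mod period m)"

lemma tau_local_pieces:
  "j \<le> 3 \<Longrightarrow> tau_local m j = real j / 3"
  "3 \<le> j \<Longrightarrow> j \<le> 9 + 2 * m \<Longrightarrow> tau_local m j = 1 + (real j - 3) / (6 + 2 * real m)"
  "9 + 2 * m \<le> j \<Longrightarrow> j \<le> 12 + 2 * m \<Longrightarrow> tau_local m j = 2 + (real j - 9 - 2 * real m) / 3"
  "12 + 2 * m \<le> j \<Longrightarrow> tau_local m j = 3 + (real j - 12 - 2 * real m) / (6 + 2 * real m)"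
proof -
  have t: "6 + 2 * real m > 0" by simp
  show "j \<le> 3 \<Longrightarrow> tau_local m j = real j / 3" by (simp add: tau_local_def)
  show "3 \<le> j \<Longrightarrow> j \<le> 9 + 2 * m \<Longrightarrow> tau_local m j = 1 + (real j - 3) / (6 + 2 * real m)"
    by (cases "j = 3") (auto simp: tau_local_def)
  show "tau_local m j = 2 + (real j - 9 - 2 * real m) / 3" if "9 + 2 * m \<le> j" "j \<le> 12 + 2 * m"
  proof (cases "j = 9 + 2 * m")
    case True
    then show ?thesis using t by (simp add: tau_local_def field_simps)
  qed (use that in \<open>auto simp: tau_local_def\<close>)
  show "tau_local m j = 3 + (real j - 12 - 2 * real m) / (6 + 2 * real m)" if "12 + 2 * m \<le> j"
  proof (cases "j = 12 + 2 * m")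
    case True
    then show ?thesis using t by (simp add: tau_local_def field_simps)
  qed (use that in \<open>auto simp: tau_local_def\<close>)
qed

lemma tau_add:
  assumes "j \<le> period m"
  shows "tau m (k * period m + j) = 4 * real k + tau_local m j"
proof (cases "j = period m")
  case True
  have "6 + 2 * real m > 0" by simp
  then have "tau_local m (period m) = 4" using tau_local_pieces(4)[of m "period m"] by (simp add: period_def field_simps)
  moreover have "tau_local m 0 = 0" by (simp add: tau_local_def)
  moreover have "k * period m + j = (k + 1) * period m" using True by simp
  then have "tau m (k * period m + j) = 4 * real (k + 1) + tau_local m 0"
    by (simp only: tau_def nonzero_mult_div_cancel_right[OF period_pos(2)] mod_mult_self2_is_0)
  ultimately show ?thesis using True by simp
next
  case False
  then show ?thesis using assms by (simp add: tau_def)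
qed

lemma tau_period: "tau m (p + g * period m) = tau m p + 4 * real g"
  by (simp add: tau_def)

lemma tau_0: "tau m 0 = 0"
  by (simp add: tau_def tau_local_def)

text \<open>On inverse sides the pairing is the reflection in which parameters add up to 8k+3 (for
  a) or 8k+5 (for b); it carries the piece p, reversed, to its earlier copy.\<close>

lemma side_position_aux:
  fixes m p :: nat
  defines "Q \<equiv> first_side m p" and "k \<equiv> real (p div period m)"
  shows "tau m p < tau m (p + 1) \<and>
    (Q = p \<and> 4 * k \<le> tau m p \<and> tau m (p + 1) \<le> 4 * k + 1 \<or>
     Q = p \<and> 4 * k + 1 \<le> tau m p \<and> tau m (p + 1) \<le> 4 * k + 2 \<or>
     Q \<noteq> p \<and> 4 * k + 2 \<le> tau m p \<and> tau m (p + 1) \<le> 4 * k + 3 \<and>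
       tau m Q = 8 * k + 3 - tau m (p + 1) \<and> tau m (Q + 1) = 8 * k + 3 - tau m p \<or>
     Q \<noteq> p \<and> 4 * k + 3 \<le> tau m p \<and> tau m (p + 1) \<le> 4 * k + 4 \<and>
       tau m Q = 8 * k + 5 - tau m (p + 1) \<and> tau m (Q + 1) = 8 * k + 5 - tau m p)"
proof -
  let ?M = "period m"
  define i j where "i = p div ?M" and "j = p mod ?M"
  have M: "?M = 18 + 4 * m" by (simp add: period_def)
  have p: "p = i * ?M + j" "j < ?M" by (simp_all add: i_def j_def)
  have t: "6 + 2 * real m > 0" by simp
  have k: "k = real i" by (simp add: k_def i_def)
  have p1: "p + 1 = i * ?M + (j + 1)" using p(1) by linarith
  have tp: "tau m p = 4 * k + tau_local m j" "tau m (p + 1) = 4 * k + tau_local m (j + 1)"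
    unfolding p1 k by (subst p(1), rule tau_add, use p(2) in simp) (rule tau_add, use p(2) in simp)
  define r where "r = (if j < 9 + 2 * m then j else if j < 12 + 2 * m then 11 + 2 * m - j else 20 + 4 * m - j)"
  have Q: "Q = i * ?M + r" by (simp add: Q_def first_side_def r_def i_def j_def Let_def)
  have r: "r < ?M" using p(2) by (auto simp: r_def M)
  have tq: "tau m Q = 4 * k + tau_local m r" "tau m (Q + 1) = 4 * k + tau_local m (r + 1)"
    unfolding Q add.assoc k by (rule tau_add, use r in simp)+
  have Qp: "Q = p \<longleftrightarrow> r = j" unfolding Q using p(1) by linarith
  consider "j < 3" | "3 \<le> j" "j < 9 + 2 * m" | "9 + 2 * m \<le> j" "j < 12 + 2 * m" | "12 + 2 * m \<le> j" by linarith
  then show ?thesis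
  proof cases
    case 1
    then have e: "tau_local m j = real j / 3" "tau_local m (j + 1) = (real j + 1) / 3" and "r = j"
      using tau_local_pieces(1)[of j m] tau_local_pieces(1)[of "j + 1" m] by (simp_all add: r_def)
    moreover have "real j \<le> 2" using 1 by simp
    ultimately show ?thesis unfolding Qp tp e by (intro conjI disjI1) simp_all
  next
    case 2
    define x y where "x = (real j - 3) / (6 + 2 * real m)" and "y = (real j - 2) / (6 + 2 * real m)"
    have e: "tau_local m j = 1 + x" "tau_local m (j + 1) = 1 + y" and "r = j"
      using tau_local_pieces(2)[of j m] tau_local_pieces(2)[of "j + 1" m] 2 by (simp_all add: r_def x_def y_def)
    moreover have "real j \<ge> 3" "real j \<le> 8 + 2 * real m" using 2 by simp_all
    then have "0 \<le> x" "x < y" "y \<le> 1" using t by (simp_all add: x_def y_def field_simps)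
    ultimately show ?thesis unfolding Qp tp e by (intro conjI disjI2[OF disjI1]) simp_all
  next
    case 3
    define x where "x = (real j - 9 - 2 * real m) / 3"
    have rr: "r = 11 + 2 * m - j" "r \<le> 2" "j \<le> 11 + 2 * m" using 3 by (simp_all add: r_def)
    have "real r = 11 + 2 * real m - real j" using rr by (simp add: of_nat_diff)
    then have e: "tau_local m j = 2 + x" "tau_local m (j + 1) = 2 + (x + 1 / 3)"
      "tau_local m r = 1 - (x + 1 / 3)" "tau_local m (r + 1) = 1 - x"
      using tau_local_pieces(3)[of m j] tau_local_pieces(3)[of m "j + 1"] tau_local_pieces(1)[of r m]
        tau_local_pieces(1)[of "r + 1" m] rr 3 by (simp_all add: x_def field_simps)
    moreover have "real j \<ge> 9 + 2 * real m" "real j \<le> 11 + 2 * real m" using 3 rr by simp_all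
    then have "0 \<le> x" "x + 1 / 3 \<le> 1" by (simp_all add: x_def field_simps)
    moreover have "r \<noteq> j" using 3 rr by simp
    ultimately show ?thesis unfolding Qp tp tq e by (intro conjI disjI2[OF disjI2[OF disjI1]]) simp_all
  next
    case 4
    define x y where "x = (real j - 12 - 2 * real m) / (6 + 2 * real m)" and "y = (real j - 11 - 2 * real m) / (6 + 2 * real m)"
    have rr: "r = 20 + 4 * m - j" "3 \<le> r" "r + 1 \<le> 9 + 2 * m" "j \<le> 17 + 4 * m" using 4 p(2) by (auto simp: r_def M)
    have "real r = 20 + 4 * real m - real j" using rr by (simp add: of_nat_diff)
    then have "tau_local m r = 1 + (17 + 4 * real m - real j) / (6 + 2 * real m)"
      "tau_local m (r + 1) = 1 + (18 + 4 * real m - real j) / (6 + 2 * real m)"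
      using tau_local_pieces(2)[of r m] tau_local_pieces(2)[of "r + 1" m] rr by simp_all
    moreover have "(17 + 4 * real m - real j) / (6 + 2 * real m) = 1 - y" "(18 + 4 * real m - real j) / (6 + 2 * real m) = 1 - x"
      using t by (simp_all add: x_def y_def field_simps)
    ultimately have e: "tau_local m r = 2 - y" "tau_local m (r + 1) = 2 - x" by simp_all
    have e': "tau_local m j = 3 + x" "tau_local m (j + 1) = 3 + y"
      using tau_local_pieces(4)[of m j] tau_local_pieces(4)[of m "j + 1"] 4 by (simp_all add: x_def y_def)
    have "real j \<ge> 12 + 2 * real m" "real j \<le> 17 + 4 * real m" using 4 rr by simp_all
    then have "0 \<le> x" "x < y" "y \<le> 1" using t by (simp_all add: x_def y_def field_simps)
    moreover have "r \<noteq> j" using 4 rr by simp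
    ultimately show ?thesis unfolding Qp tp tq e e' by (intro conjI disjI2[OF disjI2[OF disjI2]]) simp_all
  qed
qed

lemmas side_position = side_position_aux[THEN conjunct1] side_position_aux[THEN conjunct2]

lemma strict_mono_tau: "strict_mono (tau m)"
  using side_position(1) by (simp add: strict_mono_Suc_iff)

text \<open>The affine extension of \<open>fold_param\<close> from the interior of one piece to its
  ends, where \<open>fold_param\<close> itself may jump to 0. On a second copy the constant is that
  of the reflection.\<close>

definition fold_side :: "nat \<Rightarrow> nat \<Rightarrow> real \<Rightarrow> real" where
  "fold_side m p x = (if first_side m p = p then x else tau m p + tau m (first_side m p + 1) - x)"

lemma fold_param_side:
  assumes "tau m p < x" "x < tau m (p + 1)"
  shows "fold_param x = fold_side m p x"
    "tau m (first_side m p) < fold_side m p x" "fold_side m p x < tau m (first_side m p + 1)"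
proof -
  let ?k = "p div period m"
  have "fold_param x = fold_side m p x \<and> tau m (first_side m p) < fold_side m p x \<and> fold_side m p x < tau m (first_side m p + 1)"
    using side_position(2)[of m p]
  proof (elim disjE conjE)
    assume "first_side m p = p" "4 * real ?k \<le> tau m p" "tau m (p + 1) \<le> 4 * real ?k + 1"
    then show ?thesis using assms fold_param_a[of ?k x] by (simp add: fold_side_def)
  next
    assume "first_side m p = p" "4 * real ?k + 1 \<le> tau m p" "tau m (p + 1) \<le> 4 * real ?k + 2"
    then show ?thesis using assms fold_param_b[of ?k x] by (simp add: fold_side_def)
  next
    assume "first_side m p \<noteq> p" "4 * real ?k + 2 \<le> tau m p" "tau m (p + 1) \<le> 4 * real ?k + 3"
      "tau m (first_side m p) = 8 * real ?k + 3 - tau m (p + 1)" "tau m (first_side m p + 1) = 8 * real ?k + 3 - tau m p"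
    then show ?thesis using assms fold_param_a_inv[of ?k x] by (simp add: fold_side_def)
  next
    assume "first_side m p \<noteq> p" "4 * real ?k + 3 \<le> tau m p" "tau m (p + 1) \<le> 4 * real ?k + 4"
      "tau m (first_side m p) = 8 * real ?k + 5 - tau m (p + 1)" "tau m (first_side m p + 1) = 8 * real ?k + 5 - tau m p"
    then show ?thesis using assms fold_param_b_inv[of ?k x] by (simp add: fold_side_def)
  qed
  then show "fold_param x = fold_side m p x" "tau m (first_side m p) < fold_side m p x"
    "fold_side m p x < tau m (first_side m p + 1)" by auto
qed

lemma fold_side_image:
  "fold_side m p ` {tau m p..tau m (p + 1)} = {tau m (first_side m p)..tau m (first_side m p + 1)}"
proof (cases "first_side m p = p")
  case False
  have s: "tau m p + tau m (first_side m p + 1) - tau m (p + 1) = tau m (first_side m p)"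
    using side_position(2)[of m p] False by auto
  have "fold_side m p = (\<lambda>x. (tau m p + tau m (first_side m p + 1)) - x)"
    using False by (auto simp: fold_side_def)
  then show ?thesis using s by (simp add: image_diff_atLeastAtMost)
qed (auto simp: fold_side_def)

text \<open>Corners have integer parameters and fold to 0, and any other subdivision point folds to
  the earlier copy, which its label names. So the labels classify the vertices of the
  quotient.\<close>

lemma fold_param_tau: "fold_param (tau m p) = (if label m p = 3 then 0 else tau m (label m p))"
proof -
  let ?M = "period m"
  define k j where "k = p div ?M" and "j = p mod ?M"
  have M: "?M = 18 + 4 * m" by (simp add: period_def)
  have p: "p = k * ?M + j" "j < ?M" by (simp_all add: k_def j_def)
  have t: "6 + 2 * real m > 0" by simp
  have tp: "tau m p = 4 * real k + tau_local m j" using tau_add[of j m k] p by simp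
  have k3: "k * ?M + x \<noteq> 3" if "x \<noteq> 3" for x using that by (cases k) (auto simp: M)
  have lab: "label m p = (if local_label m j = 3 then 3 else k * ?M + local_label m j)"
    using label_add[OF p(2), of k] p by simp
  have "j = 0 \<or> j = 3 \<or> j = 9 + 2 * m \<or> j = 12 + 2 * m \<or> 0 < j \<and> j < 3 \<or> 3 < j \<and> j < 9 + 2 * m
    \<or> 9 + 2 * m < j \<and> j < 12 + 2 * m \<or> 12 + 2 * m < j" by presburger
  then consider "j \<in> {0, 3, 9 + 2 * m, 12 + 2 * m}" | "0 < j" "j < 3" | "3 < j" "j < 9 + 2 * m"
    | "9 + 2 * m < j" "j < 12 + 2 * m" | "12 + 2 * m < j" by blast
  then show ?thesis
  proof cases
    case 1
    have l: "tau_local m 0 = 0" "tau_local m 3 = 1" "tau_local m (9 + 2 * m) = 2" "tau_local m (12 + 2 * m) = 3"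
      using tau_local_pieces(1)[of 0 m] tau_local_pieces(1)[of 3 m] tau_local_pieces(3)[of m "9 + 2 * m"]
        tau_local_pieces(4)[of m "12 + 2 * m"] by simp_all
    have "tau m p = real (4 * k) \<or> tau m p = real (4 * k + 1) \<or> tau m p = real (4 * k + 2) \<or> tau m p = real (4 * k + 3)"
      using 1 l tp by auto
    then have "fold_param (tau m p) = 0" using fold_param_nat by metis
    moreover have "label m p = 3" using 1 lab by (auto simp: local_label_def)
    ultimately show ?thesis by simp
  next
    case 2
    have "local_label m j = j" using 2 by (simp add: local_label_def)
    then have "label m p = p" "label m p \<noteq> 3" using 2 lab p k3[of j] by auto
    moreover have "tau_local m j = real j / 3" "0 < real j" "real j < 3" using tau_local_pieces(1)[of j m] 2 by simp_all
    ultimately show ?thesis using fold_param_a[of k "tau m p"] tp by simp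
  next
    case 3
    have "local_label m j = j" using 3 by (simp add: local_label_def)
    then have "label m p = p" "label m p \<noteq> 3" using 3 lab p k3[of j] by auto
    moreover have "tau_local m j = 1 + (real j - 3) / (6 + 2 * real m)" using tau_local_pieces(2)[of j m] 3 by simp
    moreover have "(real j - 3) / (6 + 2 * real m) > 0" "(real j - 3) / (6 + 2 * real m) < 1"
      using 3 t by (simp_all add: field_simps)
    ultimately show ?thesis using fold_param_b[of k "tau m p"] tp by simp
  next
    case 4
    have ll: "local_label m j = 12 + 2 * m - j" using 4 by (simp add: local_label_def)
    then have lp: "label m p = k * ?M + (12 + 2 * m - j)" "label m p \<noteq> 3" using 4 lab k3[of "12 + 2 * m - j"] by auto
    have "tau m (label m p) = 4 * real k + tau_local m (12 + 2 * m - j)"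
      unfolding lp(1) using 4 by (intro tau_add) (simp add: M)
    then have tl: "tau m (label m p) = 4 * real k + (12 + 2 * real m - real j) / 3"
      using tau_local_pieces(1)[of "12 + 2 * m - j" m] 4 by (simp add: of_nat_diff)
    have "tau_local m j = 2 + (real j - 9 - 2 * real m) / 3" using tau_local_pieces(3)[of m j] 4 by simp
    moreover have "real j > 9 + 2 * real m" "real j < 12 + 2 * real m" using 4 by simp_all
    ultimately show ?thesis using fold_param_a_inv[of k "tau m p"] tp tl lp(2) by (simp add: field_simps)
  next
    case 5
    have ll: "local_label m j = 21 + 4 * m - j" using 5 p(2) by (auto simp: local_label_def M)
    have n3: "21 + 4 * m - j \<noteq> 3" using p(2) M by linarith
    have lp: "label m p = k * ?M + (21 + 4 * m - j)" using ll n3 lab by simp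
    have lp3: "label m p \<noteq> 3" using lp k3[OF n3] by simp
    have "tau m (label m p) = 4 * real k + tau_local m (21 + 4 * m - j)"
      unfolding lp using 5 by (intro tau_add) (simp add: M)
    then have tl: "tau m (label m p) = 4 * real k + (1 + (18 + 4 * real m - real j) / (6 + 2 * real m))"
      using tau_local_pieces(2)[of "21 + 4 * m - j" m] 5 p(2) M by (simp add: of_nat_diff)
    have "tau_local m j = 3 + (real j - 12 - 2 * real m) / (6 + 2 * real m)" using tau_local_pieces(4)[of m j] 5 by simp
    moreover have "(real j - 12 - 2 * real m) / (6 + 2 * real m) > 0" "(real j - 12 - 2 * real m) / (6 + 2 * real m) < 1"
      using 5 p(2) M t by (simp_all add: field_simps)
    moreover have "(18 + 4 * real m - real j) / (6 + 2 * real m) = 1 - (real j - 12 - 2 * real m) / (6 + 2 * real m)"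
      using t by (simp add: field_simps)
    ultimately show ?thesis using fold_param_b_inv[of k "tau m p"] tp tl lp3 by simp
  qed
qed

lemma label_pos: "label m p > 0"
  using local_label_bounds(2)[of "p mod period m" m] by (simp add: label_def)

lemma fold_param_tau_eq_iff: "fold_param (tau m p) = fold_param (tau m r) \<longleftrightarrow> label m p = label m r"
proof -
  have pos: "tau m (label m x) > 0" for x
    using strict_monoD[OF strict_mono_tau label_pos, of m m x] by (simp add: tau_0)
  have inj: "tau m x = tau m y \<longleftrightarrow> x = y" for x y
    using strict_mono_eq[OF strict_mono_tau] by blast
  show ?thesis unfolding fold_param_tau using pos[of p] pos[of r] inj by auto
qed

text \<open>Subdivision points fold to subdivision points, 0 being \<open>tau m 0\<close>.\<close>

lemma fold_param_tau_not_between: "\<not> (tau m r < fold_param (tau m p) \<and> fold_param (tau m p) < tau m (r + 1))"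
proof -
  have "\<exists>n. fold_param (tau m p) = tau m n" unfolding fold_param_tau using tau_0 by metis
  then obtain n where n: "fold_param (tau m p) = tau m n" by blast
  show ?thesis unfolding n using strict_mono_less[OF strict_mono_tau, of m] by simp
qed

lemma card_first_side:
  assumes "p < g * period m"
  shows "card {r. r < g * period m \<and> first_side m r = first_side m p} = 2"
proof -
  let ?M = "period m"
  have M: "?M = 18 + 4 * m" by (simp add: period_def)
  define fl where "fl j = (if j < 9 + 2 * m then j else if j < 12 + 2 * m then 11 + 2 * m - j else 20 + 4 * m - j)" for j
  \<comment> \<open>The later copy of a side, as a function of its earlier copy.\<close>
  define mir where "mir j = (if j < 3 then 11 + 2 * m - j else 20 + 4 * m - j)" for j
  define k c where "k = p div ?M" and "c = fl (p mod ?M)"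
  have fs: "first_side m (i * ?M + j) = i * ?M + fl j" if "j < ?M" for i j
    using that by (simp add: first_side_def fl_def Let_def)
  have flM: "fl j < ?M" "fl j < 9 + 2 * m" if "j < ?M" for j using that by (auto simp: fl_def M)
  have pj: "p mod ?M < ?M" by simp
  have p: "first_side m p = k * ?M + c" using fs[OF pj, of k] by (simp add: k_def c_def)
  have c: "c < 9 + 2 * m" using flM[OF pj] by (simp add: c_def)
  have k: "k < g" using assms by (simp add: k_def less_mult_imp_div_less)
  have kl: "k * ?M + j < g * ?M" if "j < ?M" for j
  proof -
    have "(k + 1) * ?M \<le> g * ?M" using k by (intro mult_le_mono1) simp
    then show ?thesis using that by simp
  qed
  have mirM: "mir c < ?M" "mir c \<noteq> c" "fl (mir c) = c" "fl c = c" "c < ?M" using c by (auto simp: mir_def fl_def M)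
  have flmir: "j = c \<or> j = mir c" if "j < ?M" "fl j = c" for j
    using that c by (auto simp: fl_def mir_def M split: if_splits)
  have "{r. r < g * ?M \<and> first_side m r = first_side m p} = {k * ?M + c, k * ?M + mir c}"
  proof (intro equalityI subsetI)
    fix r assume r: "r \<in> {r. r < g * ?M \<and> first_side m r = first_side m p}"
    define i j where "i = r div ?M" and "j = r mod ?M"
    have rij: "r = i * ?M + j" "j < ?M" by (simp_all add: i_def j_def)
    have e: "i * ?M + fl j = k * ?M + c" using r fs[OF rij(2), of i] p rij by simp
    have "i = (i * ?M + fl j) div ?M" "fl j = (i * ?M + fl j) mod ?M" using flM[OF rij(2)] by simp_all
    then have "i = k" "fl j = c" using e mirM(5) by simp_all
    then show "r \<in> {k * ?M + c, k * ?M + mir c}" using flmir[OF rij(2)] rij by auto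
  next
    fix r assume "r \<in> {k * ?M + c, k * ?M + mir c}"
    then show "r \<in> {r. r < g * ?M \<and> first_side m r = first_side m p}"
      using fs[OF mirM(1), of k] fs[OF mirM(5), of k] mirM p kl by auto
  qed
  then show ?thesis using mirM(2) by simp
qed

section \<open>The triangulated surface\<close>

lemma affine_image_unit:
  fixes a b :: real
  assumes "a < b"
  shows "(\<lambda>u. (1 - u) * a + u * b) ` {0..1} = {a..b}" "(\<lambda>u. (1 - u) * a + u * b) ` {0<..<1} = {a<..<b}"
  using closed_segment_image_interval[of a b] open_segment_image_interval[of a b] assms
  by (simp_all add: closed_segment_eq_real_ivl open_segment_eq_real_ivl)

lemma doubleton_transfer:
  assumes "\<And>x y. x \<in> S \<Longrightarrow> y \<in> S \<Longrightarrow> f x = f y \<longleftrightarrow> h x = h y" "a \<in> S" "b \<in> S" "c \<in> S" "d \<in> S"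
  shows "{f a, f b} = {f c, f d} \<longleftrightarrow> {h a, h b} = {h c, h d}"
  using assms by (simp add: doubleton_eq_iff)

text \<open>An interior point folds strictly between two consecutive subdivision values, where no
  end can fold, and the two ends have different labels.\<close>

lemma fold_param_inj_side:
  assumes "a \<in> {tau m p..tau m (p + 1)}" "b \<in> {tau m p..tau m (p + 1)}" "fold_param a = fold_param b"
  shows "a = b"
proof -
  have ends: "fold_param (tau m p) \<noteq> fold_param (tau m (p + 1))"
    using side_labels(1)[of m p] by (auto simp: fold_param_tau_eq_iff)
  have mixed: False if "tau m p < x" "x < tau m (p + 1)" "y = tau m p \<or> y = tau m (p + 1)" "fold_param x = fold_param y" for x y
    using fold_param_side[OF that(1,2)] fold_param_tau_not_between[of m "first_side m p"] that(3,4) by metis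
  consider "tau m p < a" "a < tau m (p + 1)" "tau m p < b" "b < tau m (p + 1)"
    | "tau m p < a" "a < tau m (p + 1)" "b = tau m p \<or> b = tau m (p + 1)"
    | "tau m p < b" "b < tau m (p + 1)" "a = tau m p \<or> a = tau m (p + 1)"
    | "a = tau m p \<or> a = tau m (p + 1)" "b = tau m p \<or> b = tau m (p + 1)"
    using assms(1,2) by fastforce
  then show ?thesis
  proof cases
    case 1
    then have "fold_side m p a = fold_side m p b"
      using fold_param_side(1)[OF 1(1,2)] fold_param_side(1)[OF 1(3,4)] assms(3) by simp
    then show ?thesis by (auto simp: fold_side_def split: if_splits)
  next
    case 2
    then show ?thesis using mixed[OF 2] assms(3) by simp
  next
    case 3
    then show ?thesis using mixed[OF 3] assms(3) by simp
  next
    case 4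
    then show ?thesis using ends assms(3) by auto
  qed
qed

section \<open>The subdivided sides in the quotient\<close>

context glued_polygon
begin

abbreviation N :: "nat \<Rightarrow> nat" where "N m \<equiv> g * period m"

lemma tau_range: "p \<le> N m \<Longrightarrow> 0 \<le> tau m p" "p \<le> N m \<Longrightarrow> tau m p \<le> 4 * real g"
  using strict_mono_less_eq[OF strict_mono_tau, of m 0 p] strict_mono_less_eq[OF strict_mono_tau, of m p "N m"]
    tau_period[of m 0 g] by (simp_all add: tau_0)

lemma tau_side_range:
  assumes "p < N m" "x \<in> {tau m p..tau m (p + 1)}"
  shows "0 \<le> x" "x \<le> 4 * real g"
  using tau_range[of p m] tau_range[of "p + 1" m] assms by auto

lemma bpoint_tau_eq_iff:
  assumes "p \<le> N m" "r \<le> N m"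
  shows "bpoint (tau m p) = bpoint (tau m r) \<longleftrightarrow> label m p = label m r"
  using bpoint_eq_iff tau_range assms by (simp add: fold_param_tau_eq_iff)

lemma bpoint_side:
  assumes "p < N m" "x \<in> {tau m p..tau m (p + 1)}"
  shows "bpoint x = bpoint (fold_side m p x)"
proof -
  let ?k = "p div period m"
  have k: "?k < g" using assms(1) by (simp add: less_mult_imp_div_less)
  show ?thesis
    using side_position(2)[of m p]
  proof (elim disjE conjE)
    assume "first_side m p \<noteq> p" "4 * real ?k + 2 \<le> tau m p" "tau m (p + 1) \<le> 4 * real ?k + 3"
      "tau m (first_side m p + 1) = 8 * real ?k + 3 - tau m p"
    then show ?thesis using assms(2) bpoint_a[OF k, of "8 * real ?k + 3 - x"] by (simp add: fold_side_def)
  next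
    assume "first_side m p \<noteq> p" "4 * real ?k + 3 \<le> tau m p" "tau m (p + 1) \<le> 4 * real ?k + 4"
      "tau m (first_side m p + 1) = 8 * real ?k + 5 - tau m p"
    then show ?thesis using assms(2) bpoint_b[OF k, of "8 * real ?k + 5 - x"] by (simp add: fold_side_def)
  qed (simp_all add: fold_side_def)
qed

lemma bpoint_side_image:
  assumes "p < N m"
  shows "bpoint ` {tau m p..tau m (p + 1)} = bpoint ` {tau m (first_side m p)..tau m (first_side m p + 1)}"
  using bpoint_side[OF assms] unfolding fold_side_image[symmetric] image_image by (intro image_cong) auto

lemma bpoint_side_ends:
  assumes "p < N m"
  shows "{bpoint (tau m p), bpoint (tau m (p + 1))} =
    {bpoint (tau m (first_side m p)), bpoint (tau m (first_side m p + 1))}"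
proof (cases "first_side m p = p")
  case False
  have lt: "tau m p < tau m (p + 1)" by (rule side_position(1))
  have "fold_side m p (tau m p) = tau m (first_side m p + 1)" using False by (simp add: fold_side_def)
  moreover have "fold_side m p (tau m (p + 1)) = tau m (first_side m p)"
    using False side_position(2)[of m p] by (auto simp: fold_side_def)
  ultimately have "bpoint (tau m p) = bpoint (tau m (first_side m p + 1))"
    "bpoint (tau m (p + 1)) = bpoint (tau m (first_side m p))"
    using bpoint_side[OF assms, of "tau m p"] bpoint_side[OF assms, of "tau m (p + 1)"] lt by simp_all
  then show ?thesis by (simp add: insert_commute)
qed simp

text \<open>The forward direction says that no two distinct glued sides are parallel: the labels of
  the ends already determine the earlier copy.\<close>

lemma side_ends_eq_iff:
  assumes "p < N m" "r < N m"
  shows "{bpoint (tau m p), bpoint (tau m (p + 1))} = {bpoint (tau m r), bpoint (tau m (r + 1))} \<longleftrightarrow>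
    first_side m p = first_side m r"
proof
  assume "{bpoint (tau m p), bpoint (tau m (p + 1))} = {bpoint (tau m r), bpoint (tau m (r + 1))}"
  then have "{label m p, label m (p + 1)} = {label m r, label m (r + 1)}"
    using doubleton_transfer[of "{..N m}" "\<lambda>x. bpoint (tau m x)" "label m" p "p + 1" r "r + 1"]
      bpoint_tau_eq_iff assms by simp
  then show "first_side m p = first_side m r" by (rule first_side_eq_if_labels_eq)
next
  assume "first_side m p = first_side m r"
  then show "{bpoint (tau m p), bpoint (tau m (p + 1))} = {bpoint (tau m r), bpoint (tau m (r + 1))}"
    using bpoint_side_ends[OF assms(1)] bpoint_side_ends[OF assms(2)] by simp
qed

text \<open>Positions are shifted by one against the corners of the polygon, so that the root triangle of the tree is
  cut off at the corner \<open>0\<close>.\<close>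

definition angle :: "nat \<Rightarrow> nat \<Rightarrow> real" where
  "angle m p = 2 * pi * tau m (p + 1) / real (4 * g)"

lemma circle_points_angle: "circle_points (N m) (angle m)"
proof
  have "angle m p < angle m (Suc p)" for p
    using side_position(1)[of m "p + 1"] g_pos
    by (auto simp: angle_def intro!: divide_strict_right_mono mult_strict_left_mono)
  then show "strict_mono (angle m)" by (simp add: strict_mono_Suc_iff)
  fix p
  have "tau m (p + N m + 1) = tau m (p + 1) + 4 * real g" using tau_period[of m "p + 1" g] by (simp add: ac_simps)
  then show "angle m (p + N m) = angle m p + 2 * pi"
    using g_pos by (simp add: angle_def field_simps)
qed

text \<open>With the shifted numbering, side p starts at position \<open>p + 1\<close>; the last
  side is moved back to 0 so that its parameters stay between 0 and \<open>4 * g\<close>.\<close>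

definition side_start :: "nat \<Rightarrow> nat \<Rightarrow> nat" where
  "side_start m p = (if p + 1 = N m then 0 else p + 1)"

lemma side_start_less: "p < N m \<Longrightarrow> side_start m p < N m"
  using g_pos by (auto simp: side_start_def)

lemma card_side_start:
  assumes "p < N m"
  shows "card {r. r < N m \<and> first_side m (side_start m r) = first_side m (side_start m p)} = 2"
proof -
  let ?N = "N m" and ?c = "first_side m (side_start m p)"
  have inj: "inj_on (side_start m) {r. r < ?N \<and> first_side m (side_start m r) = ?c}"
    by (auto simp: inj_on_def side_start_def split: if_splits)
  have "side_start m ` {r. r < ?N \<and> first_side m (side_start m r) = ?c} = {R. R < ?N \<and> first_side m R = ?c}"
  proof (intro equalityI subsetI)
    fix R assume R: "R \<in> {R. R < ?N \<and> first_side m R = ?c}"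
    define r where "r = (if R = 0 then ?N - 1 else R - 1)"
    have "side_start m r = R" "r < ?N" using R by (auto simp: r_def side_start_def)
    then show "R \<in> side_start m ` {r. r < ?N \<and> first_side m (side_start m r) = ?c}" using R by force
  qed (use side_start_less in auto)
  then show ?thesis using card_image[OF inj] card_first_side[OF side_start_less[OF assms]] by simp
qed

context
  fixes m :: nat
begin

interpretation circle_points "N m" "angle m"
  by (rule circle_points_angle)

lemma pt_angle: "pt p = polygon_boundary g (tau m (p + 1))"
  by (simp add: pt_def angle_def polygon_boundary_def)

lemma edge_path_side:
  assumes "p < N m"
  shows "edge_path p (Suc p) u =
    polygon_boundary g ((1 - u) * tau m (side_start m p) + u * tau m (side_start m p + 1))"
proof -
  have *: "edge_path p (Suc p) u = polygon_boundary g ((1 - u) * tau m (p + 1) + u * tau m (p + 2))"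
  proof -
    have "(1 - u) * angle m p + u * angle m (Suc p) =
        2 * pi * ((1 - u) * tau m (p + 1) + u * tau m (p + 2)) / real (4 * g)"
      by (simp add: angle_def algebra_simps add_divide_distrib diff_divide_distrib)
    then show ?thesis by (simp add: edge_path_def polygon_boundary_def)
  qed
  show ?thesis
  proof (cases "p + 1 = N m")
    case True
    then have "tau m (p + 1) = tau m 0 + 4 * real g" "tau m (p + 2) = tau m 1 + 4 * real g"
      using tau_period[of m 0 g] tau_period[of m 1 g] by (simp_all add: add.commute)
    then have "(1 - u) * tau m (p + 1) + u * tau m (p + 2) = ((1 - u) * tau m 0 + u * tau m 1) + 4 * real g"
      by (simp add: algebra_simps)
    then show ?thesis
      unfolding * using polygon_boundary_period[OF g_pos] True by (simp add: side_start_def)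
  next
    case False
    then show ?thesis unfolding * by (simp add: side_start_def)
  qed
qed

lemma edge_path_side_image:
  assumes "p < N m"
  shows "arc p (Suc p) = polygon_boundary g ` {tau m (side_start m p)..tau m (side_start m p + 1)}"
    "open_arc p (Suc p) = polygon_boundary g ` {tau m (side_start m p)<..<tau m (side_start m p + 1)}"
  unfolding affine_image_unit[OF side_position(1), symmetric] image_image edge_path_side[OF assms] by simp_all

lemma q_pt:
  assumes "p < N m"
  shows "q (pt p) = bpoint (tau m (side_start m p))" "q (pt (Suc p)) = bpoint (tau m (side_start m p + 1))"
    "q (pt p) = bpoint (tau m (p + 1))"
  using edge_path_side[OF assms, of 0] edge_path_side[OF assms, of 1] edge_path_ends[of p "Suc p"]
  by (simp_all add: bpoint_def pt_angle)

lemma q_pt_eq_iff: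
  assumes "p < N m" "r < N m"
  shows "q (pt p) = q (pt r) \<longleftrightarrow> label m (p + 1) = label m (r + 1)"
  using q_pt(3)[OF assms(1)] q_pt(3)[OF assms(2)] bpoint_tau_eq_iff[of "p + 1" m "r + 1"] assms by simp

lemma q_side_ends_eq_iff:
  assumes "p < N m" "r < N m"
  shows "{q (pt p), q (pt (Suc p))} = {q (pt r), q (pt (Suc r))} \<longleftrightarrow>
    first_side m (side_start m p) = first_side m (side_start m r)"
  unfolding q_pt(1,2)[OF assms(1)] q_pt(1,2)[OF assms(2)]
  using side_ends_eq_iff[OF side_start_less[OF assms(1)] side_start_less[OF assms(2)]] .

lemma q_side_image:
  assumes "p < N m"
  shows "q ` arc p (Suc p) = bpoint ` {tau m (side_start m p)..tau m (side_start m p + 1)}"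
    "q ` open_arc p (Suc p) = bpoint ` {tau m (side_start m p)<..<tau m (side_start m p + 1)}"
  unfolding edge_path_side_image[OF assms] image_image bpoint_def by simp_all

text \<open>The open intervals belonging to different earlier copies are disjoint and contain no
  fold of a vertex, which is how open sides are separated from each other and from the
  vertices.\<close>

lemma open_side_fold:
  assumes "p < N m" "z \<in> q ` open_arc p (Suc p)"
  obtains x where "z = bpoint x" "0 \<le> x" "x \<le> 4 * real g"
    "tau m (first_side m (side_start m p)) < fold_param x" "fold_param x < tau m (first_side m (side_start m p) + 1)"
proof -
  obtain x where x: "z = bpoint x" "tau m (side_start m p) < x" "x < tau m (side_start m p + 1)"
    using assms(2) unfolding q_side_image[OF assms(1)] by auto
  then show ?thesis
    using that[of x] fold_param_side[OF x(2,3)] tau_side_range[OF side_start_less[OF assms(1)], of x] by auto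
qed

lemma glued_triangulation_handles:
  assumes "Hausdorff_space X" "quotient_map (top_of_set (cball 0 1)) X q" "g = k + 1"
  shows "glued_triangulation (N m) (angle m) (handles m k) X q"
proof -
  let ?N = "N m"
  have ch: "a < ?N" "b < ?N" if "(a, b) \<in> chords 0 (handles m k)" for a b
    using chords_bounds[OF that] width_handles[of m k] assms(3) by auto
  show ?thesis
  proof
    show "width (handles m k) + 2 = ?N" using width_handles[of m k] assms(3) by simp
    show "handles m k \<noteq> Side" by (cases k) (simp_all add: handle_def zigzag_def)
    show "Hausdorff_space X" "quotient_map (top_of_set (cball 0 1)) X q" by fact+
    show "\<And>x y. x \<in> ball 0 1 \<Longrightarrow> y \<in> cball 0 1 \<Longrightarrow> q x = q y \<Longrightarrow> x = y" by (rule q_inj_ball)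
  next
    fix p assume p: "p < ?N"
    show "inj_on q (arc p (Suc p))"
      unfolding edge_path_side_image[OF p]
    proof
      fix x y assume xy: "x \<in> polygon_boundary g ` {tau m (side_start m p)..tau m (side_start m p + 1)}"
        "y \<in> polygon_boundary g ` {tau m (side_start m p)..tau m (side_start m p + 1)}" "q x = q y"
      then obtain a b where ab: "x = polygon_boundary g a" "y = polygon_boundary g b"
        "a \<in> {tau m (side_start m p)..tau m (side_start m p + 1)}" "b \<in> {tau m (side_start m p)..tau m (side_start m p + 1)}"
        by blast
      have "bpoint a = bpoint b" using xy(3) ab by (simp add: bpoint_def)
      then have "fold_param a = fold_param b"
        using fold_eq_if_bpoint_eq tau_side_range[OF side_start_less[OF p]] ab(3,4) by blast
      then show "x = y" using fold_param_inj_side[OF ab(3,4)] ab(1,2) by simp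
    qed
    show "card {r. r < ?N \<and> {q (pt r), q (pt (Suc r))} = {q (pt p), q (pt (Suc p))}} = 2"
    proof -
      have "{r. r < ?N \<and> {q (pt r), q (pt (Suc r))} = {q (pt p), q (pt (Suc p))}} =
        {r. r < ?N \<and> first_side m (side_start m r) = first_side m (side_start m p)}"
        using q_side_ends_eq_iff[OF _ p] by blast
      then show ?thesis using card_side_start[OF p] by simp
    qed
    fix r assume r: "r < ?N"
    show "q z \<noteq> q (pt r)" if "z \<in> open_arc p (Suc p)" for z
    proof
      assume eq: "q z = q (pt r)"
      have "q z \<in> q ` open_arc p (Suc p)" using that by blast
      then obtain x where x: "q z = bpoint x" "0 \<le> x" "x \<le> 4 * real g"
        "tau m (first_side m (side_start m p)) < fold_param x" "fold_param x < tau m (first_side m (side_start m p) + 1)"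
        by (rule open_side_fold[OF p])
      have "bpoint x = bpoint (tau m (r + 1))" using x(1) eq q_pt(3)[OF r] by simp
      then have "fold_param x = fold_param (tau m (r + 1))"
        using x(2,3) tau_range[of "r + 1" m] r by (intro fold_eq_if_bpoint_eq) auto
      then show False using fold_param_tau_not_between x(4,5) by metis
    qed
    show "q ` arc p (Suc p) = q ` arc r (Suc r)"
      if "{q (pt p), q (pt (Suc p))} = {q (pt r), q (pt (Suc r))}"
    proof -
      have "first_side m (side_start m p) = first_side m (side_start m r)"
        using q_side_ends_eq_iff[OF p r] that by blast
      then show ?thesis
        unfolding q_side_image[OF p] q_side_image[OF r]
        using bpoint_side_image[OF side_start_less[OF p]] bpoint_side_image[OF side_start_less[OF r]] by simp
    qed
    show "q ` open_arc p (Suc p) \<inter> q ` open_arc r (Suc r) = {}"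
      if "{q (pt p), q (pt (Suc p))} \<noteq> {q (pt r), q (pt (Suc r))}"
    proof (rule ccontr)
      assume "q ` open_arc p (Suc p) \<inter> q ` open_arc r (Suc r) \<noteq> {}"
      then obtain z where z: "z \<in> q ` open_arc p (Suc p)" "z \<in> q ` open_arc r (Suc r)" by blast
      define P R where "P = first_side m (side_start m p)" and "R = first_side m (side_start m r)"
      have ne: "P \<noteq> R" using that q_side_ends_eq_iff[OF p r] by (simp add: P_def R_def)
      obtain x where x: "z = bpoint x" "0 \<le> x" "x \<le> 4 * real g" "tau m P < fold_param x" "fold_param x < tau m (P + 1)"
        using open_side_fold[OF p z(1)] unfolding P_def by blast
      obtain y where y: "z = bpoint y" "0 \<le> y" "y \<le> 4 * real g" "tau m R < fold_param y" "fold_param y < tau m (R + 1)"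
        using open_side_fold[OF r z(2)] unfolding R_def by blast
      have "fold_param x = fold_param y" using fold_eq_if_bpoint_eq[of x y] x y by simp
      then have "tau m P < tau m (R + 1)" "tau m R < tau m (P + 1)" using x y by linarith+
      then show False using ne by (simp add: strict_mono_less[OF strict_mono_tau])
    qed
  next
    fix a b assume ab: "(a, b) \<in> chords 0 (handles m k)"
    show "q (pt a) \<noteq> q (pt b)" using chord_label_neq[OF ab] q_pt_eq_iff ch[OF ab] by blast
    show "(a, b) = (c, d)" if cd: "(c, d) \<in> chords 0 (handles m k)" and "{q (pt a), q (pt b)} = {q (pt c), q (pt d)}" for c d
    proof -
      have "{label m (a + 1), label m (b + 1)} = {label m (c + 1), label m (d + 1)}"
        using doubleton_transfer[of "{..<?N}" "\<lambda>x. q (pt x)" "\<lambda>x. label m (x + 1)" a b c d]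
          q_pt_eq_iff ch[OF ab] ch[OF cd] that(2) by simp
      then show ?thesis by (rule chord_label_inj[OF ab cd])
    qed
    show "{q (pt a), q (pt b)} \<noteq> {q (pt p), q (pt (Suc p))}" if p: "p < ?N" for p
    proof -
      have "{label m (a + 1), label m (b + 1)} \<noteq> {label m (side_start m p), label m (side_start m p + 1)}"
        by (rule chord_label_not_side[OF ab])
      then show ?thesis
        unfolding q_pt(1,2)[OF p] q_pt(3)[OF ch(1)[OF ab]] q_pt(3)[OF ch(2)[OF ab]]
        using doubleton_transfer[of "{..?N}" "\<lambda>x. bpoint (tau m x)" "label m" "a + 1" "b + 1" "side_start m p" "side_start m p + 1"]
          bpoint_tau_eq_iff ch[OF ab] side_start_less[OF p] by simp
    qed
  qed
qed

end

end

theorem theorem1: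
  fixes \<Omega> :: "'a topology"
    and A :: "('a set \<times> ('a \<Rightarrow> complex)) set"
    and g n :: nat
  assumes "closed_riemann_surface \<Omega> A"
    and "has_genus \<Omega> g"
    and "g > 0"
    and "n > 0"
  shows "\<exists>V E \<gamma>. surface_triangulation \<Omega> V E \<gamma> \<and> n \<le> card V \<and> nondegenerate_groundstate V E"
proof -
  obtain q where quot: "quotient_map (top_of_set (cball 0 1)) \<Omega> q"
    and q_eq: "\<forall>x\<in>cball 0 1. \<forall>y\<in>cball 0 1. q x = q y \<longleftrightarrow> (x, y) \<in> (side_pairing g \<union> (side_pairing g)\<inverse>)\<^sup>*"
    using assms(2,3) by (auto simp: has_genus_def)
  have Haus: "Hausdorff_space \<Omega>" using assms(1) by (simp add: closed_riemann_surface_def)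
  obtain k where k: "g = k + 1" using assms(3) by (metis Suc_eq_plus1 gr0_implies_Suc)
  interpret poly: glued_polygon g q
    using assms(3) q_eq by unfold_locales auto
  \<comment> \<open>The side b of the first handle alone contributes \<open>5 + 2 * m\<close>
    vertices.\<close>
  define m where "m = n"
  let ?N = "g * period m"
  have N: "?N = (k + 1) * period m" by (simp add: k)
  interpret T: glued_triangulation ?N "poly.angle m" "handles m k" \<Omega> q
    by (rule poly.glued_triangulation_handles[OF Haus quot k])
  have vertex_eq: "T.vertex p = T.vertex r \<longleftrightarrow> label m (p + 1) = label m (r + 1)" if "p < ?N" "r < ?N" for p r
    using poly.q_pt_eq_iff[OF that] by (simp add: T.vertex_def)
  have tri: "T.all_triangles = insert (0, (k + 1) * period m - 2, (k + 1) * period m - 1) (triangles 0 (handles m k))"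
    unfolding N[symmetric] by (rule T.all_triangles_def)
  have "nondegenerate_groundstate T.vertices T.graph_edges"
  proof (rule T.nondegenerate_if_unique[of "\<lambda>p. spin m (p + 1)"])
    show "spin m (p + 1) \<in> {1, - 1}" for p by (simp add: spin_def)
    show "spin m (p + 1) = spin m (r + 1)" if "p < ?N" "r < ?N" "T.vertex p = T.vertex r" for p r
      using vertex_eq[OF that(1,2)] that(3) by (simp add: spin_def)
    show "\<not> (spin m (a + 1) = spin m (b + 1) \<and> spin m (b + 1) = spin m (c + 1))"
      if "(a, b, c) \<in> T.all_triangles" for a b c
      using that unfolding tri by (rule handles_triangle_parity)
  next
    fix \<sigma> assume \<sigma>: "\<sigma> \<in> states T.vertices" "T.satisfied \<sigma>"
    define f where "f p = \<sigma> (T.vertex p)" for p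
    have pm: "f p \<in> {1, - 1}" if "p < (k + 1) * period m" for p
    proof -
      have "p \<le> ?N" using that N by simp
      then show ?thesis
        unfolding f_def using PiE_mem[OF \<sigma>(1)[unfolded states_def] T.vertex_in_vertices] by simp
    qed
    have "f p = - f 2 * spin m (p + 1)" if "p < ?N" for p
    proof (rule handle_unique[OF pm])
      show "f x = f y" if "x < (k + 1) * period m" "y < (k + 1) * period m" "label m (x + 1) = label m (y + 1)" for x y
        using vertex_eq[of x y] that by (simp add: f_def N)
      show "\<not> (f a = f b \<and> f b = f c)" if "(a, b, c) \<in> triangles 0 (handles m k)" for a b c
        using \<sigma>(2) that by (auto simp: T.satisfied_def T.all_triangles_def f_def)
    qed (use that N in simp_all)
    \<comment> \<open>The sign is the opposite of the spin of v, since the reference state has spin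
      -1 there.\<close>
    moreover have "- f 2 \<in> {1, - 1}" using pm[of 2] by (auto simp: period_def)
    ultimately show "\<exists>\<epsilon>\<in>{1, - 1}. \<forall>p<?N. \<sigma> (T.vertex p) = \<epsilon> * spin m (p + 1)"
      unfolding f_def by blast
  qed
  moreover have "n \<le> card T.vertices"
  proof -
    \<comment> \<open>These are the tree positions of b_1, ..., b_(5+2m) on the first copy of b,
      where the labels are the positions themselves and so are distinct.\<close>
    have sub: "{3..<8 + 2 * m} \<subseteq> {..<?N}" by (auto simp: k period_def)
    have "label m (p + 1) = p + 1" if "p \<in> {3..<8 + 2 * m}" for p
      using that label_add[of "p + 1" m 0] by (simp add: local_label_def period_def)
    then have "inj_on T.vertex {3..<8 + 2 * m}"
      using vertex_eq sub by (auto simp: inj_on_def subset_iff)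
    then have "card (T.vertex ` {3..<8 + 2 * m}) = 5 + 2 * m" by (simp add: card_image)
    moreover have "T.vertex ` {3..<8 + 2 * m} \<subseteq> T.vertices" using sub by (auto simp: T.vertices_def)
    then have "card (T.vertex ` {3..<8 + 2 * m}) \<le> card T.vertices" by (intro card_mono) (simp_all add: T.vertices_def)
    ultimately show ?thesis by (simp add: m_def)
  qed
  ultimately show ?thesis using T.surface_triangulation_glued by blast
qed

end
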